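(* Assume that there is $\epsilon>0$ such that for all $i,l$, $\tilde f_{i;\mathrm{res}}(x)=O(\kappa(x)^{-(1+\epsilon)})$ and $\frac{\partial\tilde f_{i;\mathrm{res}}}{\partial x_l}(x)=o(\kappa(x)^{-(1+\epsilon)})$ as $x\in\mathcal{D}$ approaches $\mathcal{E}$. Let $x_\ast\in\mathcal{E}$ be a hyperbolic equilibrium on the horizon for the desingularized vector field $g$ such that $C_\ast:=G(x_\ast)>0$ and $W^s_{\mathrm{loc}}(x_\ast;g)\cap\mathcal{D}\neq\emptyset$, and let $Y_0=r^{\Lambda_\alpha}x_\ast\ne0$, $r=(kC_\ast)^{-1/k}$, be the corresponding root of the balance law $-\frac1k\Lambda_\alpha Y_0+f_{\alpha,k}(Y_0)=0$. Let $A=-\frac1k\Lambda_\alpha+Df_{\alpha,k}(Y_0)$. If $$m:=\dim W^s_{\mathrm{loc}}(x_\ast;g),\qquad m_A:=\sharp\{\lambda\in\mathrm{Spec}(A)\mid \mathrm{Re}\,\lambda<0\}$$ (eigenvalues counted with multiplicity), then $m=m_A+1$.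
   Context: Let $n\ge1$, $\alpha=(\alpha_1,\ldots,\alpha_n)$ positive integers, $k>0$ real, $\Lambda_\alpha=\mathrm{diag}(\alpha_1,\ldots,\alpha_n)$, and $s^{\Lambda_\alpha}=\mathrm{diag}(s^{\alpha_1},\ldots,s^{\alpha_n})$ for $s>0$. The map $f:\mathbb{R}^n\to\mathbb{R}^n$ is $C^r$ with $r\ge2$ and is asymptotically quasi-homogeneous of type $\alpha$ and order $k+1$ at infinity: there is a quasi-homogeneous vector field $f_{\alpha,k}$, i.e. $f_{i;\alpha,k}(s^{\Lambda_\alpha}x)=s^{k+\alpha_i}f_{i;\alpha,k}(x)$ for all $x\in\mathbb{R}^n$, $s>0$, such that $f_i(s^{\Lambda_\alpha}x)-s^{k+\alpha_i}f_{i;\alpha,k}(x)=o(s^{k+\alpha_i})$ as $s\to+\infty$, uniformly for $x$ in the unit sphere. $f_{\alpha,k}$ is $C^1$. Put $f_{\mathrm{res}}=f-f_{\alpha,k}$. Quasi-parabolic compactification: $c$ is the least common multiple of $\alpha_1,\ldots,\alpha_n$, $\beta_i=c/\alpha_i$, $p(x)=\big(\sum_i x_i^{2\beta_i}\big)^{1/(2c)}$, $\mathcal{D}=\{p<1\}$, horizon $\mathcal{E}=\{p=1\}$, $\overline{\mathcal{D}}=\{p\le1\}$, $\kappa(x)=(1-p(x)^{2c})^{-1}$ on $\mathcal D$. On $\mathcal{D}$ put $\tilde f_i(x)=\kappa^{-(k+\alpha_i)}f_i(\kappa^{\Lambda_\alpha}x)$ and $\tilde f_{i;\mathrm{res}}(x)=\kappa^{-(k+\alpha_i)}f_{i;\mathrm{res}}(\kappa^{\Lambda_\alpha}x)$;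 $\tilde f$ is extended continuously to $\mathcal{E}$ by $\tilde f=f_{\alpha,k}$. Put $G(x)=\sum_j\frac{x_j^{2\beta_j-1}}{\alpha_j}\tilde f_j(x)$. The desingularized vector field on $\overline{\mathcal{D}}$ is $$g(x)=\Big(1-\tfrac{2c-1}{2c}(1-p(x)^{2c})\Big)\tilde f(x)-G(x)\Lambda_\alpha x ,$$ with associated ODE $dx/d\tau=g(x)$ and flow $\varphi_g$. Derivatives at points of $\mathcal{E}$ are continuous extensions of the derivatives from $\mathcal{D}$. An equilibrium on the horizon is $x_\ast\in\mathcal{E}$ with $g(x_\ast)=0$; it is hyperbolic if $\mathrm{Spec}(Dg(x_\ast))\cap i\mathbb{R}=\emptyset$. $W^s_{\mathrm{loc}}(x_\ast;g)=\{x\in U\mid|\varphi_g(\tau,x)-x_\ast|\to0\text{ as }\tau\to+\infty\}$, where $U$ is a small neighborhood of $x_\ast$ in $\overline{\mathcal{D}}$; for hyperbolic $x_\ast$ this is the local stable manifold. *)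

theory Defs
  imports
    "HOL-Analysis.Analysis"
    "HOL-Computational_Algebra.Polynomial"
    "HOL-Library.Landau_Symbols"
begin

section \<open>Maps of class \<open>C\<^sup>r\<close> and derivatives up to the boundary\<close>

primrec C_map :: "nat \<Rightarrow> (real^'n \<Rightarrow> real^'n) \<Rightarrow> bool" where
  "C_map 0 F \<longleftrightarrow> continuous_on UNIV F"
| "C_map (Suc r) F \<longleftrightarrow>
     F differentiable_on UNIV \<and>
     (\<forall>l. C_map r (\<lambda>x. frechet_derivative F (at x) (axis l 1)))"

text \<open>The Jacobian matrix of \<open>F\<close> on the open set \<open>S\<close>, extended continuously to points outside \<open>S\<close>.\<close>

definition jacobian_ext :: "(real^'n) set \<Rightarrow> (real^'n \<Rightarrow> real^'n) \<Rightarrow> real^'n \<Rightarrow> real^'n^'n" where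
  "jacobian_ext S F x =
     (if x \<in> S then jacobian F (at x) else Lim (at x within S) (\<lambda>y. jacobian F (at y)))"


section \<open>Complex spectrum of a real matrix\<close>

definition complex_matrix :: "real^'n^'n \<Rightarrow> complex^'n^'n" where
  "complex_matrix A = (\<chi> i j. complex_of_real (A $ i $ j))"

definition Spec :: "real^'n^'n \<Rightarrow> complex set" where
  "Spec A = {z. \<exists>v. v \<noteq> 0 \<and> complex_matrix A *v v = z *s v}"

definition charpoly :: "real^'n^'n \<Rightarrow> complex poly" where
  "charpoly A = det (\<chi> i j. (if i = j then [:0, 1:] else 0) - [:complex_matrix A $ i $ j:])"

definition num_stable_eigenvalues :: "real^'n^'n \<Rightarrow> nat" where
  "num_stable_eigenvalues A = size {#z \<in># proots (charpoly A). Re z < 0#}"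

text \<open>The roots counted above are the elements of the spectrum.\<close>

lemma poly_det: "poly (det B) z = det (\<chi> i j. poly (B $ i $ j) z)"
  for B :: "'a::comm_ring_1 poly^'n^'n"
  by (simp add: det_def poly_sum poly_prod)

lemma poly_charpoly_eq_0_iff: "poly (charpoly A) z = 0 \<longleftrightarrow> z \<in> Spec A"
proof -
  define B where "B = mat z - complex_matrix A"
  have "poly (charpoly A) z = det B"
    unfolding charpoly_def B_def poly_det
    by (rule arg_cong[where f = det]) (simp add: vec_eq_iff mat_def)
  moreover have "det B = 0 \<longleftrightarrow> (\<exists>v. v \<noteq> 0 \<and> B *v v = 0)"
    using invertible_det_nz[of B] invertible_left_inverse[of B] matrix_left_invertible_ker[of B]
    by blast
  moreover have "B *v v = 0 \<longleftrightarrow> complex_matrix A *v v = z *s v" for v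
  proof -
    have "mat z *v v = z *s v"
      by (simp add: vec_eq_iff matrix_vector_mult_def mat_def if_distrib[where f = "\<lambda>x. x * _"]
          cong: if_cong)
    then show ?thesis
      by (auto simp: B_def matrix_vector_mult_diff_rdistrib)
  qed
  ultimately show ?thesis
    by (simp add: Spec_def)
qed


section \<open>Dimension of a set\<close>

text \<open>
  The largest \<open>d\<close> such that the set contains a homeomorphic copy of the open unit ball of a
  \<open>d\<close>-dimensional Euclidean space. For a topological manifold of dimension \<open>m\<close>, possibly with
  boundary, this is \<open>m\<close> (lemma \<open>mdim_manifold\<close>). The set \<open>W_s_loc\<close> below consists of all points of \<open>U\<close>
  whose orbit converges to the equilibrium, including those whose orbit leaves \<open>U\<close> and returns, so
  it may have infinitely many sheets and be only an injectively immersed manifold. By Baire's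
  theorem \<open>mdim\<close> is the dimension of the sheets in that case, too.
\<close>

definition mdim :: "'a::euclidean_space set \<Rightarrow> nat" where
  "mdim S = Max {dim V | V A. subspace (V :: 'a set) \<and> A \<subseteq> S \<and> A homeomorphic (ball 0 1 \<inter> V)}"

text \<open>Taking \<open>a = 0\<close> below gives a full Euclidean chart, \<open>a \<noteq> 0\<close> a half-space chart.\<close>

lemma mdim_manifold:
  fixes S :: "'a::euclidean_space set"
  assumes "S \<noteq> {}"
    and charts: "\<And>x. x \<in> S \<Longrightarrow> \<exists>N V a W. openin (top_of_set S) N \<and> x \<in> N \<and>
          subspace (V :: 'a set) \<and> dim V = m \<and> a \<in> V \<and>
          openin (top_of_set {y \<in> V. 0 \<le> a \<bullet> y}) W \<and> N homeomorphic W"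
  shows "mdim S = m"
  unfolding mdim_def
proof (rule Max_eqI)
  show "finite {dim V | V A. subspace (V :: 'a set) \<and> A \<subseteq> S \<and> A homeomorphic (ball 0 1 \<inter> V)}"
    by (rule finite_subset[of _ "{..DIM('a)}"]) (auto simp: dim_subset_UNIV)
next
  fix d
  assume "d \<in> {dim V | V A. subspace (V :: 'a set) \<and> A \<subseteq> S \<and> A homeomorphic (ball 0 1 \<inter> V)}"
  then obtain V' A where d: "d = dim V'" and V': "subspace (V' :: 'a set)" and A: "A \<subseteq> S"
    and hom: "(ball 0 1 \<inter> V') homeomorphic A"
    using homeomorphic_sym by blast
  obtain h h' where h: "homeomorphism (ball 0 1 \<inter> V') A h h'"
    using hom homeomorphic_def by blast
  have 0: "0 \<in> ball 0 1 \<inter> V'"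
    using V' by (simp add: subspace_0)
  then have "h 0 \<in> S"
    using h A homeomorphism_image1 by blast
  then obtain N V a W where N: "openin (top_of_set S) N" "h 0 \<in> N"
    and V: "subspace (V :: 'a set)" "dim V = m"
    and W: "openin (top_of_set {y \<in> V. 0 \<le> a \<bullet> y}) W" and NW: "N homeomorphic W"
    using charts by metis
  obtain q q' where q: "homeomorphism N W q q'"
    using NW homeomorphic_def by blast
  define T where "T = (ball 0 1 \<inter> V') \<inter> h -` N"
  have conth: "continuous_on (ball 0 1 \<inter> V') h" and imh: "h ` (ball 0 1 \<inter> V') = A"
    using h by (auto simp: homeomorphism_def)
  have "openin (top_of_set (ball 0 1 \<inter> V')) T"
    unfolding T_def
    by (rule continuous_openin_preimage[OF conth _ N(1)]) (use imh A in blast)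
  moreover have "openin (top_of_set V') (ball 0 1 \<inter> V')"
    by (metis inf_commute open_ball openin_open_Int)
  ultimately have oT: "openin (top_of_set V') T"
    using openin_trans by blast
  have "dim V' \<le> dim V"
  proof (rule invariance_of_dimension_subspaces[OF oT V' V(1), of "q \<circ> h"])
    show "continuous_on T (q \<circ> h)"
    proof (rule continuous_on_compose)
      show "continuous_on T h"
        using conth by (rule continuous_on_subset) (auto simp: T_def)
      show "continuous_on (h ` T) q"
        using q by (auto simp: homeomorphism_def T_def intro: continuous_on_subset)
    qed
    have "q ` N = W"
      using q by (simp add: homeomorphism_def)
    moreover have "W \<subseteq> V"
      using W openin_imp_subset by blast
    ultimately show "q \<circ> h \<in> T \<rightarrow> V"
      by (auto simp: T_def)
    have "inj_on h (ball 0 1 \<inter> V')"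
      using h by (metis homeomorphism_apply1 inj_on_inverseI)
    then have "inj_on h T"
      by (rule inj_on_subset) (auto simp: T_def)
    moreover have "inj_on q N"
      using q by (metis homeomorphism_apply1 inj_on_inverseI)
    then have "inj_on q (h ` T)"
      by (rule inj_on_subset) (auto simp: T_def)
    ultimately show "inj_on (q \<circ> h) T"
      by (rule comp_inj_on)
    show "T \<noteq> {}"
      using 0 N(2) unfolding T_def by blast
  qed
  then show "d \<le> m"
    using V d by simp
next
  obtain x where "x \<in> S"
    using \<open>S \<noteq> {}\<close> by blast
  then obtain N V a W where N: "openin (top_of_set S) N" "x \<in> N"
    and V: "subspace (V :: 'a set)" "dim V = m" "a \<in> V"
    and W: "openin (top_of_set {y \<in> V. 0 \<le> a \<bullet> y}) W" and NW: "N homeomorphic W"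
    using charts by metis
  obtain q q' where q: "homeomorphism N W q q'"
    using NW homeomorphic_def by blast
  obtain G where G: "open G" "W = {y \<in> V. 0 \<le> a \<bullet> y} \<inter> G"
    using W by (auto simp: openin_open)
  have y: "q x \<in> W"
    using q N(2) by (auto simp: homeomorphism_def)
  have "((\<lambda>t. q x + t *\<^sub>R a) \<longlongrightarrow> q x + 0 *\<^sub>R a) (at_right 0)"
    by (intro tendsto_intros)
  then have "\<forall>\<^sub>F t in at_right 0. q x + t *\<^sub>R a \<in> G"
    using topological_tendstoD[of _ _ _ G] G y by auto
  then have "\<forall>\<^sub>F t in at_right (0::real). q x + t *\<^sub>R a \<in> G \<and> 0 < t"
    by (intro eventually_conj) (auto simp: eventually_at_right_less)
  then obtain t where t: "q x + t *\<^sub>R a \<in> G" "0 < t"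
    using eventually_happens' trivial_limit_at_right_real by blast
  define z where "z = q x + t *\<^sub>R a"
  have zV: "z \<in> V"
    using V y G by (auto simp: z_def subspace_add subspace_scale)
  have "a = 0 \<or> 0 < a \<bullet> z"
  proof (cases "a = 0")
    case False
    then have "0 < t * (a \<bullet> a)"
      using t by simp
    then show ?thesis
      using y G by (auto simp: z_def inner_add_right)
  qed simp
  then have "z \<in> (if a = 0 then UNIV else {y. 0 < a \<bullet> y}) \<inter> G"
    using t by (auto simp: z_def)
  moreover have "open ((if a = 0 then UNIV else {y. 0 < a \<bullet> y}) \<inter> G)"
    using G open_halfspace_gt[of 0 a] by auto
  ultimately obtain e where e: "e > 0" "ball z e \<subseteq> (if a = 0 then UNIV else {y. 0 < a \<bullet> y}) \<inter> G"
    using open_contains_ball by meson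
  define B where "B = ball z e \<inter> V"
  have BW: "B \<subseteq> W"
    using e unfolding B_def G(2) by (auto split: if_splits simp: subset_iff less_imp_le)
  have "homeomorphism (ball 0 1 \<inter> V) B (\<lambda>y. z + e *\<^sub>R y) (\<lambda>y. (1 / e) *\<^sub>R (y - z))"
  proof (rule homeomorphismI)
    show "(\<lambda>y. z + e *\<^sub>R y) ` (ball 0 1 \<inter> V) \<subseteq> B"
      using e zV V by (auto simp: B_def dist_norm subspace_add subspace_scale)
    show "(\<lambda>y. (1 / e) *\<^sub>R (y - z)) ` B \<subseteq> ball 0 1 \<inter> V"
      using e zV V by (auto simp: B_def dist_norm norm_minus_commute subspace_diff subspace_scale)
  qed (use e in \<open>auto intro!: continuous_intros\<close>)
  then have "(ball 0 1 \<inter> V) homeomorphic B"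
    using homeomorphic_def by blast
  moreover have "B homeomorphic q' ` B"
  proof -
    have "homeomorphism B (q' ` B) q' q"
      by (rule homeomorphism_of_subsets[OF homeomorphism_symD[OF q] BW])
        (use BW q in \<open>auto simp: homeomorphism_def\<close>)
    then show ?thesis
      using homeomorphic_def by blast
  qed
  ultimately have "q' ` B homeomorphic (ball 0 1 \<inter> V)"
    using homeomorphic_trans homeomorphic_sym by blast
  moreover have "q' ` B \<subseteq> S"
    using BW q N openin_imp_subset by (force simp: homeomorphism_def)
  ultimately show
    "m \<in> {dim V | V A. subspace (V :: 'a set) \<and> A \<subseteq> S \<and> A homeomorphic (ball 0 1 \<inter> V)}"
    using V by blast
qed


section \<open>Quasi-homogeneity\<close>

text \<open>\<open>\<Lambda>\<^sub>\<alpha>\<close> and \<open>x \<mapsto> s\<^bsup>\<Lambda>\<^sub>\<alpha>\<^esup>x\<close>\<close>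

definition Lam :: "('n \<Rightarrow> nat) \<Rightarrow> real^'n^'n" where
  "Lam \<alpha> = (\<chi> i j. if i = j then real (\<alpha> i) else 0)"

definition qscale :: "('n \<Rightarrow> nat) \<Rightarrow> real \<Rightarrow> real^'n \<Rightarrow> real^'n" where
  "qscale \<alpha> s x = (\<chi> i. s ^ \<alpha> i * x $ i)"

definition quasi_homogeneous :: "('n \<Rightarrow> nat) \<Rightarrow> real \<Rightarrow> (real^'n \<Rightarrow> real^'n) \<Rightarrow> bool" where
  "quasi_homogeneous \<alpha> k F \<longleftrightarrow>
     (\<forall>x. \<forall>s>0. \<forall>i. F (qscale \<alpha> s x) $ i = s powr (k + real (\<alpha> i)) * F x $ i)"

text \<open>\<open>f\<close> is asymptotically quasi-homogeneous at infinity with principal part \<open>F = f\<^bsub>\<alpha>,k\<^esub>\<close>.\<close>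

definition asymp_quasi_homogeneous ::
    "('n \<Rightarrow> nat) \<Rightarrow> real \<Rightarrow> (real^'n \<Rightarrow> real^'n) \<Rightarrow> (real^'n \<Rightarrow> real^'n) \<Rightarrow> bool" where
  "asymp_quasi_homogeneous \<alpha> k f F \<longleftrightarrow>
     quasi_homogeneous \<alpha> k F \<and>
     (\<forall>i. uniform_limit (sphere 0 1)
        (\<lambda>s x. (f (qscale \<alpha> s x) $ i - s powr (k + real (\<alpha> i)) * F x $ i)
                 / s powr (k + real (\<alpha> i)))
        (\<lambda>x. 0) at_top)"


section \<open>Quasi-parabolic compactification\<close>

definition cc :: "('n \<Rightarrow> nat) \<Rightarrow> nat" where
  "cc \<alpha> = Lcm (range \<alpha>)"

definition \<beta> :: "('n \<Rightarrow> nat) \<Rightarrow> 'n \<Rightarrow> nat" where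
  "\<beta> \<alpha> i = cc \<alpha> div \<alpha> i"

definition pp :: "('n::finite \<Rightarrow> nat) \<Rightarrow> real^'n \<Rightarrow> real" where
  "pp \<alpha> x = root (2 * cc \<alpha>) (\<Sum>i\<in>UNIV. (x $ i) ^ (2 * \<beta> \<alpha> i))"

definition DD :: "('n::finite \<Rightarrow> nat) \<Rightarrow> (real^'n) set" where
  "DD \<alpha> = {x. pp \<alpha> x < 1}"

definition horizon :: "('n::finite \<Rightarrow> nat) \<Rightarrow> (real^'n) set" where
  "horizon \<alpha> = {x. pp \<alpha> x = 1}"

definition DDbar :: "('n::finite \<Rightarrow> nat) \<Rightarrow> (real^'n) set" where
  "DDbar \<alpha> = {x. pp \<alpha> x \<le> 1}"

definition \<kappa> :: "('n::finite \<Rightarrow> nat) \<Rightarrow> real^'n \<Rightarrow> real" where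
  "\<kappa> \<alpha> x = inverse (1 - pp \<alpha> x ^ (2 * cc \<alpha>))"

text \<open>
  Convergence of points of \<open>\<D>\<close> to the horizon; since the closure of \<open>\<D>\<close> is compact, \<open>p(x) \<rightarrow> 1\<close>
  from below is the same as the distance of \<open>x \<in> \<D>\<close> to the horizon tending to \<open>0\<close>.
\<close>

definition to_horizon :: "('n::finite \<Rightarrow> nat) \<Rightarrow> (real^'n) filter" where
  "to_horizon \<alpha> = filtercomap (pp \<alpha>) (at_left 1)"

text \<open>The tilde operation on \<open>\<D>\<close>, applied to \<open>f\<close> and to \<open>f\<^sub>r\<^sub>e\<^sub>s\<close>.\<close>

definition tilde ::
    "('n::finite \<Rightarrow> nat) \<Rightarrow> real \<Rightarrow> (real^'n \<Rightarrow> real^'n) \<Rightarrow> real^'n \<Rightarrow> real^'n" where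
  "tilde \<alpha> k h x =
     (\<chi> i. \<kappa> \<alpha> x powr (- (k + real (\<alpha> i))) * h (qscale \<alpha> (\<kappa> \<alpha> x) x) $ i)"

definition f_tilde ::
    "('n::finite \<Rightarrow> nat) \<Rightarrow> real \<Rightarrow> (real^'n \<Rightarrow> real^'n) \<Rightarrow> (real^'n \<Rightarrow> real^'n)
      \<Rightarrow> real^'n \<Rightarrow> real^'n" where
  "f_tilde \<alpha> k f F x = (if x \<in> DD \<alpha> then tilde \<alpha> k f x else F x)"

definition GG ::
    "('n::finite \<Rightarrow> nat) \<Rightarrow> real \<Rightarrow> (real^'n \<Rightarrow> real^'n) \<Rightarrow> (real^'n \<Rightarrow> real^'n)
      \<Rightarrow> real^'n \<Rightarrow> real" where
  "GG \<alpha> k f F x =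
     (\<Sum>j\<in>UNIV. (x $ j) ^ (2 * \<beta> \<alpha> j - 1) / real (\<alpha> j) * f_tilde \<alpha> k f F x $ j)"

text \<open>The desingularized vector field; only its values on the closure of \<open>\<D>\<close> are meaningful.\<close>

definition desing ::
    "('n::finite \<Rightarrow> nat) \<Rightarrow> real \<Rightarrow> (real^'n \<Rightarrow> real^'n) \<Rightarrow> (real^'n \<Rightarrow> real^'n)
      \<Rightarrow> real^'n \<Rightarrow> real^'n" where
  "desing \<alpha> k f F x =
     (1 - (2 * real (cc \<alpha>) - 1) / (2 * real (cc \<alpha>)) * (1 - pp \<alpha> x ^ (2 * cc \<alpha>)))
         *\<^sub>R f_tilde \<alpha> k f F x
     - GG \<alpha> k f F x *\<^sub>R (Lam \<alpha> *v x)"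


section \<open>Hyperbolic equilibria and local stable sets\<close>

definition hyperbolic_at ::
    "(real^'n) set \<Rightarrow> (real^'n \<Rightarrow> real^'n) \<Rightarrow> real^'n \<Rightarrow> bool" where
  "hyperbolic_at S g x \<longleftrightarrow> Spec (jacobian_ext S g x) \<inter> {z. Re z = 0} = {}"

text \<open>\<open>y\<close> is a forward orbit of \<open>dx/d\<tau> = g(x)\<close> in \<open>K\<close>, starting at \<open>x\<close>.\<close>

definition forward_orbit ::
    "'a::real_normed_vector set \<Rightarrow> ('a \<Rightarrow> 'a) \<Rightarrow> 'a \<Rightarrow> (real \<Rightarrow> 'a) \<Rightarrow> bool" where
  "forward_orbit K g x y \<longleftrightarrow>
     y 0 = x \<and>
     (\<forall>\<tau>\<ge>0. y \<tau> \<in> K \<and> (y has_vector_derivative g (y \<tau>)) (at \<tau> within {0..}))"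

text \<open>
  In the application \<open>g\<close> is \<open>C\<^sup>1\<close> on the compact set \<open>K\<close> and tangent to its boundary, so every point
  of \<open>K\<close> has exactly one forward orbit, \<open>y(\<tau>) = \<phi>\<^sub>g(\<tau>, x)\<close>.
\<close>

definition W_s_loc ::
    "'a::real_normed_vector set \<Rightarrow> ('a \<Rightarrow> 'a) \<Rightarrow> 'a set \<Rightarrow> 'a \<Rightarrow> 'a set" where
  "W_s_loc K g U xs = {x \<in> U. \<exists>y. forward_orbit K g x y \<and> (y \<longlongrightarrow> xs) at_top}"

definition nhd_in :: "'a::topological_space set \<Rightarrow> 'a \<Rightarrow> 'a set \<Rightarrow> bool" where
  "nhd_in K x U \<longleftrightarrow> U \<subseteq> K \<and> (\<exists>V. openin (top_of_set K) V \<and> x \<in> V \<and> V \<subseteq> U)"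

end

theory Submission
  imports Defs "HOL-Computational_Algebra.Fundamental_Theorem_Algebra"
begin

text \<open>
  Extended by 0 across the horizon, the residual part of \<open>f_tilde\<close> is \<open>C\<^sup>1\<close>, so the desingularized field
  \<open>g\<close> is \<open>C\<^sup>1\<close> on the whole space, and \<open>1 - P\<close> with \<open>P = p\<^bsup>2c\<^esup>\<close> satisfies \<open>(1 - P)' = - G (1 - P)\<close> along its
  orbits. At the equilibrium, \<open>Dg\<close> is a rank one update of a matrix conjugate to a positive multiple of
  \<open>A\<close>; the update replaces the positive eigenvalue \<open>k C\<close> by \<open>- C\<close> and keeps all others. Hence
  \<open>m\<^sub>A + 1\<close> is the number of stable eigenvalues of \<open>Dg\<close>.

  That this number is the dimension of the local stable set is shown with a quadratic form \<open>V\<close>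
  that strictly decreases along differences of orbits near the equilibrium and is positive on the
  stable and negative on the unstable subspace. Orbits converging to the equilibrium stay in the cone
  \<open>V \<ge> 0\<close>, so close to the equilibrium the stable set projects injectively to the stable subspace, and
  Wazewski's argument shows that the projection is onto.
\<close>


section \<open>Characteristic polynomials\<close>

text \<open>The added 1 is the direction transversal to the horizon: \<open>Dg\<close> has the
  eigenvalue \<open>- C\<close> there, while the corresponding eigenvalue of \<open>A\<close> is 1
  and reflects a shift of the blow-up time. Since \<open>mdim\<close> asks only for embedded balls,
  no smoothness of the stable manifold is involved: a Lipschitz graph over the stable subspace
  bounds the dimension from below, a continuous injection into that subspace from above. Two
  features of the stable set shape this. Its orbits may leave \<open>U\<close> and return, so the
  upper bound cannot stay near the equilibrium and has to carry a piece of a given ball there by a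
  large time map. And the equilibrium lies on the boundary of the domain, so the ball for the lower
  bound is placed around a point of the stable set in the open domain, which orbits do not leave.
  Multiplicities are handled without generalised eigenspaces: invariant subspaces with a decaying
  quadratic form are taken of maximal dimension, and a count of roots shows that they are large
  enough.\<close>

definition const_mat :: "real^'n^'n \<Rightarrow> complex poly^'n^'n" where
  "const_mat M = (\<chi> i j. [:complex_matrix M $ i $ j:])"

lemma charpoly_alt: "charpoly M = det (mat [:0, 1:] - const_mat M)"
  unfolding charpoly_def const_mat_def
  by (rule arg_cong[where f = det]) (simp add: vec_eq_iff mat_def)

lemma matrix_sub_ldistrib: "A ** (B - C) = A ** B - A ** C"
  and matrix_sub_rdistrib: "(B - C) ** D = B ** D - C ** D"
  for B C :: "'a::ring_1^'n^'m"
  by (simp_all add: matrix_matrix_mult_def vec_eq_iff sum_subtractf algebra_simps)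

lemma const_mat_mult: "const_mat (M ** N) = const_mat M ** const_mat N"
proof -
  have s: "(\<Sum>x\<in>S. [:h x:]) = [:\<Sum>x\<in>S. h x:]" for S :: "'n set" and h :: "'n \<Rightarrow> complex"
    by (induction S rule: infinite_finite_induct) auto
  show ?thesis
    by (simp add: const_mat_def complex_matrix_def matrix_matrix_mult_def vec_eq_iff s mult.commute)
qed

lemma const_mat_add: "const_mat (M + N) = const_mat M + const_mat N"
  by (simp add: const_mat_def complex_matrix_def vec_eq_iff)

lemma const_mat_diff: "const_mat (M - N) = const_mat M - const_mat N"
  by (simp add: const_mat_def complex_matrix_def vec_eq_iff)

lemma const_mat_mat: "const_mat (mat c) = mat [:complex_of_real c:]"
  by (simp add: const_mat_def complex_matrix_def vec_eq_iff mat_def)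

lemma mat_diff: "mat a - mat b = (mat (a - b) :: 'a::ring_1^'n^'n)"
  by (simp add: mat_def vec_eq_iff)

lemma mat_mult_left: "mat a ** M = (\<chi> i j. a * M $ i $ j)" for M :: "'a::comm_ring_1^'n^'n"
  by (simp add: matrix_matrix_mult_def mat_def vec_eq_iff if_distrib[where f = "\<lambda>x. x * _"] cong: if_cong)

lemma mat_mult_right: "M ** mat a = mat a ** M" for M :: "'a::comm_ring_1^'n^'n"
proof -
  have "(\<Sum>l\<in>UNIV. M $ i $ l * (if l = j then a else 0)) = (\<Sum>l\<in>UNIV. if l = j then M $ i $ l * a else 0)" for i j
    by (rule sum.cong) auto
  then show ?thesis
    by (simp add: mat_mult_left vec_eq_iff mult.commute) (simp add: matrix_matrix_mult_def mat_def)
qed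

lemma det_mat: "det (mat a :: 'a::comm_ring_1^'n^'n) = a ^ CARD('n)"
  by (subst det_diagonal) (simp_all add: mat_def)

text \<open>
  Both the passage to an invariant subspace and its quotient, and a rank one perturbation in the
  direction of an eigenvector, are instances.
\<close>

lemma charpoly_mult:
  fixes M N :: "real^'n^'n"
  assumes "(M - mat c) ** (N - mat c) = 0"
  shows "charpoly M * charpoly N = [:- complex_of_real c, 1:] ^ CARD('n) * charpoly (M + N - mat c)"
proof -
  let ?X = "mat [:0, 1:] :: complex poly^'n^'n" and ?Y = "mat [:- complex_of_real c, 1:] :: complex poly^'n^'n"
  define M' N' where "M' = const_mat (M - mat c)" and "N' = const_mat (N - mat c)"
  have Y: "?X - mat [:complex_of_real c:] = ?Y"
    by (simp add: mat_diff)
  have M: "?X - const_mat M = ?Y - M'"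
    unfolding M'_def const_mat_diff const_mat_mat Y[symmetric] by simp
  have N: "?X - const_mat N = ?Y - N'"
    unfolding N'_def const_mat_diff const_mat_mat Y[symmetric] by simp
  have MN: "?X - const_mat (M + N - mat c) = ?Y - M' - N'"
    unfolding N'_def M'_def const_mat_diff const_mat_mat const_mat_add Y[symmetric] by simp
  have "M' ** N' = 0"
    unfolding M'_def N'_def const_mat_mult[symmetric] assms
    by (simp add: const_mat_def complex_matrix_def vec_eq_iff)
  \<comment> \<open>\<open>?Y\<close> is scalar, so it commutes with \<open>M'\<close> and can be
    taken out as a common left factor once \<open>M' ** N'\<close> has vanished.\<close>
  then have "(?Y - M') ** (?Y - N') = ?Y ** (?Y - M' - N')"
    by (simp add: matrix_sub_ldistrib matrix_sub_rdistrib matrix_add_ldistrib mat_mult_right[of M'] algebra_simps)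
  then show ?thesis
    unfolding charpoly_alt M N MN det_mul[symmetric] det_mat[symmetric] by simp
qed

text \<open>In the Leibniz formula the identity permutation contributes a product of monic linear
  factors. Any other permutation moves an index and so picks up a constant entry, which lowers the
  degree.\<close>

lemma charpoly_degree_monic:
  fixes M :: "real^'n^'n"
  shows "degree (charpoly M) = CARD('n)" "lead_coeff (charpoly M) = 1"
proof -
  define E :: "'n \<Rightarrow> 'n \<Rightarrow> complex poly" where
    "E i j = (if i = j then [:0, 1:] else 0) - [:complex_matrix M $ i $ j:]" for i j
  have degE: "degree (E i j) = (if i = j then 1 else 0)" for i j
    by (auto simp: E_def)
  have cp: "charpoly M = (\<Sum>p | p permutes UNIV. of_int (sign p) * (\<Prod>i\<in>UNIV. E i (p i)))"
    by (simp add: charpoly_def det_def E_def)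
  define Q where "Q = (\<Prod>i\<in>UNIV. E i i)"
  have monE: "lead_coeff (E i i) = 1" for i
    using degE[of i i] by (simp add: E_def)
  have nz: "E i i \<noteq> 0" for i
    using monE[of i] by auto
  have "degree Q = CARD('n)"
    unfolding Q_def by (subst degree_prod_sum_eq) (simp_all add: nz degE)
  moreover have "lead_coeff Q = 1"
    unfolding Q_def lead_coeff_prod using monE by simp
  moreover
  define R where "R = (\<Sum>p | p permutes (UNIV::'n set) \<and> p \<noteq> id. of_int (sign p) * (\<Prod>i\<in>UNIV. E i (p i)))"
  have "degree R < CARD('n)"
    unfolding R_def
  proof (rule degree_sum_less)
    fix p assume "p \<in> {p. p permutes (UNIV::'n set) \<and> p \<noteq> id}"
    then obtain i where i: "p i \<noteq> i" by (auto simp: fun_eq_iff)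
    have "degree (\<Prod>i\<in>UNIV. E i (p i)) \<le> (\<Sum>i\<in>UNIV. degree (E i (p i)))"
      by (rule degree_prod_sum_le[unfolded o_def]) simp
    also have "\<dots> < (\<Sum>i\<in>(UNIV::'n set). 1)"
      by (rule sum_strict_mono_ex1) (use i in \<open>auto simp: degE intro!: exI[of _ i]\<close>)
    finally have "degree (\<Prod>i\<in>UNIV. E i (p i)) < CARD('n)" by simp
    moreover have "degree (of_int (sign p) * (\<Prod>i\<in>UNIV. E i (p i))) = degree (\<Prod>i\<in>UNIV. E i (p i))"
      by (cases "evenperm p") (simp_all add: sign_def)
    ultimately show "degree (of_int (sign p) * (\<Prod>i\<in>UNIV. E i (p i))) < CARD('n)" by simp
  qed simp
  moreover have "charpoly M = Q + R"
  proof -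
    have "{p. p permutes (UNIV::'n set)} = insert id {p. p permutes UNIV \<and> p \<noteq> id}"
      by (auto simp: permutes_id)
    then show ?thesis
      unfolding cp R_def Q_def by simp
  qed
  ultimately show "degree (charpoly M) = CARD('n)" "lead_coeff (charpoly M) = 1"
    by (simp_all add: degree_add_eq_left coeff_eq_0)
qed

lemma charpoly_nonzero: "charpoly M \<noteq> 0"
  using charpoly_degree_monic(2)[of M] by auto

lemma charpoly_similar:
  fixes M N S T :: "real^'n^'n"
  assumes "S ** T = mat 1" "M ** S = S ** N"
  shows "charpoly M = charpoly N"
proof -
  let ?X = "mat [:0, 1:] :: complex poly^'n^'n"
  have "(?X - const_mat M) ** const_mat S = const_mat S ** (?X - const_mat N)"
    by (simp add: matrix_sub_ldistrib matrix_sub_rdistrib mat_mult_right const_mat_mult[symmetric] assms)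
  then have "charpoly M * det (const_mat S) = det (const_mat S) * charpoly N"
    unfolding charpoly_alt det_mul[symmetric] by simp
  moreover have "det (const_mat S) * det (const_mat T) = 1"
    unfolding det_mul[symmetric] const_mat_mult[symmetric] assms const_mat_mat
    by (simp add: det_mat flip: one_pCons)
  then have "det (const_mat S) \<noteq> 0" by auto
  ultimately show ?thesis by simp
qed

text \<open>Geometric multiplicity is at most algebraic multiplicity. In a basis that extends one of
  \<open>W\<close>, each basis vector from \<open>W\<close> gives a column equal to \<open>c\<close>
  times a unit vector, hence a factor \<open>X - c\<close> of the determinant.\<close>

lemma kernel_power_dvd_charpoly:
  fixes M :: "real^'n^'n"
  assumes W: "subspace W" and ker: "\<And>x. x \<in> W \<Longrightarrow> M *v x = c *\<^sub>R x"
  shows "[:- complex_of_real c, 1:] ^ dim W dvd charpoly M"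
proof -
  obtain B where B: "B \<subseteq> W" "independent B" "W \<subseteq> span B" "card B = dim W"
    using basis_exists[of W] by metis
  obtain B' where B': "B \<subseteq> B'" "independent B'" "span B' = UNIV"
    using maximal_independent_subset_extend[OF subset_UNIV B(2)] by (metis top.extremum_uniqueI)
  have fin: "finite B'"
    using B'(2) by (rule independent_imp_finite)
  have cardB': "card B' = CARD('n)"
  proof -
    have "dim (UNIV :: (real^'n) set) = card B'"
      by (rule dim_eq_card[OF _ B'(2)]) (simp only: B'(3) span_UNIV)
    then show ?thesis by simp
  qed
  obtain e :: "'n \<Rightarrow> real^'n" where e: "bij_betw e UNIV B'"
    using finite_same_card_bij[of "UNIV::'n set" B'] fin cardB' by auto
  define S :: "real^'n^'n" where "S = (\<chi> i j. e j $ i)"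
  have col: "column j S = e j" for j
    by (simp add: S_def column_def vec_eq_iff)
  have "columns S = B'"
    using e by (auto simp: columns_def col bij_betw_def)
  then obtain T where T: "S ** T = mat 1"
    using B'(3) matrix_right_invertible_span_columns[of S] by (auto simp: span_vec_eq)
  then have TS: "T ** S = mat 1"
    by (simp add: matrix_left_right_inverse)
  define N where "N = T ** M ** S"
  have MS: "M ** S = S ** N"
    unfolding N_def matrix_mul_assoc T by simp
  define I where "I = e -` B"
  have cardI: "card I = dim W"
  proof -
    have "bij_betw e I B"
      unfolding I_def by (rule bij_betw_subset[OF e]) (use e B'(1) in \<open>auto simp: bij_betw_def\<close>)
    then show ?thesis using B(4) by (simp add: bij_betw_same_card)
  qed
  have Ncol: "N $ i $ j = (if i = j then c else 0)" if "j \<in> I" for i j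
  proof -
    have "S *v axis j 1 = e j" for j
      by (simp add: matrix_vector_mult_basis col)
    then have "M *v (S *v axis j 1) = c *\<^sub>R (S *v axis j 1)"
      using that ker[of "e j"] B(1) by (auto simp: I_def)
    then have "N *v axis j 1 = c *\<^sub>R axis j 1"
      unfolding N_def matrix_vector_mul_assoc[symmetric] matrix_vector_mult_scaleR
      by (simp add: matrix_vector_mult_scaleR matrix_vector_mul_assoc TS)
    then have "column j N $ i = (c *\<^sub>R axis j 1) $ i"
      by (simp add: matrix_vector_mult_basis)
    then show ?thesis by (auto simp: column_def axis_def)
  qed
  let ?p = "[:- complex_of_real c, 1:]"
  \<comment> \<open>Transposing turns these columns into rows, from which
    \<open>det_rows_mul\<close> extracts the factors.\<close>
  define Z where "Z = transpose (mat [:0, 1:] - const_mat N)"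
  define Z' where "Z' = (\<chi> j. if j \<in> I then axis j 1 else Z $ j)"
  have "Z = (\<chi> j. (if j \<in> I then ?p else 1) *s Z' $ j)"
  proof -
    have "Z $ j = ?p *s axis j 1" if "j \<in> I" for j
      using that by (auto simp: Z_def transpose_def vec_eq_iff mat_def const_mat_def complex_matrix_def Ncol axis_def)
    then show ?thesis by (simp add: Z'_def vec_eq_iff)
  qed
  then have "det Z = (\<Prod>j\<in>UNIV. (if j \<in> I then ?p else 1)) * det Z'"
    using det_rows_mul[of "\<lambda>j. if j \<in> I then ?p else 1" "\<lambda>j. Z' $ j"] by simp
  also have "(\<Prod>j\<in>UNIV. (if j \<in> I then ?p else 1)) = ?p ^ dim W"
    by (simp add: prod.If_cases cardI)
  also have "det Z = charpoly M"
    unfolding Z_def det_transpose charpoly_alt[symmetric] charpoly_similar[OF T MS] ..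
  finally show ?thesis by simp
qed

section \<open>Stable and unstable subspaces\<close>

definition root_count :: "real \<Rightarrow> complex poly \<Rightarrow> nat" where
  "root_count \<sigma> p = size {#z \<in># proots p. \<sigma> * Re z < 0#}"

lemma num_stable_eigenvalues_root_count: "num_stable_eigenvalues M = root_count 1 (charpoly M)"
  by (simp add: num_stable_eigenvalues_def root_count_def)

lemma root_count_mult:
  "p \<noteq> 0 \<Longrightarrow> q \<noteq> 0 \<Longrightarrow> root_count \<sigma> (p * q) = root_count \<sigma> p + root_count \<sigma> q"
  by (simp add: root_count_def proots_mult)

lemma root_count_linear: "root_count \<sigma> [:- c, 1:] = (if \<sigma> * Re c < 0 then 1 else 0)"
  by (simp add: root_count_def)

lemma root_count_linear_power: "root_count \<sigma> ([:- c, 1:] ^ n) = (if \<sigma> * Re c < 0 then n else 0)"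
proof (induction n)
  case 0
  then show ?case by (simp add: root_count_def)
next
  case (Suc n)
  have "root_count \<sigma> ([:- c, 1:] * [:- c, 1:] ^ n) = root_count \<sigma> [:- c, 1:] + root_count \<sigma> ([:- c, 1:] ^ n)"
    by (rule root_count_mult) auto
  then show ?case
    by (simp only: power_Suc Suc root_count_linear) auto
qed

lemma root_count_le_degree: "root_count \<sigma> p \<le> degree p"
  unfolding root_count_def
  by (rule order_trans[OF size_filter_mset_lesseq size_proots_le])

lemma root_count_eq_0: "(\<And>z. poly p z = 0 \<Longrightarrow> \<sigma> * Re z \<ge> 0) \<Longrightarrow> root_count \<sigma> p = 0"
  by (cases "p = 0") (auto simp: root_count_def filter_mset_eq_conv not_less)

text \<open>The form decreases along \<open>x' = \<sigma> J x\<close>, so \<open>\<sigma> = 1\<close> gives stable and \<open>\<sigma> = -1\<close> unstable subspaces.\<close>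

definition lyapunov_subspace :: "real \<Rightarrow> real^'n^'n \<Rightarrow> (real^'n) set \<Rightarrow> bool" where
  "lyapunov_subspace \<sigma> J P \<longleftrightarrow> subspace P \<and> (\<forall>x\<in>P. J *v x \<in> P) \<and>
     (\<exists>B v. bilinear B \<and> (\<forall>x y. B x y = B y x) \<and> v > 0 \<and>
        (\<forall>x\<in>P. v * (x \<bullet> x) \<le> B x x \<and> \<sigma> * B x (J *v x) \<le> - v * (x \<bullet> x)))"

text \<open>The projection is wanted as a matrix because \<open>Q ** J\<close> will need a
  characteristic polynomial.\<close>

lemma orthogonal_projection_matrix:
  fixes P :: "(real^'n) set"
  assumes "subspace P"
  obtains Q :: "real^'n^'n" where "\<And>x. Q *v x \<in> P" "\<And>x. x \<in> P \<Longrightarrow> Q *v x = x"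
    "\<And>x p. p \<in> P \<Longrightarrow> (x - Q *v x) \<bullet> p = 0"
proof -
  obtain B where B: "B \<subseteq> P" "pairwise orthogonal B" "\<And>x. x \<in> B \<Longrightarrow> norm x = 1"
      "independent B" "card B = dim P" "span B = P"
    by (metis orthonormal_basis_subspace[OF assms])
  have fin: "finite B" using B(4) by (rule independent_imp_finite)
  define f where "f x = (\<Sum>b\<in>B. (b \<bullet> x) *\<^sub>R b)" for x :: "real^'n"
  have lin: "linear f"
    unfolding f_def
    by (intro linear_compose_sum ballI linearI) (simp_all add: inner_add_right scaleR_add_left)
  have fP: "f x \<in> P" for x
    unfolding f_def using B(1) assms by (intro subspace_sum subspace_scale) auto
  have orth: "(x - f x) \<bullet> p = 0" if "p \<in> P" for x p
  proof -
    have orthB: "orthogonal (x - f x) b" if b: "b \<in> B" for b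
    proof -
      have "f x \<bullet> b = (\<Sum>c\<in>B. if c = b then b \<bullet> x else 0)"
        unfolding f_def inner_sum_left
      proof (rule sum.cong)
        fix c assume c: "c \<in> B"
        have "b \<bullet> b = 1" using B(3)[OF b] by (simp add: norm_eq_1)
        then show "(c \<bullet> x) *\<^sub>R c \<bullet> b = (if c = b then b \<bullet> x else 0)"
          using B(2) b c by (auto simp: pairwise_def orthogonal_def)
      qed simp
      also have "\<dots> = b \<bullet> x" using fin b by simp
      finally show ?thesis unfolding orthogonal_def inner_diff_left inner_commute[of x b] by linarith
    qed
    have "p \<in> span B" using that unfolding B(6) .
    then have "orthogonal (x - f x) p"
      using orthB by (rule orthogonal_to_span)
    then show ?thesis unfolding orthogonal_def .
  qed
  have fid: "f x = x" if "x \<in> P" for x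
  proof -
    have "x - f x \<in> P" using that fP assms by (simp add: subspace_diff)
    then have "(x - f x) \<bullet> (x - f x) = 0" by (rule orth)
    then show ?thesis by simp
  qed
  have "matrix f *v x = f x" for x
    using lin by (simp add: matrix_works)
  then show thesis using that[of "matrix f"] fP fid orth by simp
qed

text \<open>Modulo \<open>P\<close>, \<open>x\<close> and \<open>y\<close> are the real and
  imaginary parts of an eigenvector of \<open>J\<close> for \<open>a + i w\<close>. Their span
  \<open>R\<close> is added to \<open>P\<close>. On \<open>R\<close> the form is a multiple of
  \<open>|K \<rho>|^2 + w2 |\<rho>|^2\<close>, where \<open>K\<close> is the part of
  \<open>J\<close> left after removing the component in \<open>P\<close> and the multiple
  \<open>a\<close> of the identity; this is meaningful even if \<open>x\<close> and \<open>y\<close>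
  are linearly dependent. A large multiple \<open>M\<close> absorbs the coupling from
  \<open>R\<close> into \<open>P\<close>.\<close>

lemma lyapunov_subspace_extend:
  fixes J :: "real^'n^'n"
  assumes P: "lyapunov_subspace \<sigma> J P" and \<sigma>: "\<bar>\<sigma>\<bar> = 1" and a: "\<sigma> * a < 0"
    and orthx: "\<And>p. p \<in> P \<Longrightarrow> x \<bullet> p = 0" and orthy: "\<And>p. p \<in> P \<Longrightarrow> y \<bullet> p = 0"
    and Jx: "J *v x - (a *\<^sub>R x - w *\<^sub>R y) \<in> P" and Jy: "J *v y - (w *\<^sub>R x + a *\<^sub>R y) \<in> P"
    and nz: "x \<noteq> 0 \<or> y \<noteq> 0"
  shows "\<exists>P'. lyapunov_subspace \<sigma> J P' \<and> dim P < dim P'"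
proof -
  have subP: "subspace P" and invP: "\<And>p. p \<in> P \<Longrightarrow> J *v p \<in> P"
    using P by (auto simp: lyapunov_subspace_def)
  obtain B v where B: "bilinear B" "\<And>x y. B x y = B y x" "v > 0"
    and Bpos: "\<And>x. x \<in> P \<Longrightarrow> v * (x \<bullet> x) \<le> B x x"
    and Bneg: "\<And>x. x \<in> P \<Longrightarrow> \<sigma> * B x (J *v x) \<le> - v * (x \<bullet> x)"
    using P unfolding lyapunov_subspace_def by blast
  obtain Q :: "real^'n^'n" where Q: "\<And>x. Q *v x \<in> P" "\<And>x. x \<in> P \<Longrightarrow> Q *v x = x"
    "\<And>x p. p \<in> P \<Longrightarrow> (x - Q *v x) \<bullet> p = 0"
    using orthogonal_projection_matrix[OF subP] by blast
  define R where "R = span {x, y}"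
  have R: "\<exists>s t. \<rho> = s *\<^sub>R x + t *\<^sub>R y" if "\<rho> \<in> R" for \<rho>
    using that by (auto simp: R_def span_insert span_singleton algebra_simps)
  have orthR: "\<rho> \<bullet> p = 0" if "\<rho> \<in> R" "p \<in> P" for \<rho> p
    using R[OF that(1)] orthx[OF that(2)] orthy[OF that(2)] by (auto simp: inner_add_left)
  have Q0: "Q *v u = 0" if "\<And>p. p \<in> P \<Longrightarrow> u \<bullet> p = 0" for u
  proof -
    have "u \<bullet> (Q *v u) = 0" "(u - Q *v u) \<bullet> (Q *v u) = 0" using that Q by auto
    then show ?thesis by (simp add: inner_diff_left)
  qed
  define K where "K u = J *v u - Q *v (J *v u) - a *\<^sub>R u" for u
  have linK: "linear K"
    unfolding K_def by (rule linearI) (simp_all add: matrix_vector_right_distrib matrix_vector_mult_scaleR algebra_simps)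
  have Qdec: "Q *v (J *v u) = J *v u - z" if "J *v u - z \<in> P" "\<And>p. p \<in> P \<Longrightarrow> z \<bullet> p = 0" for u z
    using Q(2)[OF that(1)] Q0[OF that(2)] by (simp add: matrix_vector_mult_diff_distrib)
  have Kx: "K x = - w *\<^sub>R y"
    using Qdec[OF Jx] orthx orthy by (simp add: K_def inner_diff_left)
  have Ky: "K y = w *\<^sub>R x"
    using Qdec[OF Jy] orthx orthy by (simp add: K_def inner_add_left)
  have KR: "K \<rho> \<in> R" "K (K \<rho>) = - (w^2) *\<^sub>R \<rho>" if r: "\<rho> \<in> R" for \<rho>
  proof -
    obtain s t where st: "\<rho> = s *\<^sub>R x + t *\<^sub>R y" using R[OF r] by blast
    have 1: "K \<rho> = (- s * w) *\<^sub>R y + (t * w) *\<^sub>R x"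
      by (simp add: st linear_add[OF linK] linear_scale[OF linK] Kx Ky)
    have 2: "K (b *\<^sub>R x + c *\<^sub>R y) = (c * w) *\<^sub>R x - (b * w) *\<^sub>R y" for b c
      by (simp add: linear_add[OF linK] linear_scale[OF linK] Kx Ky)
    show "K \<rho> \<in> R"
      unfolding 1 R_def by (intro span_add span_scale span_base) auto
    show "K (K \<rho>) = - (w^2) *\<^sub>R \<rho>"
      unfolding 1 add.commute[of "(- s * w) *\<^sub>R y" "(t * w) *\<^sub>R x"] 2[of "t * w" "- s * w"]
      by (simp add: st algebra_simps power2_eq_square)
  qed
  \<comment> \<open>Since \<open>K (K \<rho>)\<close> is \<open>- w^2\<close> times
    \<open>\<rho>\<close>, the weight \<open>w^2\<close> makes the rotation \<open>K\<close> neutral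
    for the form. For \<open>w = 0\<close> the map \<open>K\<close> vanishes on \<open>R\<close>,
    and the weight 1 keeps the form definite.\<close>
  define w2 where "w2 = (if w = 0 then 1 else w^2)"
  have w2: "w2 > 0" by (simp add: w2_def)
  have rot: "K \<rho> \<bullet> K (K \<rho>) + w2 * (\<rho> \<bullet> K \<rho>) = 0" if "\<rho> \<in> R" for \<rho>
  proof (cases "w = 0")
    case True
    have "K \<rho> = 0"
      using R[OF that] True by (auto simp: linear_add[OF linK] linear_scale[OF linK] Kx Ky)
    then show ?thesis by (simp add: linear_0[OF linK])
  next
    case False
    then show ?thesis using KR(2)[OF that] by (simp add: w2_def inner_commute)
  qed
  have "bilinear (\<lambda>p \<rho>. B p (Q *v (J *v \<rho>)))"
    using B(1) unfolding bilinear_def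
    by (auto intro!: linearI simp: linear_add linear_scale matrix_vector_right_distrib matrix_vector_mult_scaleR)
  then obtain c where c: "c > 0" "\<And>p \<rho>. norm (B p (Q *v (J *v \<rho>))) \<le> c * norm p * norm \<rho>"
    using bilinear_bounded_pos by blast
  define d where "d = - (\<sigma> * a)"
  have d: "d > 0" using a by (simp add: d_def)
  \<comment> \<open>Of the two summands of \<open>M * d * w2\<close>, \<open>c^2 / (2 * v)\<close>
    absorbs what Young's inequality leaves of the cross term, and \<open>v / 2\<close> remains as
    the decay rate on \<open>R\<close>.\<close>
  define M where "M = (c^2 / (2 * v) + v / 2) / (d * w2)"
  have M: "M > 0" "M * d * w2 = c^2 / (2 * v) + v / 2"
    using c B(3) d w2 by (auto simp: M_def add_pos_pos)
  define B' where "B' \<xi> \<eta> = B (Q *v \<xi>) (Q *v \<eta>)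
    + M * (K (\<xi> - Q *v \<xi>) \<bullet> K (\<eta> - Q *v \<eta>) + w2 * ((\<xi> - Q *v \<xi>) \<bullet> (\<eta> - Q *v \<eta>)))" for \<xi> \<eta>
  define P' where "P' = {p + \<rho> | p \<rho>. p \<in> P \<and> \<rho> \<in> R}"
  have subP': "subspace P'"
    unfolding P'_def R_def by (intro subspace_sums subP subspace_span)
  have bil: "bilinear B'"
    unfolding bilinear_def B'_def
    by (intro conjI allI linearI)
       (simp_all add: bilinear_radd[OF B(1)] bilinear_rmul[OF B(1)] bilinear_ladd[OF B(1)] bilinear_lmul[OF B(1)]
         linear_diff[OF linK] linear_add[OF linK] linear_scale[OF linK]
         matrix_vector_right_distrib matrix_vector_mult_scaleR inner_simps algebra_simps)
  have sym: "B' \<xi> \<eta> = B' \<eta> \<xi>" for \<xi> \<eta>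
    unfolding B'_def by (simp add: B(2)[of "Q *v \<xi>"] inner_commute)
  have JR: "J *v \<rho> = Q *v (J *v \<rho>) + a *\<^sub>R \<rho> + K \<rho>" for \<rho>
    by (simp add: K_def)
  have QR: "Q *v \<rho> = 0" if "\<rho> \<in> R" for \<rho> by (rule Q0) (rule orthR[OF that])
  have scaleR: "c *\<^sub>R \<rho> \<in> R" if "\<rho> \<in> R" for c \<rho> using that by (simp add: R_def span_scale)
  define v' where "v' = min (v / 2) (M * w2)"
  have v': "v' > 0" "v' \<le> v / 2" "v' \<le> M * w2" using B(3) M(1) w2 by (auto simp: v'_def)
  have main: "J *v \<xi> \<in> P' \<and> v' * (\<xi> \<bullet> \<xi>) \<le> B' \<xi> \<xi> \<and> \<sigma> * B' \<xi> (J *v \<xi>) \<le> - v' * (\<xi> \<bullet> \<xi>)" if mem: "\<xi> \<in> P'" for \<xi>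
  proof -
    obtain p \<rho> where p: "p \<in> P" and \<rho>: "\<rho> \<in> R" and \<xi>: "\<xi> = p + \<rho>" using mem by (auto simp: P'_def)
    define e where "e = Q *v (J *v \<rho>)"
    have eP: "e \<in> P" by (simp add: e_def Q)
    have J\<xi>: "J *v \<xi> = (J *v p + e) + (a *\<^sub>R \<rho> + K \<rho>)"
      using JR[of \<rho>] by (simp add: \<xi> e_def matrix_vector_right_distrib add.assoc)
    have r: "a *\<^sub>R \<rho> + K \<rho> \<in> R"
      using scaleR[OF \<rho>] KR(1)[OF \<rho>] unfolding R_def by (rule span_add)
    have 1: "J *v \<xi> \<in> P'"
      unfolding P'_def J\<xi> using r subspace_add[OF subP invP[OF p] eP] by blast
    have Q\<xi>: "Q *v \<xi> = p" by (simp add: \<xi> matrix_vector_right_distrib Q(2)[OF p] QR[OF \<rho>])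
    have QJ\<xi>: "Q *v (J *v \<xi>) = J *v p + e"
      unfolding J\<xi> matrix_vector_right_distrib[of Q "J *v p + e"] QR[OF r] Q(2)[OF subspace_add[OF subP invP[OF p] eP]] by simp
    have diff\<xi>: "\<xi> - p = \<rho>" by (simp add: \<xi>)
    have diffJ: "J *v \<xi> - (J *v p + e) = a *\<^sub>R \<rho> + K \<rho>" by (simp add: J\<xi>)
    have n\<xi>: "\<xi> \<bullet> \<xi> = p \<bullet> p + \<rho> \<bullet> \<rho>"
      using orthR[OF \<rho> p] by (simp add: \<xi> inner_simps inner_commute)
    have "B' \<xi> \<xi> = B p p + M * (K \<rho> \<bullet> K \<rho> + w2 * (\<rho> \<bullet> \<rho>))"
      unfolding B'_def Q\<xi> diff\<xi> ..
    moreover have "M * (w2 * (\<rho> \<bullet> \<rho>)) \<le> M * (K \<rho> \<bullet> K \<rho> + w2 * (\<rho> \<bullet> \<rho>))"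
      using M(1) by (intro mult_left_mono) auto
    moreover have "v' * (p \<bullet> p) \<le> v * (p \<bullet> p)" "v' * (\<rho> \<bullet> \<rho>) \<le> M * w2 * (\<rho> \<bullet> \<rho>)"
      using v' B(3) by (auto intro!: mult_right_mono)
    ultimately have 2: "v' * (\<xi> \<bullet> \<xi>) \<le> B' \<xi> \<xi>"
      using Bpos[OF p] by (simp add: n\<xi> algebra_simps)
    have "B' \<xi> (J *v \<xi>) = B p (J *v p) + B p e + M * (K \<rho> \<bullet> K (a *\<^sub>R \<rho> + K \<rho>) + w2 * (\<rho> \<bullet> (a *\<^sub>R \<rho> + K \<rho>)))"
      unfolding B'_def Q\<xi> QJ\<xi> diff\<xi> diffJ by (simp add: bilinear_radd[OF B(1)])
    also have "\<dots> = B p (J *v p) + B p e + M * a * (K \<rho> \<bullet> K \<rho> + w2 * (\<rho> \<bullet> \<rho>)) + M * (K \<rho> \<bullet> K (K \<rho>) + w2 * (\<rho> \<bullet> K \<rho>))"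
      by (simp add: linear_add[OF linK] linear_scale[OF linK] inner_simps algebra_simps)
    finally have "B' \<xi> (J *v \<xi>) = B p (J *v p) + B p e + M * a * (K \<rho> \<bullet> K \<rho> + w2 * (\<rho> \<bullet> \<rho>))"
      by (simp add: rot[OF \<rho>])
    then have eq: "\<sigma> * B' \<xi> (J *v \<xi>) = \<sigma> * B p (J *v p) + \<sigma> * B p e - M * d * (K \<rho> \<bullet> K \<rho> + w2 * (\<rho> \<bullet> \<rho>))"
      by (simp add: d_def algebra_simps)
    have "\<sigma> * B p e \<le> \<bar>\<sigma>\<bar> * \<bar>B p e\<bar>" by (metis abs_ge_self abs_mult)
    also have "\<dots> \<le> c * norm p * norm \<rho>" using c(2)[of p \<rho>] \<sigma> by (simp add: e_def)
    also have "\<dots> \<le> v / 2 * (p \<bullet> p) + c^2 / (2 * v) * (\<rho> \<bullet> \<rho>)"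
    proof -
      have "0 \<le> (v * norm p - c * norm \<rho>)^2" by simp
      then have "2 * v * (c * norm p * norm \<rho>) \<le> v^2 * (p \<bullet> p) + c^2 * (\<rho> \<bullet> \<rho>)"
        unfolding dot_square_norm by (simp add: power2_eq_square algebra_simps)
      then show ?thesis using B(3) by (simp add: field_simps power2_eq_square)
    qed
    finally have cross: "\<sigma> * B p e \<le> v / 2 * (p \<bullet> p) + c^2 / (2 * v) * (\<rho> \<bullet> \<rho>)" .
    have "M * d * w2 * (\<rho> \<bullet> \<rho>) \<le> M * d * (K \<rho> \<bullet> K \<rho> + w2 * (\<rho> \<bullet> \<rho>))"
      using M(1) d by (simp add: algebra_simps)
    then have "\<sigma> * B' \<xi> (J *v \<xi>) \<le> - v * (p \<bullet> p) + (v / 2 * (p \<bullet> p) + c^2 / (2 * v) * (\<rho> \<bullet> \<rho>)) - (c^2 / (2 * v) + v / 2) * (\<rho> \<bullet> \<rho>)"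
      using eq cross Bneg[OF p] unfolding M(2) by linarith
    also have "\<dots> = - (v / 2) * (\<xi> \<bullet> \<xi>)" by (simp add: n\<xi> algebra_simps)
    also have "\<dots> \<le> - v' * (\<xi> \<bullet> \<xi>)" using mult_right_mono[OF v'(2), of "\<xi> \<bullet> \<xi>"] by simp
    finally show ?thesis using 1 2 by blast
  qed
  have "lyapunov_subspace \<sigma> J P'"
    unfolding lyapunov_subspace_def using subP' bil sym v'(1) main by blast
  moreover have "dim P < dim P'"
  proof -
    have "P \<subseteq> P'" unfolding P'_def R_def using span_zero[of "{x, y}"] by force
    moreover have "x \<in> P'" "y \<in> P'"
    proof -
      have "0 \<in> P" using subP by (rule subspace_0)
      moreover have "x \<in> R" "y \<in> R" by (auto simp: R_def span_base)
      ultimately show "x \<in> P'" "y \<in> P'" unfolding P'_def by force+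
    qed
    moreover have "x \<notin> P \<or> y \<notin> P"
      using nz orthx[of x] orthy[of y] by auto
    ultimately have "P \<subset> P'" by blast
    then show ?thesis
      using subP subP' by (intro dim_psubset) (simp add: span_eq_iff[THEN iffD2])
  qed
  ultimately show ?thesis by blast
qed

section \<open>Root counts as lower bounds for maximal Lyapunov subspaces\<close>

lemma complex_eigenvector_parts:
  fixes M :: "real^'n^'n"
  assumes "poly (charpoly M) z = 0"
  obtains x y where "x \<noteq> 0 \<or> y \<noteq> 0" "M *v x = Re z *\<^sub>R x - Im z *\<^sub>R y" "M *v y = Im z *\<^sub>R x + Re z *\<^sub>R y"
proof -
  obtain b where b: "b \<noteq> 0" "complex_matrix M *v b = z *s b"
    using assms unfolding poly_charpoly_eq_0_iff Spec_def by blast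
  define x y where "x = (\<chi> i. Re (b $ i))" and "y = (\<chi> i. Im (b $ i))"
  have comp: "(\<Sum>j\<in>UNIV. complex_of_real (M $ i $ j) * b $ j) = z * b $ i" for i
    using b(2) by (simp add: vec_eq_iff matrix_vector_mult_def complex_matrix_def)
  have "M *v x = Re z *\<^sub>R x - Im z *\<^sub>R y"
    using arg_cong[OF comp, of Re] by (simp add: vec_eq_iff matrix_vector_mult_def x_def y_def Re_sum)
  moreover have "M *v y = Im z *\<^sub>R x + Re z *\<^sub>R y"
    using arg_cong[OF comp, of Im] by (simp add: vec_eq_iff matrix_vector_mult_def x_def y_def Im_sum add.commute)
  moreover have "x \<noteq> 0 \<or> y \<noteq> 0"
    using b(1) by (auto simp: vec_eq_iff x_def y_def complex_eq_iff)
  ultimately show thesis using that by blast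
qed

text \<open>Rank and nullity: \<open>M\<close> is injective on the orthogonal complement of its
  kernel and maps it into \<open>P\<close>.\<close>

lemma dim_kernel_ge:
  fixes M :: "real^'n^'n"
  assumes "subspace P" "\<And>x. M *v x \<in> P"
  shows "CARD('n) \<le> dim {x. M *v x = 0} + dim P"
proof -
  let ?W = "{x. M *v x = 0}" and ?C = "{y \<in> UNIV. \<forall>x\<in>{x. M *v x = 0}. orthogonal x y}"
  have subW: "subspace ?W"
    by (auto simp: subspace_def matrix_vector_right_distrib matrix_vector_mult_scaleR)
  have subC: "subspace ?C"
    by (auto simp: subspace_def orthogonal_clauses)
  have "dim ?C + dim ?W = dim (UNIV :: (real^'n) set)"
    by (rule dim_subspace_orthogonal_to_vectors[OF subW]) auto
  moreover have "dim ((*v) M ` ?C) = dim ?C"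
  proof (rule dim_image_eq)
    show "inj_on ((*v) M) (span ?C)"
      unfolding span_eq_iff[THEN iffD2, OF subC]
    proof (rule inj_onI)
      fix x y assume xy: "x \<in> ?C" "y \<in> ?C" "M *v x = M *v y"
      then have "x - y \<in> ?C" "x - y \<in> ?W"
        using subspace_diff[OF subC] by (auto simp: matrix_vector_mult_diff_distrib)
      then show "x = y" by (auto simp: orthogonal_def)
    qed
  qed simp
  moreover have "dim ((*v) M ` ?C) \<le> dim P"
    using assms(2) by (intro dim_subset) auto
  ultimately show ?thesis by simp
qed

text \<open>\<open>J\<close> is split into \<open>A1 = J - Q ** J\<close>, which represents the
  action on the quotient by \<open>P\<close>, and \<open>A2 = Q ** J\<close> with range in
  \<open>P\<close>. Invariance of \<open>P\<close> gives \<open>A1 ** A2 = 0\<close>, so up to a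
  power of \<open>X\<close> the characteristic polynomials multiply. A root of \<open>A1\<close> on
  the side chosen by \<open>\<sigma>\<close> would allow \<open>P\<close> to be enlarged, and
  \<open>A2\<close> has at most \<open>dim P\<close> nonzero roots.\<close>

lemma root_count_le_dim_lyapunov_subspace:
  fixes J :: "real^'n^'n"
  assumes P: "lyapunov_subspace \<sigma> J P" and \<sigma>: "\<bar>\<sigma>\<bar> = 1"
    and max: "\<And>P'. lyapunov_subspace \<sigma> J P' \<Longrightarrow> dim P' \<le> dim P"
  shows "root_count \<sigma> (charpoly J) \<le> dim P"
proof -
  have subP: "subspace P" and invP: "\<And>p. p \<in> P \<Longrightarrow> J *v p \<in> P"
    using P by (auto simp: lyapunov_subspace_def)
  obtain Q :: "real^'n^'n" where Q: "\<And>x. Q *v x \<in> P" "\<And>x. x \<in> P \<Longrightarrow> Q *v x = x"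
    "\<And>x p. p \<in> P \<Longrightarrow> (x - Q *v x) \<bullet> p = 0"
    using orthogonal_projection_matrix[OF subP] by blast
  define A1 A2 where "A1 = J - Q ** J" and "A2 = Q ** J"
  have A1: "A1 *v x = J *v x - Q *v (J *v x)" and A2: "A2 *v x = Q *v (J *v x)" for x
    by (simp_all add: A1_def A2_def matrix_vector_mult_diff_rdistrib matrix_vector_mul_assoc)
  have "(A1 - mat 0) ** (A2 - mat 0) = 0"
  proof -
    have "mat 0 = (0 :: real^'n^'n)" by (simp add: mat_def vec_eq_iff)
    moreover have "(A1 ** A2) *v x = 0" for x
      using invP[OF Q(1)] by (simp add: matrix_vector_mul_assoc[symmetric] A1 A2 Q(2))
    ultimately show ?thesis by (simp add: matrix_eq)
  qed
  from charpoly_mult[OF this] have cp: "charpoly A1 * charpoly A2 = [:- 0, 1:] ^ CARD('n) * charpoly J"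
    by (simp add: A1_def A2_def mat_def zero_vec_def[symmetric])
  have 1: "root_count \<sigma> (charpoly A1) + root_count \<sigma> (charpoly A2) = root_count \<sigma> (charpoly J)"
    using arg_cong[OF cp, of "root_count \<sigma>"] root_count_linear_power[of \<sigma> 0 "CARD('n)"]
    by (simp add: root_count_mult charpoly_nonzero)
  have 2: "root_count \<sigma> (charpoly A1) = 0"
  proof (rule root_count_eq_0, rule ccontr)
    fix z assume "poly (charpoly A1) z = 0" and neg: "\<not> \<sigma> * Re z \<ge> 0"
    then obtain x y where xy: "x \<noteq> 0 \<or> y \<noteq> 0"
      "A1 *v x = Re z *\<^sub>R x - Im z *\<^sub>R y" "A1 *v y = Im z *\<^sub>R x + Re z *\<^sub>R y"
      using complex_eigenvector_parts by blast
    let ?a = "Re z" and ?w = "Im z"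
    have a: "?a \<noteq> 0" using neg by auto
    have aw: "?a\<^sup>2 + ?w\<^sup>2 \<noteq> 0" using a by (simp add: sum_power2_eq_zero_iff)
    \<comment> \<open>The range of \<open>A1\<close> is orthogonal to \<open>P\<close>, and so are
      eigenvectors for nonzero eigenvalues. In real terms this is a homogeneous 2 by 2 system with
      determinant \<open>?a\<^sup>2 + ?w\<^sup>2\<close>.\<close>
    have orth: "x \<bullet> p = 0 \<and> y \<bullet> p = 0" if p: "p \<in> P" for p
    proof -
      have "(A1 *v x) \<bullet> p = 0" "(A1 *v y) \<bullet> p = 0" unfolding A1 by (simp_all add: Q(3)[OF p])
      then have e: "?a * (x \<bullet> p) = ?w * (y \<bullet> p)" "?w * (x \<bullet> p) + ?a * (y \<bullet> p) = 0"
        unfolding xy by (simp_all add: inner_simps)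
      have "(?a\<^sup>2 + ?w\<^sup>2) * (x \<bullet> p) = 0" "(?a\<^sup>2 + ?w\<^sup>2) * (y \<bullet> p) = 0"
        using e by algebra+
      then show ?thesis using aw by (metis mult_eq_0_iff)
    qed
    have "\<exists>P'. lyapunov_subspace \<sigma> J P' \<and> dim P < dim P'"
      by (rule lyapunov_subspace_extend[OF P \<sigma>, of ?a x y ?w])
         (use neg orth xy Q(1) in \<open>simp_all flip: xy(2,3) add: A1\<close>)
    then show False using max by fastforce
  qed
  \<comment> \<open>The kernel of \<open>A2\<close> has codimension at most \<open>dim P\<close>, so
    removing the corresponding power of \<open>X\<close> leaves a factor of degree at most
    \<open>dim P\<close>; the removed roots 0 are not counted.\<close>
  have 3: "root_count \<sigma> (charpoly A2) \<le> dim P"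
  proof -
    define W where "W = {x. A2 *v x = 0}"
    have dW: "CARD('n) \<le> dim W + dim P"
      unfolding W_def by (rule dim_kernel_ge[OF subP]) (simp add: A2 Q)
    have "subspace W"
      by (auto simp: W_def subspace_def matrix_vector_right_distrib matrix_vector_mult_scaleR)
    then have "[:- complex_of_real 0, 1:] ^ dim W dvd charpoly A2"
      by (rule kernel_power_dvd_charpoly) (simp add: W_def)
    then obtain s where s: "charpoly A2 = [:- 0, 1:] ^ dim W * s" by (auto elim: dvdE)
    have s0: "s \<noteq> 0" using s charpoly_nonzero[of A2] by auto
    have "degree (charpoly A2) = dim W + degree s"
      unfolding s using s0 by (subst degree_mult_eq) (auto simp: degree_power_eq)
    then have "degree s \<le> dim P" using dW by (simp add: charpoly_degree_monic)
    moreover have "root_count \<sigma> (charpoly A2) = root_count \<sigma> s"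
      unfolding s using s0 root_count_linear_power[of \<sigma> 0 "dim W"] by (subst root_count_mult) auto
    ultimately show ?thesis using root_count_le_degree[of \<sigma> s] by simp
  qed
  show ?thesis using 1 2 3 by simp
qed

lemma lyapunov_subspace_max:
  fixes J :: "real^'n^'n"
  assumes "\<bar>\<sigma>\<bar> = 1"
  obtains P where "lyapunov_subspace \<sigma> J P" "root_count \<sigma> (charpoly J) \<le> dim P"
proof -
  have "lyapunov_subspace \<sigma> J {0}"
    unfolding lyapunov_subspace_def
    by (auto intro!: exI[of _ "(\<bullet>)"] exI[of _ "1::real"] linearI simp: bilinear_def inner_simps inner_commute)
  moreover have "\<And>P. lyapunov_subspace \<sigma> J P \<Longrightarrow> dim P \<le> CARD('n)"
    using dim_subset_UNIV_cart by blast
  ultimately obtain P where "lyapunov_subspace \<sigma> J P" "\<And>P'. lyapunov_subspace \<sigma> J P' \<Longrightarrow> dim P' \<le> dim P"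
    using ex_has_greatest_nat[of "lyapunov_subspace \<sigma> J" "{0}" dim "Suc CARD('n)"] by (metis le_imp_less_Suc)
  then show thesis using that root_count_le_dim_lyapunov_subspace[OF _ assms] by blast
qed

lemma root_count_complementary:
  fixes J :: "real^'n^'n"
  assumes "Spec J \<inter> {z. Re z = 0} = {}"
  shows "root_count 1 (charpoly J) + root_count (- 1) (charpoly J) = CARD('n)"
proof -
  let ?R = "proots (charpoly J)"
  have "Re z \<noteq> 0" if "z \<in># ?R" for z
    using that assms charpoly_nonzero[of J] by (auto simp: poly_charpoly_eq_0_iff)
  then have "filter_mset (\<lambda>z. - 1 * Re z < 0) ?R = filter_mset (\<lambda>z. \<not> 1 * Re z < 0) ?R"
    by (intro filter_mset_cong) (auto simp: not_less less_le)
  then have "root_count 1 (charpoly J) + root_count (- 1) (charpoly J) = size ?R"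
    unfolding root_count_def by (metis multiset_partition size_union)
  then show ?thesis by (simp add: size_proots_complex charpoly_degree_monic)
qed

text \<open>At a maximiser of the ratio of the two forms their derivatives along \<open>J\<close> are proportional,
  although they have opposite signs.\<close>

lemma stable_unstable_trivial_intersection:
  fixes J :: "real^'n^'n"
  assumes P: "lyapunov_subspace 1 J P" and N: "lyapunov_subspace (- 1) J N"
  shows "P \<inter> N = {0}"
proof (rule ccontr)
  let ?M = "P \<inter> N"
  have subM: "subspace ?M" and invM: "\<And>x. x \<in> ?M \<Longrightarrow> J *v x \<in> ?M"
    using P N by (auto simp: lyapunov_subspace_def subspace_inter)
  assume "?M \<noteq> {0}"
  then obtain x0 where x0: "x0 \<in> ?M" "x0 \<noteq> 0" using subspace_0[OF subM] by blast
  obtain B v where B: "bilinear B" "\<And>x y. B x y = B y x" "v > 0"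
    "\<And>x. x \<in> P \<Longrightarrow> v * (x \<bullet> x) \<le> B x x" "\<And>x. x \<in> P \<Longrightarrow> B x (J *v x) \<le> - v * (x \<bullet> x)"
    using P unfolding lyapunov_subspace_def by auto
  obtain D w where D: "bilinear D" "\<And>x y. D x y = D y x" "w > 0"
    "\<And>x. x \<in> N \<Longrightarrow> w * (x \<bullet> x) \<le> D x x" "\<And>x. x \<in> N \<Longrightarrow> - D x (J *v x) \<le> - w * (x \<bullet> x)"
    using N unfolding lyapunov_subspace_def by auto
  have Bp: "B x x > 0" if "x \<in> ?M" "x \<noteq> 0" for x
    using B(4)[of x] that B(3) by (smt (verit) IntD1 inner_gt_zero_iff mult_pos_pos)
  define K where "K = ?M \<inter> sphere 0 1"
  define f where "f x = D x x / B x x" for x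
  have "compact K"
    unfolding K_def using closed_subspace[OF subM] compact_sphere by (intro closed_Int_compact)
  moreover have "K \<noteq> {}"
  proof -
    have "(1 / norm x0) *\<^sub>R x0 \<in> K"
      using x0 subspace_scale[OF subM x0(1)] by (simp add: K_def)
    then show ?thesis by blast
  qed
  moreover have "continuous_on K f"
    unfolding f_def
    by (intro continuous_on_divide bilinear_continuous_on_compose[OF continuous_on_id continuous_on_id]
        B(1) D(1)) (use Bp in \<open>force simp: K_def\<close>)
  ultimately obtain z where z: "z \<in> K" "\<And>x. x \<in> K \<Longrightarrow> f x \<le> f z"
    using continuous_attains_sup by meson
  have zM: "z \<in> ?M" "z \<noteq> 0" using z(1) by (auto simp: K_def)
  define \<mu> where "\<mu> = f z"
  define H where "H x y = \<mu> * B x y - D x y" for x y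
  have H0: "H z z = 0" using Bp[OF zM] by (simp add: H_def \<mu>_def f_def)
  have Hpos: "H x x \<ge> 0" if "x \<in> ?M" for x
  proof (cases "x = 0")
    case True
    then show ?thesis by (simp add: H_def bilinear_lzero[OF B(1)] bilinear_lzero[OF D(1)])
  next
    case False
    define u where "u = (1 / norm x) *\<^sub>R x"
    have xu: "x = norm x *\<^sub>R u" using False by (simp add: u_def)
    have u: "u \<in> K" using False subspace_scale[OF subM that] by (simp add: u_def K_def)
    then have "u \<in> ?M" "u \<noteq> 0" by (auto simp: K_def)
    then have "H u u \<ge> 0" using z(2)[OF u] Bp[of u] by (simp add: H_def \<mu>_def f_def field_simps)
    moreover have "H x x = (norm x)^2 * H u u"
      by (subst (1 2) xu) (simp add: H_def bilinear_lmul[OF B(1)] bilinear_rmul[OF B(1)]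
          bilinear_lmul[OF D(1)] bilinear_rmul[OF D(1)] power2_eq_square algebra_simps)
    ultimately show ?thesis by simp
  qed
  have expand: "H (z + t *\<^sub>R y) (z + t *\<^sub>R y) = 2 * t * H z y + t^2 * H y y" for t y
    using H0 B(2)[of z y] D(2)[of z y]
    by (simp add: H_def bilinear_lmul[OF B(1)] bilinear_rmul[OF B(1)] bilinear_ladd[OF B(1)] bilinear_radd[OF B(1)]
          bilinear_lmul[OF D(1)] bilinear_rmul[OF D(1)] bilinear_ladd[OF D(1)] bilinear_radd[OF D(1)]
          power2_eq_square algebra_simps)
  have "H z y = 0" if y: "y \<in> ?M" for y
  proof (rule ccontr)
    assume nz: "H z y \<noteq> 0"
    \<comment> \<open>The minimum of the quadratic in \<open>t\<close> is at
      \<open>- H z y / H y y\<close>. Adding 1 avoids a zero denominator and still gives a negative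
      value, which contradicts \<open>H \<ge> 0\<close>: a vector on which a semidefinite form
      vanishes lies in its radical.\<close>
    define s where "s = H y y + 1"
    have s: "s > 0" using Hpos[OF y] by (simp add: s_def)
    define t where "t = - H z y / s"
    have "0 \<le> H (z + t *\<^sub>R y) (z + t *\<^sub>R y)"
      by (rule Hpos[OF subspace_add[OF subM zM(1) subspace_scale[OF subM y]]])
    also have "H (z + t *\<^sub>R y) (z + t *\<^sub>R y) = - ((H z y)\<^sup>2 / s\<^sup>2) * (2 * s - H y y)"
      unfolding expand t_def using s by (simp add: field_simps power2_eq_square)
    also have "- ((H z y)\<^sup>2 / s\<^sup>2) * (2 * s - H y y) < 0"
      using nz s Hpos[OF y] by (intro mult_neg_pos) (auto simp: s_def)
    finally show False by simp
  qed
  then have "\<mu> * B z (J *v z) = D z (J *v z)"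
    using invM[OF zM(1)] by (simp add: H_def)
  moreover have "z \<bullet> z > 0" using zM by simp
  then have "B z (J *v z) < 0" "D z (J *v z) > 0"
    using B(5)[of z] D(5)[of z] zM B(3) D(3) by (smt (verit) IntD1 IntD2 mult_pos_pos mult_minus_left)+
  moreover have "D z z > 0"
    using D(4)[of z] zM D(3) \<open>z \<bullet> z > 0\<close> by (smt (verit) IntD2 mult_pos_pos)
  then have "\<mu> > 0" using Bp[OF zM] by (simp add: \<mu>_def f_def)
  ultimately show False by (smt (verit) mult_pos_neg)
qed

text \<open>The root counts bound \<open>dim P\<close> and \<open>dim N\<close> from below and add
  up to the full dimension, while the trivial intersection bounds \<open>dim P + dim N\<close> from
  above. So both bounds are sharp and the space is the direct sum. \<open>V\<close> is the form of
  the stable part minus the form of the unstable part.\<close>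

theorem hyperbolic_splitting:
  fixes J :: "real^'n^'n"
  assumes "Spec J \<inter> {z. Re z = 0} = {}"
  obtains V a Es Eu \<pi> where
    "bilinear V" "\<And>x y. V x y = V y x" "a > 0" "\<And>x. V x (J *v x) \<le> - a * (x \<bullet> x)"
    "subspace Es" "subspace Eu" "dim Es = num_stable_eigenvalues J"
    "linear \<pi>" "\<And>x. \<pi> x \<in> Es" "\<And>x. x - \<pi> x \<in> Eu" "\<And>x. x \<in> Es \<Longrightarrow> \<pi> x = x"
    "\<And>x. x \<in> Es \<Longrightarrow> a * (x \<bullet> x) \<le> V x x" "\<And>x. x \<in> Eu \<Longrightarrow> V x x \<le> - a * (x \<bullet> x)"
    "\<And>x y. x \<in> Es \<Longrightarrow> y \<in> Eu \<Longrightarrow> V x y = 0"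
proof -
  obtain P where P: "lyapunov_subspace 1 J P" "root_count 1 (charpoly J) \<le> dim P"
    using lyapunov_subspace_max[of 1 J] by auto
  obtain N where N: "lyapunov_subspace (- 1) J N" "root_count (- 1) (charpoly J) \<le> dim N"
    using lyapunov_subspace_max[of "- 1" J] by auto
  have subP: "subspace P" and invP: "\<And>x. x \<in> P \<Longrightarrow> J *v x \<in> P"
    and subN: "subspace N" and invN: "\<And>x. x \<in> N \<Longrightarrow> J *v x \<in> N"
    using P N by (auto simp: lyapunov_subspace_def)
  have PN: "P \<inter> N = {0}" by (rule stable_unstable_trivial_intersection[OF P(1) N(1)])
  let ?S = "{x + y | x y. x \<in> P \<and> y \<in> N}"
  have dS: "dim ?S = dim P + dim N"
    using dim_sums_Int[OF subP subN] PN by simp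
  then have le: "dim P + dim N \<le> CARD('n)" using dim_subset_UNIV_cart[of ?S] by simp
  have dP: "dim P = num_stable_eigenvalues J" and dN: "dim P + dim N = CARD('n)"
    using le P(2) N(2) root_count_complementary[OF assms] by (simp_all add: num_stable_eigenvalues_root_count)
  have "?S = UNIV"
    using subspace_dim_equal[OF subspace_sums[OF subP subN] subspace_UNIV] dS dN by simp
  then have "\<forall>x. \<exists>p. p \<in> P \<and> x - p \<in> N" by (auto simp: set_eq_iff) (metis add_diff_cancel_left')
  then obtain \<pi> where \<pi>: "\<And>x. \<pi> x \<in> P" "\<And>x. x - \<pi> x \<in> N" by metis
  have uniq: "\<pi> x = p" if "p \<in> P" "x - p \<in> N" for x p
  proof -
    have "\<pi> x - p \<in> P" using \<pi>(1) that(1) subP by (simp add: subspace_diff)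
    moreover have "(x - p) - (x - \<pi> x) \<in> N" by (intro subspace_diff subN that \<pi>)
    ultimately have "\<pi> x - p \<in> P \<inter> N" by simp
    then show ?thesis using PN by auto
  qed
  have lin: "linear \<pi>"
  proof (rule linearI)
    fix x y and c :: real
    have "(x - \<pi> x) + (y - \<pi> y) \<in> N" by (intro subspace_add subN \<pi>)
    then show "\<pi> (x + y) = \<pi> x + \<pi> y"
      by (intro uniq subspace_add subP \<pi>) (simp add: algebra_simps)
    have "c *\<^sub>R (x - \<pi> x) \<in> N" by (intro subspace_scale subN \<pi>)
    then show "\<pi> (c *\<^sub>R x) = c *\<^sub>R \<pi> x"
      by (intro uniq subspace_scale subP \<pi>) (simp add: algebra_simps)
  qed
  have \<pi>J: "\<pi> (J *v x) = J *v \<pi> x" for x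
    using invP[OF \<pi>(1)[of x]] invN[OF \<pi>(2)[of x]] by (intro uniq) (simp_all add: matrix_vector_mult_diff_distrib)
  have \<pi>P: "\<pi> x = x" if "x \<in> P" for x using that subspace_0[OF subN] by (intro uniq) auto
  have \<pi>N: "\<pi> x = 0" if "x \<in> N" for x using that subspace_0[OF subP] by (intro uniq) auto
  obtain B v where B: "bilinear B" "\<And>x y. B x y = B y x" "v > 0"
    "\<And>x. x \<in> P \<Longrightarrow> v * (x \<bullet> x) \<le> B x x" "\<And>x. x \<in> P \<Longrightarrow> B x (J *v x) \<le> - v * (x \<bullet> x)"
    using P(1) unfolding lyapunov_subspace_def by auto
  obtain D w where D: "bilinear D" "\<And>x y. D x y = D y x" "w > 0"
    "\<And>x. x \<in> N \<Longrightarrow> w * (x \<bullet> x) \<le> D x x" "\<And>x. x \<in> N \<Longrightarrow> - D x (J *v x) \<le> - w * (x \<bullet> x)"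
    using N(1) unfolding lyapunov_subspace_def by auto
  define V where "V x y = B (\<pi> x) (\<pi> y) - D (x - \<pi> x) (y - \<pi> y)" for x y
  \<comment> \<open>The division by 2 pays for the factor 2 in \<open>sq\<close>, since the two
    summands need not be orthogonal for the inner product.\<close>
  define a where "a = min v w / 2"
  have a: "a > 0" "2 * a \<le> v" "2 * a \<le> w" using B(3) D(3) by (auto simp: a_def)
  have sq: "x \<bullet> x \<le> 2 * (\<pi> x \<bullet> \<pi> x) + 2 * ((x - \<pi> x) \<bullet> (x - \<pi> x))" for x
  proof -
    have "(p + u) \<bullet> (p + u) \<le> 2 * (p \<bullet> p) + 2 * (u \<bullet> u)" for p u :: "real^'n"
      using inner_ge_zero[of "p - u"] by (simp add: inner_simps inner_commute)
    from this[of "\<pi> x" "x - \<pi> x"] show ?thesis by simp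
  qed
  show thesis
  proof (rule that[of V a P N \<pi>])
    show "bilinear V"
      unfolding bilinear_def V_def
      by (intro conjI allI linearI)
         (simp_all add: linear_add[OF lin] linear_scale[OF lin] bilinear_radd[OF B(1)] bilinear_rmul[OF B(1)]
           bilinear_ladd[OF B(1)] bilinear_lmul[OF B(1)] bilinear_rsub[OF D(1)] bilinear_lsub[OF D(1)]
           bilinear_radd[OF D(1)] bilinear_rmul[OF D(1)] bilinear_ladd[OF D(1)] bilinear_lmul[OF D(1)] algebra_simps)
    show "V x y = V y x" for x y
      unfolding V_def using B(2) D(2) by metis
    show "V x (J *v x) \<le> - a * (x \<bullet> x)" for x
    proof -
      have "V x (J *v x) = B (\<pi> x) (J *v \<pi> x) - D (x - \<pi> x) (J *v (x - \<pi> x))"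
        by (simp add: V_def \<pi>J matrix_vector_mult_diff_distrib)
      also have "\<dots> \<le> - v * (\<pi> x \<bullet> \<pi> x) - w * ((x - \<pi> x) \<bullet> (x - \<pi> x))"
        using B(5)[OF \<pi>(1)[of x]] D(5)[OF \<pi>(2)[of x]] by simp
      also have "\<dots> \<le> - (2 * a) * (\<pi> x \<bullet> \<pi> x) - (2 * a) * ((x - \<pi> x) \<bullet> (x - \<pi> x))"
        using mult_right_mono[OF a(2), of "\<pi> x \<bullet> \<pi> x"] mult_right_mono[OF a(3), of "(x - \<pi> x) \<bullet> (x - \<pi> x)"] by simp
      also have "\<dots> \<le> - a * (x \<bullet> x)"
        using mult_left_mono[OF sq[of x], of a] a(1) by (simp add: algebra_simps)
      finally show ?thesis .
    qed
    show "a * (x \<bullet> x) \<le> V x x" if "x \<in> P" for x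
      using B(4)[OF that] mult_right_mono[of a v "x \<bullet> x"] a B(3)
      by (simp add: V_def \<pi>P[OF that] bilinear_lzero[OF D(1)])
    show "V x x \<le> - a * (x \<bullet> x)" if "x \<in> N" for x
      using D(4)[OF that] mult_right_mono[of a w "x \<bullet> x"] a D(3)
      by (simp add: V_def \<pi>N[OF that] bilinear_lzero[OF B(1)])
    show "V x y = 0" if "x \<in> P" "y \<in> N" for x y
      using that by (simp add: V_def \<pi>P \<pi>N bilinear_rzero[OF B(1)] bilinear_lzero[OF D(1)])
  qed (use subP subN dP a lin \<pi> \<pi>P in auto)
qed

section \<open>Eigenvalues under rank one updates and conjugation\<close>

lemma mat_vector_mult: "mat a *v x = a *\<^sub>R x" for x :: "real^'n"
  by (simp add: matrix_vector_mult_def mat_def vec_eq_iff if_distrib[where f = "\<lambda>a. a * _"] cong: if_cong)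

text \<open>The matrix \<open>N = s + v w\<close> isolates the rank one part. Its difference to
  \<open>s\<close> has range spanned by \<open>v\<close>, which \<open>B - s\<close> annihilates, so
  \<open>charpoly_mult\<close> applies to \<open>B\<close> and \<open>N\<close>. As \<open>N\<close>
  acts as \<open>s\<close> on the hyperplane \<open>w = 0\<close> and as \<open>t\<close> on
  \<open>v\<close>, its characteristic polynomial is \<open>(X - s)^(n-1) (X - t)\<close>, and
  cancelling powers leaves the claim.\<close>

lemma charpoly_rank_one_update:
  fixes B J :: "real^'n^'n"
  assumes B: "B *v v = s *\<^sub>R v" and w: "linear w" and J: "\<And>h. J *v h = B *v h + w h *\<^sub>R v"
    and Jv: "J *v v = t *\<^sub>R v" and v: "v \<noteq> 0" and st: "s \<noteq> t"
  shows "charpoly J * [:- complex_of_real s, 1:] = charpoly B * [:- complex_of_real t, 1:]"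
proof -
  define M where "M = matrix (\<lambda>h. w h *\<^sub>R v)"
  have "linear (\<lambda>h. w h *\<^sub>R v)"
    by (rule linearI) (simp_all add: linear_add[OF w] linear_scale[OF w] scaleR_add_left)
  then have M: "M *v h = w h *\<^sub>R v" for h by (simp add: M_def matrix_works)
  define N where "N = mat s + M"
  have N: "N *v h = s *\<^sub>R h + w h *\<^sub>R v" for h
    by (simp add: N_def matrix_vector_mult_add_rdistrib mat_vector_mult M)
  have wv: "w v = t - s"
  proof -
    have "(s + w v) *\<^sub>R v = t *\<^sub>R v" using J[of v] B Jv by (simp add: scaleR_add_left)
    then show ?thesis using v by simp
  qed
  have "((B - mat s) ** (N - mat s)) *v h = 0" for h
    by (simp add: matrix_vector_mul_assoc[symmetric] matrix_vector_mult_diff_rdistrib N mat_vector_mult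
        matrix_vector_mult_scaleR B)
  then have "(B - mat s) ** (N - mat s) = 0" by (simp add: matrix_eq)
  moreover have "B + N - mat s = J"
    by (simp add: matrix_eq matrix_vector_mult_diff_rdistrib matrix_vector_mult_add_rdistrib N mat_vector_mult J)
  ultimately have cp: "charpoly B * charpoly N = [:- complex_of_real s, 1:] ^ CARD('n) * charpoly J"
    using charpoly_mult[of B s N] by simp
  define W where "W = {h. w h = 0}"
  have subW: "subspace W"
    by (auto simp: W_def subspace_def linear_add[OF w] linear_scale[OF w] linear_0[OF w])
  have "CARD('n) - 1 \<le> dim W"
  proof -
    obtain u where u: "\<And>h. w h = u \<bullet> h"
      using w by (metis adjoint_works inner_real_def mult.right_neutral inner_commute mult_1)
    have "u \<noteq> 0" using wv st u[of v] by auto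
    then show ?thesis using dim_hyperplane[of u] by (simp add: W_def u)
  qed
  moreover have "dim W \<noteq> CARD('n)"
  proof
    assume "dim W = CARD('n)"
    then have "W = UNIV" using subspace_dim_equal[OF subW subspace_UNIV] by simp
    then have "v \<in> W" by simp
    then show False using wv st by (simp add: W_def)
  qed
  ultimately have dW: "dim W = CARD('n) - 1" using dim_subset_UNIV_cart[of W] by linarith
  have "[:- complex_of_real s, 1:] ^ (CARD('n) - 1) dvd charpoly N"
    unfolding dW[symmetric] by (rule kernel_power_dvd_charpoly[OF subW]) (simp add: N W_def)
  then obtain q where q: "charpoly N = [:- complex_of_real s, 1:] ^ (CARD('n) - 1) * q" by (auto elim: dvdE)
  have q0: "q \<noteq> 0" using q charpoly_nonzero[of N] by auto
  have "CARD('n) = (CARD('n) - 1) + degree q"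
    using charpoly_degree_monic(1)[of N] q0 unfolding q by (subst (asm) degree_mult_eq) (auto simp: degree_power_eq)
  then have "degree q = 1" using zero_less_card_finite[where 'a = 'n] by linarith
  moreover have "lead_coeff q = 1"
    using charpoly_degree_monic(2)[of N] unfolding q lead_coeff_mult lead_coeff_power by simp
  moreover have "poly q (complex_of_real t) = 0"
  proof -
    define b where "b = (\<chi> i. complex_of_real (v $ i))"
    have "N *v v = t *\<^sub>R v" by (simp add: N wv flip: scaleR_add_left)
    then have "(\<Sum>j\<in>UNIV. N $ i $ j * v $ j) = t * v $ i" for i
      by (simp add: vec_eq_iff matrix_vector_mult_def)
    from arg_cong[OF this, of complex_of_real]
    have "complex_matrix N *v b = complex_of_real t *s b"
      by (simp add: vec_eq_iff matrix_vector_mult_def complex_matrix_def b_def)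
    moreover have "b \<noteq> 0" using v by (auto simp: b_def vec_eq_iff)
    ultimately have "poly (charpoly N) (complex_of_real t) = 0"
      unfolding poly_charpoly_eq_0_iff Spec_def by blast
    then show ?thesis using st by (simp add: q)
  qed
  ultimately have "q = [:- complex_of_real t, 1:]"
  proof -
    assume d: "degree q = 1" and l: "lead_coeff q = 1" and r: "poly q (complex_of_real t) = 0"
    obtain x p where p: "q = pCons x p" by (cases q)
    then have "degree p = 0" using d by (auto split: if_splits)
    then obtain y where "p = [:y:]" by (rule degree_eq_zeroE)
    with p have xy: "q = [:x, y:]" by simp
    then have "y = 1" using l d by simp
    then show ?thesis using r xy by (simp add: eq_neg_iff_add_eq_0)
  qed
  with cp q have "charpoly B * ([:- complex_of_real s, 1:] ^ (CARD('n) - 1) * [:- complex_of_real t, 1:])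
    = [:- complex_of_real s, 1:] ^ Suc (CARD('n) - 1) * charpoly J" by simp
  then have "[:- complex_of_real s, 1:] ^ (CARD('n) - 1) * (charpoly B * [:- complex_of_real t, 1:])
    = [:- complex_of_real s, 1:] ^ (CARD('n) - 1) * (charpoly J * [:- complex_of_real s, 1:])"
    by (simp only: power_Suc mult_ac)
  then show ?thesis by (subst (asm) mult_left_cancel) auto
qed

lemma num_stable_eigenvalues_rank_one_update:
  fixes B J :: "real^'n^'n"
  assumes "B *v v = s *\<^sub>R v" "linear w" "\<And>h. J *v h = B *v h + w h *\<^sub>R v"
    and "J *v v = t *\<^sub>R v" "v \<noteq> 0" "s > 0" "t < 0"
  shows "num_stable_eigenvalues J = num_stable_eigenvalues B + 1"
proof -
  have "charpoly J * [:- complex_of_real s, 1:] = charpoly B * [:- complex_of_real t, 1:]"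
    by (rule charpoly_rank_one_update[OF assms(1-5)]) (use assms in simp)
  moreover have "root_count 1 (charpoly M * [:- complex_of_real a, 1:]) = root_count 1 (charpoly M) + (if a < 0 then 1 else 0)"
    for M :: "real^'n^'n" and a
    using root_count_linear[of 1 "complex_of_real a"]
    by (subst root_count_mult[OF charpoly_nonzero]) (simp_all split: if_splits)
  ultimately show ?thesis
    using assms(6,7) by (metis add.right_neutral not_less_iff_gr_or_eq num_stable_eigenvalues_root_count)
qed

text \<open>Substituting \<open>s X\<close> for \<open>X\<close> in the characteristic polynomial of
  \<open>s B\<close> gives \<open>s^n\<close> times that of \<open>B\<close>. Hence the two
  multisets of roots differ by the positive factor \<open>s\<close>, which preserves the sign of
  real parts.\<close>

lemma num_stable_eigenvalues_scaleR:
  fixes B :: "real^'n^'n"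
  assumes s: "s > 0"
  shows "num_stable_eigenvalues (s *\<^sub>R B) = num_stable_eigenvalues B"
proof -
  let ?p = "charpoly (s *\<^sub>R B)" and ?q = "charpoly B" and ?s = "complex_of_real s"
  have s0: "?s \<noteq> 0" using s by simp
  have val: "poly (charpoly M) z = det (\<chi> i j. (if i = j then z else 0) - complex_of_real (M $ i $ j))" for M :: "real^'n^'n" and z
    unfolding charpoly_def poly_det by (rule arg_cong[where f = det]) (simp add: vec_eq_iff complex_matrix_def)
  have "poly ?p (?s * z) = ?s ^ CARD('n) * poly ?q z" for z
  proof -
    let ?A = "(\<chi> i j. (if i = j then z else 0) - complex_of_real (B $ i $ j)) :: complex^'n^'n"
    have "(\<chi> i j. (if i = j then ?s * z else 0) - complex_of_real ((s *\<^sub>R B) $ i $ j)) = (\<chi> i. ?s *s ?A $ i)"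
      by (simp add: vec_eq_iff algebra_simps)
    then show ?thesis unfolding val using det_rows_mul[of "\<lambda>i. ?s" "\<lambda>i. ?A $ i"] by simp
  qed
  then have "poly (?p \<circ>\<^sub>p [:0, ?s:]) = poly (smult (?s ^ CARD('n)) ?q)"
    by (simp add: fun_eq_iff poly_pcompose mult.commute)
  then have eq: "?p \<circ>\<^sub>p [:0, ?s:] = smult (?s ^ CARD('n)) ?q"
    by (simp add: poly_eq_poly_eq_iff)
  have "?p = (\<Prod>x\<in>#proots ?p. [:- x, 1:])"
    using complex_poly_decompose_multiset[of ?p] charpoly_degree_monic(2)[of "s *\<^sub>R B"] by simp
  then have "?p \<circ>\<^sub>p [:0, ?s:] = (\<Prod>x\<in>#proots ?p. [:- x, 1:]) \<circ>\<^sub>p [:0, ?s:]" by simp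
  also have "\<dots> = (\<Prod>x\<in>#proots ?p. [:- x, ?s:])"
  proof -
    have lin: "[:- x, 1:] \<circ>\<^sub>p [:0, ?s:] = [:- x, ?s:]" for x by (simp add: pcompose_pCons)
    have "(\<Prod>x\<in>#X. [:- x, 1:]) \<circ>\<^sub>p [:0, ?s:] = (\<Prod>x\<in>#X. [:- x, ?s:])" for X
      by (induction X) (simp_all add: pcompose_mult lin pcompose_1 del: mult_pCons_left mult_pCons_right)
    then show ?thesis .
  qed
  also have "proots \<dots> = image_mset (\<lambda>x. x / ?s) (proots ?p)"
  proof -
    have lin: "proots [:- x, ?s:] = {#x / ?s#}" for x
    proof -
      have "[:- x, ?s:] = smult ?s [:- (x / ?s), 1:]" using s0 by simp
      then show ?thesis using s0 by (simp del: smult_pCons)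
    qed
    have "proots (\<Prod>x\<in>#X. [:- x, ?s:]) = image_mset (\<lambda>x. x / ?s) X" for X
    proof (induction X)
      case (add x X)
      have "(\<Prod>x\<in>#X. [:- x, ?s:]) \<noteq> 0" using s0 by (auto simp: prod_mset_zero_iff)
      then have "proots ([:- x, ?s:] * (\<Prod>x\<in>#X. [:- x, ?s:])) = proots [:- x, ?s:] + proots (\<Prod>x\<in>#X. [:- x, ?s:])"
        using s0 by (intro proots_mult) auto
      then show ?case using add lin by simp
    qed simp
    then show ?thesis .
  qed
  finally have "proots ?q = image_mset (\<lambda>x. x / ?s) (proots ?p)"
    unfolding eq using s0 by simp
  then show ?thesis
    unfolding num_stable_eigenvalues_def
    using s by (simp add: filter_mset_image_mset divide_less_0_iff)
qed

lemma num_stable_eigenvalues_conjugate: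
  fixes A B S :: "real^'n^'n"
  assumes "invertible S" "A ** S = S ** (s *\<^sub>R B)" "s > 0"
  shows "num_stable_eigenvalues A = num_stable_eigenvalues B"
proof -
  obtain T where "S ** T = mat 1" using assms(1) by (auto simp: invertible_def)
  then have "charpoly A = charpoly (s *\<^sub>R B)" using assms(2) by (rule charpoly_similar)
  then have "num_stable_eigenvalues A = num_stable_eigenvalues (s *\<^sub>R B)"
    by (simp add: num_stable_eigenvalues_def)
  then show ?thesis using num_stable_eigenvalues_scaleR[OF assms(3)] by simp
qed

section \<open>Solutions of differential equations\<close>

text \<open>In contrast to \<open>forward_orbit\<close> nothing is said about staying in a set;
  confinement is a separate argument. The derivative at 0 is one-sided.\<close>

definition solution :: "('a::real_normed_vector \<Rightarrow> 'a) \<Rightarrow> (real \<Rightarrow> 'a) \<Rightarrow> bool" where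
  "solution g y \<longleftrightarrow> (\<forall>t\<ge>0. (y has_vector_derivative g (y t)) (at t within {0..}))"

lemma has_vector_derivative_within_half_line:
  "((y has_vector_derivative d) (at t within {0..})) \<Longrightarrow> 0 < (t::real) \<Longrightarrow> (y has_vector_derivative d) (at t)"
  by (metis at_within_interior greaterThan_iff interior_real_atLeast)

lemma nonincreasing_half_line:
  fixes \<phi> :: "real \<Rightarrow> real"
  assumes der: "\<And>t. t \<ge> 0 \<Longrightarrow> (\<phi> has_vector_derivative \<phi>' t) (at t within {0..})"
    and neg: "\<And>\<tau>. s < \<tau> \<Longrightarrow> \<tau> < t \<Longrightarrow> \<phi>' \<tau> \<le> 0" and st: "0 \<le> s" "s \<le> t"
  shows "\<phi> t \<le> \<phi> s"
proof (rule DERIV_nonpos_imp_decreasing_open[OF st(2)])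
  fix \<tau> assume \<tau>: "s < \<tau>" "\<tau> < t"
  then have "(\<phi> has_vector_derivative \<phi>' \<tau>) (at \<tau>)"
    using der[of \<tau>] st by (intro has_vector_derivative_within_half_line) auto
  then show "\<exists>y. DERIV \<phi> \<tau> :> y \<and> y \<le> 0"
    using neg[OF \<tau>] by (auto simp: has_real_derivative_iff_has_vector_derivative)
next
  have "continuous_on {0..} \<phi>"
    using der by (auto simp: continuous_on_eq_continuous_within intro: has_vector_derivative_continuous)
  then show "continuous_on {s..t} \<phi>"
    by (rule continuous_on_subset) (use st in auto)
qed

text \<open>The squared norm times \<open>exp (- 2 L t)\<close> is nonincreasing, and times
  \<open>exp (2 L t)\<close> nondecreasing. The backward bound is what makes time maps injective and
  keeps orbits from reaching the horizon in finite time.\<close>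

lemma gronwall_two_sided:
  fixes u :: "real \<Rightarrow> 'a::real_inner"
  assumes der: "\<And>t. t \<ge> 0 \<Longrightarrow> (u has_vector_derivative u' t) (at t within {0..})"
    and bound: "\<And>\<tau>. s < \<tau> \<Longrightarrow> \<tau> < t \<Longrightarrow> norm (u' \<tau>) \<le> L * norm (u \<tau>)" and st: "0 \<le> s" "s \<le> t"
  shows "norm (u t) \<le> exp (L * (t - s)) * norm (u s)" "norm (u s) \<le> exp (L * (t - s)) * norm (u t)"
proof -
  have le: "\<bar>u' \<tau> \<bullet> u \<tau>\<bar> \<le> L * (norm (u \<tau>))^2" if "s < \<tau>" "\<tau> < t" for \<tau>
  proof -
    have "\<bar>u' \<tau> \<bullet> u \<tau>\<bar> \<le> norm (u' \<tau>) * norm (u \<tau>)" by (rule Cauchy_Schwarz_ineq2)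
    also have "\<dots> \<le> (L * norm (u \<tau>)) * norm (u \<tau>)" using bound[OF that] by (intro mult_right_mono) auto
    finally show ?thesis by (simp add: power2_eq_square algebra_simps)
  qed
  have dsq: "((\<lambda>t. exp (c * t) * (u t \<bullet> u t)) has_vector_derivative exp (c * t) * (c * (norm (u t))^2 + 2 * (u' t \<bullet> u t))) (at t within {0..})"
    if "t \<ge> 0" for c t :: real
  proof -
    have "((\<lambda>t. u t \<bullet> u t) has_vector_derivative u t \<bullet> u' t + u' t \<bullet> u t) (at t within {0..})"
      by (rule bounded_bilinear.has_vector_derivative[OF bounded_bilinear_inner der[OF that] der[OF that]])
    then show ?thesis
      unfolding has_real_derivative_iff_has_vector_derivative[symmetric]
      by (auto intro!: derivative_eq_intros simp: inner_commute power2_norm_eq_inner algebra_simps)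
  qed
  have scale: "norm p \<le> exp (L * (t - s)) * norm q" if "exp c * (p \<bullet> p) \<le> exp d * (q \<bullet> q)" "d - c = 2 * L * (t - s)"
    for p q :: 'a and c d
  proof -
    have "p \<bullet> p \<le> exp (d - c) * (q \<bullet> q)" using that(1) by (simp add: exp_diff field_simps)
    also have "exp (d - c) = (exp (L * (t - s)))^2" using that(2) by (simp add: mult.assoc flip: exp_double)
    finally have "(norm p)^2 \<le> (exp (L * (t - s)) * norm q)^2"
      by (simp add: power2_norm_eq_inner power_mult_distrib)
    then show ?thesis by (rule power2_le_imp_le) simp
  qed
  have "exp (- (2 * L) * t) * (u t \<bullet> u t) \<le> exp (- (2 * L) * s) * (u s \<bullet> u s)"
  proof (rule nonincreasing_half_line[OF dsq _ st])
    fix \<tau> assume "s < \<tau>" "\<tau> < t"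
    then have "- (2 * L) * (norm (u \<tau>))\<^sup>2 + 2 * (u' \<tau> \<bullet> u \<tau>) \<le> 0" using le[of \<tau>] by linarith
    then show "exp (- (2 * L) * \<tau>) * (- (2 * L) * (norm (u \<tau>))\<^sup>2 + 2 * (u' \<tau> \<bullet> u \<tau>)) \<le> 0"
      by (simp add: mult_le_0_iff)
  qed
  then show "norm (u t) \<le> exp (L * (t - s)) * norm (u s)" by (rule scale) (simp add: algebra_simps)
  have "- (exp ((2 * L) * t) * (u t \<bullet> u t)) \<le> - (exp ((2 * L) * s) * (u s \<bullet> u s))"
  proof (rule nonincreasing_half_line[OF has_vector_derivative_minus[OF dsq] _ st])
    fix \<tau> assume "s < \<tau>" "\<tau> < t"
    then have "0 \<le> (2 * L) * (norm (u \<tau>))\<^sup>2 + 2 * (u' \<tau> \<bullet> u \<tau>)" using le[of \<tau>] by linarith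
    then show "- (exp ((2 * L) * \<tau>) * ((2 * L) * (norm (u \<tau>))\<^sup>2 + 2 * (u' \<tau> \<bullet> u \<tau>))) \<le> 0" by simp
  qed
  then show "norm (u s) \<le> exp (L * (t - s)) * norm (u t)"
    by (intro scale[of "2 * L * s" _ "2 * L * t"]) (simp_all add: algebra_simps)
qed

lemma solutionD: "solution g y \<Longrightarrow> t \<ge> 0 \<Longrightarrow> (y has_vector_derivative g (y t)) (at t within {0..})"
  unfolding solution_def by blast

lemma solution_continuous:
  assumes "solution g y"
  shows "continuous_on {0..} y"
  unfolding continuous_on_eq_continuous_within
proof
  fix t :: real assume "t \<in> {0..}"
  then have "t \<ge> 0" by simp
  from solutionD[OF assms this] show "continuous (at t within {0..}) y"
    by (rule has_vector_derivative_continuous)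
qed

lemma solution_shift:
  assumes "solution g y" "T \<ge> 0"
  shows "solution g (\<lambda>t. y (T + t))"
  unfolding solution_def
proof (intro allI impI)
  fix t :: real assume t: "t \<ge> 0"
  have "(y has_vector_derivative g (y (T + t))) (at (T + t) within (\<lambda>t. T + t) ` {0..})"
    by (rule has_vector_derivative_within_subset[OF solutionD[OF assms(1)]]) (use assms t in auto)
  then have "((y \<circ> (\<lambda>t. T + t)) has_vector_derivative 1 *\<^sub>R g (y (T + t))) (at t within {0..})"
    by (intro vector_diff_chain_within) (auto intro!: derivative_eq_intros)
  then show "((\<lambda>t. y (T + t)) has_vector_derivative g (y (T + t))) (at t within {0..})"
    by (simp add: o_def)
qed

lemma solution_diff_bounds:
  fixes g :: "'a::real_inner \<Rightarrow> 'a"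
  assumes "solution g y" "solution g z" "L-lipschitz_on S g"
    and "\<And>t. t \<ge> 0 \<Longrightarrow> y t \<in> S" "\<And>t. t \<ge> 0 \<Longrightarrow> z t \<in> S" and st: "0 \<le> s" "s \<le> t"
  shows "norm (y t - z t) \<le> exp (L * (t - s)) * norm (y s - z s)"
    "norm (y s - z s) \<le> exp (L * (t - s)) * norm (y t - z t)"
proof -
  have der: "((\<lambda>t. y t - z t) has_vector_derivative g (y t) - g (z t)) (at t within {0..})" if "t \<ge> 0" for t
    by (intro has_vector_derivative_diff solutionD assms that)
  have bd: "norm (g (y \<tau>) - g (z \<tau>)) \<le> L * norm (y \<tau> - z \<tau>)" if "s < \<tau>" for \<tau>
    using lipschitz_onD[OF assms(3), of "y \<tau>" "z \<tau>"] assms(4,5)[of \<tau>] that st by (simp add: dist_norm)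
  show "norm (y t - z t) \<le> exp (L * (t - s)) * norm (y s - z s)"
    "norm (y s - z s) \<le> exp (L * (t - s)) * norm (y t - z t)"
    using gronwall_two_sided[OF der bd st] by auto
qed

section \<open>Global existence\<close>

lemma integral_has_vector_derivative_half_line:
  fixes q :: "real \<Rightarrow> 'a::banach"
  assumes q: "continuous_on {0..} q" and t: "t \<ge> 0"
  shows "((\<lambda>t. integral {0..t} q) has_vector_derivative q t) (at t within {0..})"
proof -
  have "continuous_on {0..t+1} q" by (rule continuous_on_subset[OF q]) auto
  then have "((\<lambda>t. integral {0..t} q) has_vector_derivative q t) (at t within {0..t+1})"
    using t by (intro integral_has_vector_derivative) auto
  moreover have "at t within {0..t+1} = at t within {0..}"
    by (rule at_within_nhd[of _ "{..<t+1}"]) auto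
  ultimately show ?thesis by simp
qed

lemma norm_integral_exp_le:
  fixes q :: "real \<Rightarrow> 'a::banach"
  assumes q: "continuous_on {0..} q" and t: "t \<ge> 0" and K: "K > 0" and c: "c \<ge> 0"
    and bound: "\<And>s. s \<ge> 0 \<Longrightarrow> norm (q s) \<le> c * exp (K * s)"
  shows "norm (integral {0..t} q) \<le> c / K * exp (K * t)"
proof -
  have "((\<lambda>s. c * exp (K * s)) has_integral (c / K * exp (K * t) - c / K * exp (K * 0))) {0..t}"
    by (rule fundamental_theorem_of_calculus[OF t])
       (use K in \<open>auto intro!: derivative_eq_intros simp flip: has_real_derivative_iff_has_vector_derivative\<close>)
  then have "integral {0..t} (\<lambda>s. c * exp (K * s)) = c / K * exp (K * t) - c / K * exp (K * 0)"
    by (rule integral_unique)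
  moreover have "norm (integral {0..t} q) \<le> integral {0..t} (\<lambda>s. c * exp (K * s))"
    by (intro integral_norm_bound_integral integrable_continuous_real continuous_on_subset[OF q] continuous_intros bound) auto
  ultimately have "norm (integral {0..t} q) \<le> c / K * exp (K * t) - c / K * exp (K * 0)" by simp
  also have "\<dots> \<le> c / K * exp (K * t)" using c K by simp
  finally show ?thesis .
qed

text \<open>The Picard operator contracts in the norm weighted by \<open>exp (- 2 L t)\<close>.\<close>

lemma global_solution_exists:
  fixes g :: "'a::euclidean_space \<Rightarrow> 'a"
  assumes lip: "L-lipschitz_on UNIV g" and L: "L > 0" and g0: "g 0 = 0"
  obtains y where "y 0 = x" "solution g y"
proof -
  define K where "K = 2 * L"
  have K: "K > 0" using L by (simp add: K_def)
  have glip: "norm (g u - g v) \<le> L * norm (u - v)" for u v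
    using lipschitz_onD[OF lip, of u v] by (simp add: dist_norm)
  have gcont: "continuous_on S g" for S
    using lipschitz_on_continuous_on[OF lip] continuous_on_subset by blast
  \<comment> \<open>The unknown \<open>z t\<close> stands for \<open>exp (- K t) y(t)\<close>, so
    that the usual supremum metric of bounded continuous functions is the weighted one for
    \<open>y\<close>. The contraction factor is \<open>L / K = 1 / 2\<close>. In \<open>F\<close>
    the expression \<open>max 0 t\<close> extends the operator constantly to negative times, since
    these functions live on the whole line.\<close>
  define q where "q z s = g (exp (K * s) *\<^sub>R apply_bcontfun z s)" for z :: "real \<Rightarrow>\<^sub>C 'a" and s
  have qcont: "continuous_on {0..} (q z)" for z
    unfolding q_def
    by (intro continuous_on_compose2[OF gcont[of UNIV]] continuous_intros continuous_on_subset[OF continuous_on_apply_bcontfun]) auto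
  define F where "F z t = exp (- K * max 0 t) *\<^sub>R (x + integral {0..max 0 t} (q z))" for z t
  have qdiff: "norm (q z s - q w s) \<le> (L * dist z w) * exp (K * s)" for z w s
  proof -
    have "norm (q z s - q w s) \<le> L * norm (exp (K * s) *\<^sub>R (apply_bcontfun z s - apply_bcontfun w s))"
      unfolding q_def by (metis glip scaleR_diff_right)
    also have "\<dots> = L * exp (K * s) * dist (apply_bcontfun z s) (apply_bcontfun w s)"
      by (simp add: dist_norm)
    also have "\<dots> \<le> L * exp (K * s) * dist z w"
      using L by (intro mult_left_mono dist_bounded) auto
    finally show ?thesis by (simp add: algebra_simps)
  qed
  have q0: "q 0 s = 0" for s by (simp add: q_def g0)
  have Fcont: "continuous_on UNIV (F z)" for z
  proof -
    have "continuous_on {0..} (\<lambda>t. integral {0..t} (q z))"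
      using integral_has_vector_derivative_half_line[OF qcont]
      by (auto simp: continuous_on_eq_continuous_within intro: has_vector_derivative_continuous)
    then have "continuous_on UNIV (\<lambda>t. integral {0..max 0 t} (q z))"
      by (rule continuous_on_compose2) (auto intro!: continuous_intros)
    then show ?thesis unfolding F_def by (intro continuous_intros)
  qed
  have intle: "exp (- K * t) * norm (integral {0..t} (q z) - integral {0..t} (q w)) \<le> 1 / 2 * dist z w" if "t \<ge> 0" for t z w
  proof -
    have "integral {0..t} (q z) - integral {0..t} (q w) = integral {0..t} (\<lambda>s. q z s - q w s)"
      by (rule integral_diff[symmetric]) (auto intro!: integrable_continuous_real continuous_on_subset[OF qcont])
    also have "norm \<dots> \<le> (L * dist z w) / K * exp (K * t)"
      using qdiff L K that by (intro norm_integral_exp_le continuous_intros qcont) auto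
    finally have "exp (- K * t) * norm (integral {0..t} (q z) - integral {0..t} (q w))
      \<le> exp (- K * t) * ((L * dist z w) / K * exp (K * t))" by (intro mult_left_mono) auto
    also have "\<dots> = (exp (- K * t) * exp (K * t)) * ((L * dist z w) / K)" by (simp only: mult_ac)
    also have "exp (- K * t) * exp (K * t) = 1" by (simp flip: exp_add)
    also have "1 * ((L * dist z w) / K) = 1 / 2 * dist z w" using L by (simp add: K_def)
    finally show ?thesis .
  qed
  have Fdiff: "norm (F z t - F w t) \<le> 1 / 2 * dist z w" for z w t
    using intle[of "max 0 t" z w] by (simp add: F_def flip: scaleR_diff_right)
  have Fbdd: "F z \<in> bcontfun" for z
  proof -
    have "norm (F z t) \<le> norm x + 1 / 2 * dist z 0" for t
    proof -
      have "norm (F 0 t) \<le> norm x" using K by (simp add: F_def q0[abs_def] mult_left_le_one_le)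
      then show ?thesis using Fdiff[of z t 0] norm_triangle_sub[of "F z t" "F 0 t"] by linarith
    qed
    then show ?thesis using Fcont by (intro bcontfun_normI)
  qed
  define T where "T z = Bcontfun (F z)" for z
  have T: "apply_bcontfun (T z) = F z" for z
    unfolding T_def using Fbdd by (simp add: Bcontfun_inverse)
  have "\<exists>!z. T z = z"
  proof (rule banach_fix_type[of "1 / 2"])
    show "\<forall>z w. dist (T z) (T w) \<le> 1 / 2 * dist z w"
      by (intro allI dist_bound) (simp only: T dist_norm[of "F _ _" "F _ _"] Fdiff)
  qed simp_all
  then obtain z where z: "T z = z" by blast
  define y where "y t = x + integral {0..t} (q z)" for t
  have zy: "apply_bcontfun z t = exp (- K * t) *\<^sub>R y t" if "t \<ge> 0" for t
    using arg_cong[OF z, of "\<lambda>z. apply_bcontfun z t"] that by (simp add: T F_def y_def)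
  have "(y has_vector_derivative g (y t)) (at t within {0..})" if "t \<ge> 0" for t
  proof -
    have "(y has_vector_derivative 0 + q z t) (at t within {0..})"
      unfolding y_def by (intro has_vector_derivative_add integral_has_vector_derivative_half_line qcont that has_vector_derivative_const)
    also have "0 + q z t = g (y t)" by (simp add: q_def zy[OF that] flip: exp_add)
    finally show ?thesis .
  qed
  moreover have "y 0 = x" by (simp add: y_def)
  ultimately show thesis using that by (simp add: solution_def)
qed

section \<open>The stable set of a globally Lipschitz saddle\<close>

locale saddle_form =
  fixes V :: "'a::euclidean_space \<Rightarrow> 'a \<Rightarrow> real" and a :: real and Es Eu :: "'a set" and \<pi> :: "'a \<Rightarrow> 'a"
  assumes bil: "bilinear V" and sym: "V x y = V y x" and a_pos: "a > 0"
    and subEs: "subspace Es" and subEu: "subspace Eu"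
    and lin: "linear \<pi>" and pi_Es: "\<pi> x \<in> Es" and pi_Eu: "x - \<pi> x \<in> Eu"
    and pos: "x \<in> Es \<Longrightarrow> a * (norm x)\<^sup>2 \<le> V x x"
    and neg: "x \<in> Eu \<Longrightarrow> V x x \<le> - a * (norm x)\<^sup>2"
    and orth: "x \<in> Es \<Longrightarrow> y \<in> Eu \<Longrightarrow> V x y = 0"
begin

lemma bounded_bilinear_V: "bounded_bilinear V"
  using bil bilinear_conv_bounded_bilinear by blast

lemma V_bound:
  obtains b where "b > 0" "\<And>x y. \<bar>V x y\<bar> \<le> b * norm x * norm y"
  using bilinear_bounded_pos[OF bil] by auto

lemma V_has_derivative:
  assumes "(u has_vector_derivative u') (at t within S)"
  shows "((\<lambda>t. V (u t) (u t)) has_vector_derivative 2 * V (u t) u') (at t within S)"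
proof -
  have "((\<lambda>t. V (u t) (u t)) has_vector_derivative V (u t) u' + V u' (u t)) (at t within S)"
    by (rule bounded_bilinear.has_vector_derivative[OF bounded_bilinear_V assms assms])
  then show ?thesis by (simp add: sym[of u'])
qed

lemma V_add: "x \<in> Es \<Longrightarrow> y \<in> Eu \<Longrightarrow> V (x + y) (x + y) = V x x + V y y"
  by (simp add: bilinear_ladd[OF bil] bilinear_radd[OF bil] orth sym[of y x])

lemma Es_Int_Eu: "x \<in> Es \<Longrightarrow> x \<in> Eu \<Longrightarrow> x = 0"
  using pos[of x] neg[of x] a_pos by (smt (verit) mult_pos_pos norm_eq_zero zero_less_power2 mult_minus_left)

lemma pi_add: "x \<in> Es \<Longrightarrow> y \<in> Eu \<Longrightarrow> \<pi> (x + y) = x"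
proof -
  assume x: "x \<in> Es" and y: "y \<in> Eu"
  have "\<pi> (x + y) - x \<in> Es" by (intro subspace_diff subEs pi_Es x)
  moreover have "y - (x + y - \<pi> (x + y)) \<in> Eu" by (intro subspace_diff subEu pi_Eu y)
  then have "\<pi> (x + y) - x \<in> Eu" by simp
  ultimately show ?thesis using Es_Int_Eu by fastforce
qed

lemma V_neg_imp: "V x x < 0 \<Longrightarrow> x - \<pi> x \<noteq> 0"
  using pos[OF pi_Es, of x] a_pos by (auto simp: not_less[symmetric])
     (smt (verit) mult_nonneg_nonneg zero_le_power2)

text \<open>In the cone \<open>V \<ge> 0\<close>, orthogonality of the splitting for
  \<open>V\<close> bounds the unstable component by the stable one. Applied to differences, this
  gives the inverse of \<open>\<pi>\<close> on the stable set a Lipschitz bound.\<close>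

lemma norm_le_pi:
  obtains c where "c > 0" "\<And>x. V x x \<ge> 0 \<Longrightarrow> norm x \<le> c * norm (\<pi> x)"
proof -
  obtain b where b: "b > 0" "\<And>x y. \<bar>V x y\<bar> \<le> b * norm x * norm y" by (metis V_bound)
  define c where "c = sqrt (b / a)"
  have c: "c \<ge> 0" "c\<^sup>2 = b / a" using b a_pos by (auto simp: c_def)
  have "norm x \<le> (1 + c) * norm (\<pi> x)" if nn: "V x x \<ge> 0" for x
  proof -
    have "0 \<le> V (\<pi> x) (\<pi> x) + V (x - \<pi> x) (x - \<pi> x)"
      using nn V_add[OF pi_Es[of x] pi_Eu[of x]] by simp
    also have "\<dots> \<le> b * (norm (\<pi> x))\<^sup>2 - a * (norm (x - \<pi> x))\<^sup>2"
      using b(2)[of "\<pi> x" "\<pi> x"] neg[OF pi_Eu[of x]] by (simp add: power2_eq_square algebra_simps)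
    finally have "(norm (x - \<pi> x))\<^sup>2 \<le> (c * norm (\<pi> x))\<^sup>2"
      using a_pos by (simp add: power_mult_distrib c(2) field_simps)
    then have "norm (x - \<pi> x) \<le> c * norm (\<pi> x)"
      by (rule power2_le_imp_le) (use c in simp)
    then show ?thesis using norm_triangle_ineq[of "\<pi> x" "x - \<pi> x"] by (simp add: algebra_simps)
  qed
  then show thesis using c by (intro that[of "1 + c"]) auto
qed

text \<open>\<open>V\<close> does not increase along \<open>d\<close> and tends to
  \<open>V 0 0 = 0\<close>, so it cannot start below 0. In use, \<open>d\<close> is an orbit or the
  difference of two orbits.\<close>

lemma V_nonneg_of_convergent:
  assumes der: "\<And>t. t \<ge> 0 \<Longrightarrow> (d has_vector_derivative d' t) (at t within {0..})"
    and mono: "\<And>t. t \<ge> 0 \<Longrightarrow> V (d t) (d' t) \<le> 0"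
    and lim: "(d \<longlongrightarrow> 0) at_top"
  shows "V (d 0) (d 0) \<ge> 0"
proof -
  have "((\<lambda>t. V (d t) (d t)) \<longlongrightarrow> V 0 0) at_top"
    by (rule bounded_bilinear.tendsto[OF bounded_bilinear_V lim lim])
  then have "((\<lambda>t. V (d t) (d t)) \<longlongrightarrow> 0) at_top" by (simp add: bilinear_lzero[OF bil])
  moreover have "V (d t) (d t) \<le> V (d 0) (d 0)" if "t \<ge> 0" for t
    by (rule nonincreasing_half_line[OF V_has_derivative[OF der]]) (use mono that in auto)
  then have "\<forall>\<^sub>F t in at_top. V (d t) (d t) \<le> V (d 0) (d 0)"
    using eventually_ge_at_top[of 0] by (rule eventually_mono[rotated]) blast
  ultimately show ?thesis by (rule tendsto_upperbound) simp
qed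

end

text \<open>\<open>mono\<close> controls differences of two orbits, not merely single orbits; this
  makes the stable set a graph. The global Lipschitz bound ensures that all forward orbits exist for
  all times.\<close>

locale saddle_system = saddle_form +
  fixes g :: "'a::euclidean_space \<Rightarrow> 'a" and L :: real
  assumes lip: "L-lipschitz_on UNIV g" and L_pos: "L > 0" and g0: "g 0 = 0"
    and mono: "V (x - y) (g x - g y) \<le> - a * (norm (x - y))\<^sup>2"
begin

definition flow :: "'a \<Rightarrow> real \<Rightarrow> 'a" where
  "flow x = (SOME y. y 0 = x \<and> solution g y)"

lemma flow_0 [simp]: "flow x 0 = x" and solution_flow: "solution g (flow x)"
  using someI_ex[of "\<lambda>y. y 0 = x \<and> solution g y"] global_solution_exists[OF lip L_pos g0, of x]
  unfolding flow_def by blast+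

lemma flow_dist: "t \<ge> 0 \<Longrightarrow> norm (flow x t - flow y t) \<le> exp (L * t) * norm (x - y)"
  using solution_diff_bounds(1)[OF solution_flow[of x] solution_flow[of y] lip, of 0 t] by simp

lemma flow_unique:
  assumes "solution g y" "t \<ge> 0"
  shows "y t = flow (y 0) t"
  using solution_diff_bounds(1)[OF assms(1) solution_flow[of "y 0"] lip, of 0 t] assms(2) by simp

lemma flow_tendsto:
  assumes \<rho>: "(\<rho> \<longlongrightarrow> x) F" and \<tau>: "(\<tau> \<longlongrightarrow> t) F" and \<tau>0: "\<And>u. \<tau> u \<ge> 0" and t: "t \<ge> 0"
  shows "((\<lambda>u. flow (\<rho> u) (\<tau> u)) \<longlongrightarrow> flow x t) F"
proof -
  have "((\<lambda>u. exp (L * \<tau> u) * norm (\<rho> u - x)) \<longlongrightarrow> exp (L * t) * norm (x - x)) F"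
    by (intro tendsto_intros \<rho> \<tau>)
  then have "((\<lambda>u. exp (L * \<tau> u) * norm (\<rho> u - x)) \<longlongrightarrow> 0) F" by simp
  then have "((\<lambda>u. flow (\<rho> u) (\<tau> u) - flow x (\<tau> u)) \<longlongrightarrow> 0) F"
    by (rule Lim_null_comparison[rotated]) (use flow_dist[OF \<tau>0] in auto)
  moreover have "((\<lambda>u. flow x (\<tau> u)) \<longlongrightarrow> flow x t) F"
    by (rule continuous_on_tendsto_compose[OF solution_continuous[OF solution_flow] \<tau>]) (use \<tau>0 t in auto)
  ultimately show ?thesis
    using tendsto_add[of "\<lambda>u. flow (\<rho> u) (\<tau> u) - flow x (\<tau> u)" 0 F "\<lambda>u. flow x (\<tau> u)" "flow x t"] by simp
qed

lemma flow_continuous_on: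
  assumes "continuous_on S \<rho>" "continuous_on S \<tau>" "\<And>u. \<tau> u \<ge> 0"
  shows "continuous_on S (\<lambda>u. flow (\<rho> u) (\<tau> u))"
  unfolding continuous_on_def
proof
  fix u assume "u \<in> S"
  then have "(\<rho> \<longlongrightarrow> \<rho> u) (at u within S)" "(\<tau> \<longlongrightarrow> \<tau> u) (at u within S)"
    using assms(1,2) unfolding continuous_on_def by blast+
  then show "((\<lambda>u. flow (\<rho> u) (\<tau> u)) \<longlongrightarrow> flow (\<rho> u) (\<tau> u)) (at u within S)"
    using assms(3) by (intro flow_tendsto)
qed

lemma V_flow_has_derivative:
  "t \<ge> 0 \<Longrightarrow> ((\<lambda>t. V (flow x t) (flow x t)) has_vector_derivative 2 * V (flow x t) (g (flow x t))) (at t within {0..})"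
  by (intro V_has_derivative solutionD solution_flow)

lemma mono_0: "V x (g x) \<le> - a * (norm x)\<^sup>2"
  using mono[of x 0] by (simp add: g0)

lemma V_flow_antimono: "0 \<le> s \<Longrightarrow> s \<le> t \<Longrightarrow> V (flow x t) (flow x t) \<le> V (flow x s) (flow x s)"
proof (rule nonincreasing_half_line[OF V_flow_has_derivative])
  fix \<tau>
  have "- a * (norm (flow x \<tau>))\<^sup>2 \<le> 0" using a_pos by simp
  then show "2 * V (flow x \<tau>) (g (flow x \<tau>)) \<le> 0" using mono_0[of "flow x \<tau>"] by linarith
qed

text \<open>Membership is expressed by the cone instead of by convergence, because this is a closed
  condition at each single time and so accessible to compactness. Convergence is recovered in
  \<open>stable_set_tendsto\<close>.\<close>

definition stable_set :: "'a set" where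
  "stable_set = {x. \<forall>t\<ge>0. V (flow x t) (flow x t) \<ge> 0}"

text \<open>From \<open>V x x \<le> b |x|^2\<close> the form decays like \<open>exp (- c t)\<close>
  with \<open>c = 2 a / b\<close>. Inside the cone, however, \<open>V\<close> may vanish at nonzero
  vectors and does not bound the norm. Instead the loss of \<open>V\<close> over one unit of time
  does: the orbit shrinks by at most the factor \<open>exp (- L)\<close> meanwhile, so the loss is
  at least \<open>e\<close> times the squared norm at the start, and since \<open>V\<close> stays
  nonnegative it cannot lose more than it has.\<close>

lemma stable_set_decay:
  obtains C c where "C > 0" "c > 0"
    "\<And>x t. x \<in> stable_set \<Longrightarrow> t \<ge> 0 \<Longrightarrow> (norm (flow x t))\<^sup>2 \<le> C * exp (- c * t) * (norm x)\<^sup>2"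
proof -
  obtain b where b: "b > 0" "\<And>x y. \<bar>V x y\<bar> \<le> b * norm x * norm y" by (metis V_bound)
  define c where "c = 2 * a / b"
  define e where "e = exp (- (2 * L)) * 2 * a"
  have c: "c > 0" and e: "e > 0" using a_pos b by (auto simp: c_def e_def)
  have "(norm (flow x t))\<^sup>2 \<le> (b / e) * exp (- c * t) * (norm x)\<^sup>2" if x: "x \<in> stable_set" and t: "t \<ge> 0" for x t
  proof -
    let ?\<phi> = "\<lambda>t. V (flow x t) (flow x t)" and ?n = "(norm (flow x t))\<^sup>2"
    have sol0: "solution g (\<lambda>t. 0)" by (simp add: solution_def g0 has_vector_derivative_const)
    have "?\<phi> (t + 1) + e * ?n * ((t + 1) - t) \<le> ?\<phi> t + e * ?n * (t - t)"
    proof (rule nonincreasing_half_line[where \<phi> = "\<lambda>s. ?\<phi> s + e * ?n * (s - t)"])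
      show "((\<lambda>s. ?\<phi> s + e * ?n * (s - t)) has_vector_derivative 2 * V (flow x s) (g (flow x s)) + e * ?n) (at s within {0..})"
        if "s \<ge> 0" for s
        by (rule has_vector_derivative_add[OF V_flow_has_derivative[OF that]])
           (auto intro!: derivative_eq_intros simp flip: has_real_derivative_iff_has_vector_derivative)
      fix s assume s: "t < s" "s < t + 1"
      have "norm (flow x t) \<le> exp (L * (s - t)) * norm (flow x s)"
        using solution_diff_bounds(2)[OF solution_flow[of x] sol0 lip, of t s] s t by simp
      also have "\<dots> \<le> exp L * norm (flow x s)"
        using s L_pos by (intro mult_right_mono) auto
      finally have "?n \<le> (exp L * norm (flow x s))\<^sup>2" by (rule power_mono) simp
      then have "e * ?n \<le> e * (exp L * norm (flow x s))\<^sup>2" using e by simp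
      also have "\<dots> = 2 * a * (norm (flow x s))\<^sup>2 * (exp (- (2 * L)) * (exp L)\<^sup>2)"
        by (simp add: e_def power_mult_distrib)
      also have "exp (- (2 * L)) * (exp L)\<^sup>2 = 1" by (simp flip: exp_add exp_double)
      finally show "2 * V (flow x s) (g (flow x s)) + e * ?n \<le> 0"
        using mono_0[of "flow x s"] by simp
    qed (use t in auto)
    moreover have "?\<phi> (t + 1) \<ge> 0" using x t by (simp add: stable_set_def)
    ultimately have 1: "e * ?n \<le> ?\<phi> t" by simp
    have "exp (c * t) * ?\<phi> t \<le> exp (c * 0) * ?\<phi> 0"
    proof (rule nonincreasing_half_line[where \<phi> = "\<lambda>s. exp (c * s) * ?\<phi> s"])
      show "((\<lambda>s. exp (c * s) * ?\<phi> s) has_vector_derivative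
          exp (c * s) * (c * ?\<phi> s + 2 * V (flow x s) (g (flow x s)))) (at s within {0..})" if "s \<ge> 0" for s
        using V_flow_has_derivative[OF that, of x]
        unfolding has_real_derivative_iff_has_vector_derivative[symmetric]
        by (auto intro!: derivative_eq_intros simp: algebra_simps)
      fix s :: real
      have "c * ?\<phi> s \<le> c * (b * (norm (flow x s))\<^sup>2)"
        using b(2)[of "flow x s" "flow x s"] c by (intro mult_left_mono) (auto simp: power2_eq_square)
      also have "\<dots> = 2 * a * (norm (flow x s))\<^sup>2" using b by (simp add: c_def)
      finally have "c * ?\<phi> s + 2 * V (flow x s) (g (flow x s)) \<le> 0" using mono_0[of "flow x s"] by simp
      then show "exp (c * s) * (c * ?\<phi> s + 2 * V (flow x s) (g (flow x s))) \<le> 0" by (simp add: mult_le_0_iff)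
    qed (use t in auto)
    also have "exp (c * 0) * ?\<phi> 0 \<le> b * (norm x)\<^sup>2"
      using b(2)[of x x] by (simp add: power2_eq_square)
    finally have "?\<phi> t \<le> exp (- c * t) * (b * (norm x)\<^sup>2)" by (simp add: exp_minus field_simps)
    with 1 have "e * ?n \<le> exp (- c * t) * (b * (norm x)\<^sup>2)" by linarith
    then show ?thesis using e by (simp add: field_simps)
  qed
  then show thesis using b e c by (intro that[of "b / e" c]) auto
qed

lemma stable_set_tendsto:
  assumes "x \<in> stable_set"
  shows "(flow x \<longlongrightarrow> 0) at_top"
proof -
  obtain C c where C: "C > 0" "c > 0"
    "\<And>x t. x \<in> stable_set \<Longrightarrow> t \<ge> 0 \<Longrightarrow> (norm (flow x t))\<^sup>2 \<le> C * exp (- c * t) * (norm x)\<^sup>2"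
    by (metis stable_set_decay)
  have "filterlim (\<lambda>t. - c * t) at_bot at_top"
    using C(2) by (intro filterlim_tendsto_neg_mult_at_bot[OF tendsto_const _ filterlim_ident]) auto
  then have "((\<lambda>t. exp (- c * t)) \<longlongrightarrow> 0) at_top"
    by (rule filterlim_compose[OF exp_at_bot])
  then have "((\<lambda>t. C * exp (- c * t) * (norm x)\<^sup>2) \<longlongrightarrow> C * 0 * (norm x)\<^sup>2) at_top"
    by (intro tendsto_intros)
  then have "((\<lambda>t. C * exp (- c * t) * (norm x)\<^sup>2) \<longlongrightarrow> 0) at_top" by simp
  moreover have "\<forall>\<^sub>F t in at_top. norm ((norm (flow x t))\<^sup>2) \<le> C * exp (- c * t) * (norm x)\<^sup>2"
    using eventually_ge_at_top[of 0] by eventually_elim (use C(3)[OF assms] in simp)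
  ultimately have "((\<lambda>t. (norm (flow x t))\<^sup>2) \<longlongrightarrow> 0) at_top" by (rule Lim_null_comparison[rotated])
  then have "((\<lambda>t. sqrt ((norm (flow x t))\<^sup>2)) \<longlongrightarrow> sqrt 0) at_top" by (rule tendsto_real_sqrt)
  then show ?thesis by (simp add: tendsto_norm_zero_iff)
qed

lemma stable_set_diff:
  assumes "x \<in> stable_set" "y \<in> stable_set"
  shows "V (x - y) (x - y) \<ge> 0"
proof -
  have "V (flow x 0 - flow y 0) (flow x 0 - flow y 0) \<ge> 0"
  proof (rule V_nonneg_of_convergent[where d = "\<lambda>t. flow x t - flow y t"])
    show "((\<lambda>t. flow x t - flow y t) has_vector_derivative g (flow x t) - g (flow y t)) (at t within {0..})"
      if "t \<ge> 0" for t
      by (intro has_vector_derivative_diff solutionD solution_flow that)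
    show "V (flow x t - flow y t) (g (flow x t) - g (flow y t)) \<le> 0" for t
      by (rule order_trans[OF mono]) (use a_pos in simp)
    show "((\<lambda>t. flow x t - flow y t) \<longlongrightarrow> 0) at_top"
      using tendsto_diff[OF assms[THEN stable_set_tendsto]] by simp
  qed
  then show ?thesis by simp
qed

text \<open>
  Wazewski's argument. If all points \<open>s + u\<close> with \<open>u\<close> in a large disc of \<open>Eu\<close> left the cone
  \<open>V \<ge> 0\<close>, they would all have left it by a common time \<open>T\<close>. On the disc of twice the radius, flowing
  for a time that decreases to 0 on the outer half then yields a map to \<open>Eu - {0}\<close> which is half the
  identity on the boundary, contradicting Brouwer's theorem.
\<close>

lemma stable_set_surj:
  assumes s: "s \<in> Es"
  obtains x where "x \<in> stable_set" "\<pi> x = s"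
proof (rule ccontr)
  assume "\<not> thesis"
  then have none: "s + u \<notin> stable_set" if "u \<in> Eu" for u
    using that pi_add[OF s] \<open>\<And>x. \<lbrakk>x \<in> stable_set; \<pi> x = s\<rbrakk> \<Longrightarrow> thesis\<close> by blast
  \<comment> \<open>The summand 1 makes \<open>a * R\<^sup>2 > V s s\<close> strict, so that on the
    sphere of radius \<open>R\<close> in \<open>Eu\<close> the points \<open>s + u\<close> are
    already outside the cone.\<close>
  define R where "R = sqrt (V s s / a) + 1"
  have Vs: "V s s \<ge> 0" using pos[OF s] a_pos by (smt (verit) mult_nonneg_nonneg zero_le_power2)
  have R: "R > 0" "a * R\<^sup>2 > V s s"
  proof -
    show "R > 0" using Vs a_pos by (simp add: R_def add_nonneg_pos)
    have "sqrt (V s s / a) < R" by (simp add: R_def)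
    then have "(sqrt (V s s / a))\<^sup>2 < R\<^sup>2" using Vs a_pos by (intro power_strict_mono) auto
    then show "a * R\<^sup>2 > V s s" using Vs a_pos by (simp add: field_simps)
  qed
  have Vbd: "V (s + u) (s + u) < 0" if "u \<in> Eu" "norm u = R" for u
    using V_add[OF s that(1)] neg[OF that(1)] R that(2) by simp
  \<comment> \<open>The compact sets \<open>F n\<close> collect the \<open>u\<close> whose orbit is
    still in the cone at time \<open>n\<close>. They are nested because \<open>V\<close> decreases;
    a common point would lie in the stable set, so one of them is empty and its index is the common
    exit time.\<close>
  define F where "F n = {u \<in> cball 0 R \<inter> Eu. V (flow (s + u) (real n)) (flow (s + u) (real n)) \<ge> 0}" for n
  have "\<exists>n. F n = {}"
  proof (rule ccontr)
    assume ne: "\<not> (\<exists>n. F n = {})"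
    have "\<Inter> (range F) \<noteq> {}"
    proof (rule compact_nest)
      fix n
      have fc: "continuous_on (cball 0 R \<inter> Eu) (\<lambda>u. flow (s + u) (real n))"
        by (intro flow_continuous_on continuous_on_add continuous_on_const continuous_on_id) simp
      have "continuous_on (cball 0 R \<inter> Eu) (\<lambda>u. V (flow (s + u) (real n)) (flow (s + u) (real n)))"
        by (rule bilinear_continuous_on_compose[OF fc fc bil])
      moreover have "compact (cball 0 R \<inter> Eu)"
        by (intro compact_Int_closed compact_cball closed_subspace subEu)
      ultimately have "closedin (top_of_set (cball 0 R \<inter> Eu)) (cball 0 R \<inter> Eu \<inter> (\<lambda>u. V (flow (s + u) (real n)) (flow (s + u) (real n))) -` {0..})"
        by (intro continuous_closedin_preimage) auto
      also have "cball 0 R \<inter> Eu \<inter> (\<lambda>u. V (flow (s + u) (real n)) (flow (s + u) (real n))) -` {0..} = F n"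
        by (auto simp: F_def)
      finally show "compact (F n)" using \<open>compact (cball 0 R \<inter> Eu)\<close> by (rule closedin_compact[rotated])
      show "F n \<noteq> {}" using ne by blast
    next
      fix m n :: nat assume "m \<le> n"
      then show "F n \<subseteq> F m" using V_flow_antimono[of "real m" "real n"] by (auto simp: F_def intro: order_trans)
    qed
    then obtain u where u: "\<And>n. u \<in> F n" by blast
    have "V (flow (s + u) t) (flow (s + u) t) \<ge> 0" if "t \<ge> 0" for t
    proof -
      obtain n where "t \<le> real n" using real_arch_simple by blast
      then show ?thesis using u[of n] V_flow_antimono[OF that, of "real n" "s + u"] by (simp add: F_def)
    qed
    then have "s + u \<in> stable_set" by (simp add: stable_set_def)
    then show False using none[of u] u[of 0] by (simp add: F_def)
  qed
  then obtain n where n: "F n = {}" by blast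
  \<comment> \<open>\<open>\<rho>\<close> retracts radially to the disc of radius \<open>R\<close>.
    The time \<open>\<tau>\<close> equals \<open>n\<close> on that disc and falls linearly to 0 at
    radius \<open>2 * R\<close>; on the outer part \<open>\<rho> u\<close> has norm
    \<open>R\<close>, so any flow time keeps \<open>V\<close> negative.\<close>
  define \<rho> where "\<rho> u = (R / max R (norm u)) *\<^sub>R u" for u :: 'a
  define \<tau> where "\<tau> u = real n * max 0 (min 1 (2 - norm u / R))" for u :: 'a
  define w where "w u = flow (s + \<rho> u) (\<tau> u)" for u
  define N where "N u = w u - \<pi> (w u)" for u
  let ?D = "cball 0 (2 * R) \<inter> Eu"
  have \<rho>E: "\<rho> u \<in> Eu" if "u \<in> Eu" for u using that subEu by (simp add: \<rho>_def subspace_scale)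
  have wneg: "V (w u) (w u) < 0" if u: "u \<in> Eu" for u
  proof (cases "norm u \<le> R")
    case True
    have "\<rho> u = u" using True R by (simp add: \<rho>_def max_def)
    moreover have "norm u / R \<le> 1" using True R by simp
    then have "\<tau> u = real n" unfolding \<tau>_def by simp
    moreover have "u \<notin> F n" using n by simp
    ultimately show ?thesis using True u by (simp add: F_def w_def)
  next
    case False
    moreover from this have "u \<noteq> 0" using R by auto
    ultimately have "norm (\<rho> u) = R" using R by (simp add: \<rho>_def max_def)
    then have "V (s + \<rho> u) (s + \<rho> u) < 0" using Vbd \<rho>E[OF u] by blast
    moreover have "\<tau> u \<ge> 0" by (simp add: \<tau>_def)
    ultimately show ?thesis
      using V_flow_antimono[of 0 "\<tau> u" "s + \<rho> u"] by (simp add: w_def)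
  qed
  have wcont: "continuous_on S w" for S
    unfolding w_def
  proof (rule flow_continuous_on)
    show "continuous_on S (\<lambda>u. s + \<rho> u)"
      unfolding \<rho>_def using R by (intro continuous_intros) auto
    show "continuous_on S \<tau>"
      unfolding \<tau>_def using R by (intro continuous_intros) auto
  qed (simp add: \<tau>_def)
  have picont: "continuous_on S \<pi>" for S
    by (rule linear_continuous_on[OF linear_linear[THEN iffD2, OF lin]])
  have Ncont: "continuous_on S N" for S
    unfolding N_def by (intro continuous_on_diff wcont continuous_on_compose2[OF picont[of UNIV] wcont]) auto
  have N0: "N u \<noteq> 0" if "u \<in> Eu" for u
    unfolding N_def by (rule V_neg_imp[OF wneg[OF that]])
  \<comment> \<open>The sign is chosen so that a fixed point is impossible: it would have norm
    \<open>2 * R\<close>, where \<open>N u\<close> is half of \<open>u\<close>, and there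
    \<open>f u = - u\<close>.\<close>
  define f where "f u = (- (2 * R) / norm (N u)) *\<^sub>R N u" for u
  obtain u where u: "u \<in> ?D" "f u = u"
  proof (rule brouwer[of ?D f])
    show "compact ?D" by (intro compact_Int_closed compact_cball closed_subspace subEu)
    show "convex ?D" by (intro convex_Int convex_cball subspace_imp_convex subEu)
    have "0 \<in> ?D" using subspace_0[OF subEu] R by simp
    then show "?D \<noteq> {}" by blast
    show "continuous_on ?D f"
      unfolding f_def by (intro continuous_intros Ncont) (use N0 in auto)
    show "f \<in> ?D \<rightarrow> ?D"
      using N0 R pi_Eu subEu by (auto simp: f_def N_def intro!: subspace_neg subspace_scale)
  qed
  have uE: "u \<in> Eu" using u(1) by simp
  have nu: "norm u = 2 * R"
  proof -
    have "norm u = norm (f u)" using u(2) by simp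
    also have "\<dots> = 2 * R" using N0[OF uE] R by (simp add: f_def)
    finally show ?thesis .
  qed
  have \<rho>u: "\<rho> u = (1 / 2) *\<^sub>R u" using nu R by (simp add: \<rho>_def max_def)
  have "w u = s + (1 / 2) *\<^sub>R u" using nu R by (simp add: w_def \<tau>_def \<rho>u)
  then have "N u = (1 / 2) *\<^sub>R u"
    using pi_add[OF s subspace_scale[OF subEu uE, of "1 / 2"]] by (simp add: N_def)
  then have "f u = - u" using nu R by (simp add: f_def)
  then have "u + u = 0" using u(2) by (metis left_minus)
  then have "u = 0" by (simp flip: scaleR_2)
  then show False using nu R by simp
qed

text \<open>Surjectivity of \<open>\<pi>\<close> gives a section \<open>\<sigma>\<close> over
  \<open>Es\<close> with values in the stable set, and the cone condition on differences makes it
  \<open>c\<close>-Lipschitz. A disc of radius \<open>\<delta> = \<eta> / c\<close> around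
  \<open>\<pi> z\<close> is therefore lifted into the ball of radius \<open>\<eta>\<close>.\<close>

lemma stable_set_contains_ball:
  assumes z: "z \<in> stable_set" and \<eta>: "\<eta> > 0"
  obtains A where "A \<subseteq> stable_set \<inter> ball z \<eta>" "A homeomorphic (ball 0 1 \<inter> Es)"
proof -
  have "\<forall>s. \<exists>x. s \<in> Es \<longrightarrow> x \<in> stable_set \<and> \<pi> x = s" using stable_set_surj by metis
  then obtain \<sigma> where \<sigma>: "\<And>s. s \<in> Es \<Longrightarrow> \<sigma> s \<in> stable_set" "\<And>s. s \<in> Es \<Longrightarrow> \<pi> (\<sigma> s) = s" by metis
  obtain c where c: "c > 0" "\<And>x. V x x \<ge> 0 \<Longrightarrow> norm x \<le> c * norm (\<pi> x)" by (metis norm_le_pi)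
  have lipg: "norm (x - y) \<le> c * norm (\<pi> x - \<pi> y)" if "x \<in> stable_set" "y \<in> stable_set" for x y
    using c(2)[OF stable_set_diff[OF that]] by (simp add: linear_diff[OF lin])
  define \<delta> where "\<delta> = \<eta> / c"
  have \<delta>: "\<delta> > 0" using c \<eta> by (simp add: \<delta>_def)
  define h where "h s = \<sigma> (\<pi> z + \<delta> *\<^sub>R s)" for s
  have mem: "\<pi> z + \<delta> *\<^sub>R s \<in> Es" if "s \<in> Es" for s
    using that subEs pi_Es by (simp add: subspace_add subspace_scale)
  have picont: "continuous_on S \<pi>" for S
    by (rule linear_continuous_on[OF linear_linear[THEN iffD2, OF lin]])
  have "c-lipschitz_on Es \<sigma>"
    by (rule lipschitz_onI) (use lipg[OF \<sigma>(1) \<sigma>(1)] \<sigma>(2) c in \<open>auto simp: dist_norm\<close>)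
  then have \<sigma>cont: "continuous_on Es \<sigma>" by (rule lipschitz_on_continuous_on)
  let ?A = "h ` (ball 0 1 \<inter> Es)"
  have "homeomorphism (ball 0 1 \<inter> Es) ?A h (\<lambda>x. (1 / \<delta>) *\<^sub>R (\<pi> x - \<pi> z))"
  proof (rule homeomorphismI)
    show "continuous_on (ball 0 1 \<inter> Es) h"
      unfolding h_def by (rule continuous_on_compose2[OF \<sigma>cont]) (auto intro!: continuous_intros mem)
    show "continuous_on ?A (\<lambda>x. (1 / \<delta>) *\<^sub>R (\<pi> x - \<pi> z))"
      by (intro continuous_intros picont)
  qed (use \<delta> \<sigma>(2)[OF mem] in \<open>auto simp: h_def\<close>)
  then have "?A homeomorphic (ball 0 1 \<inter> Es)"
    using homeomorphic_def homeomorphic_sym by blast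
  moreover have "?A \<subseteq> stable_set \<inter> ball z \<eta>"
  proof
    fix x assume "x \<in> ?A"
    then obtain s where s: "s \<in> Es" "norm s < 1" "x = h s" by auto
    have x: "x \<in> stable_set" "\<pi> x = \<pi> z + \<delta> *\<^sub>R s" using \<sigma>[OF mem[OF s(1)]] by (auto simp: s(3) h_def)
    have "norm (x - z) \<le> c * (\<delta> * norm s)" using lipg[OF x(1) z] x(2) \<delta> by simp
    also have "\<dots> = \<eta> * norm s" using c by (simp add: \<delta>_def)
    also have "\<dots> < \<eta>" using s(2) \<eta> by simp
    finally show "x \<in> stable_set \<inter> ball z \<eta>" using x by (simp add: dist_norm norm_minus_commute)
  qed
  ultimately show thesis using that by blast
qed

end

section \<open>The dimension of the local stable set\<close>

context saddle_form
begin

text \<open>Half of the decay rate \<open>2 * a\<close> of the linear part is spent on the nonlinear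
  error. With \<open>b\<close> a bound of \<open>V\<close>, an error of size \<open>a / b\<close>
  times the distance is affordable, and strict differentiability provides it near
  \<open>xs\<close>.\<close>

lemma local_monotonicity:
  assumes J: "\<And>x. V x (J x) \<le> - (2 * a) * (norm x)\<^sup>2"
    and strict: "\<And>\<delta>. \<delta> > 0 \<Longrightarrow> \<exists>\<rho>>0. \<forall>x\<in>cball xs \<rho>. \<forall>y\<in>cball xs \<rho>. norm (g x - g y - J (x - y)) \<le> \<delta> * norm (x - y)"
  obtains \<rho> \<delta> where "\<rho> > 0" "\<delta> > 0"
    "\<And>x y. x \<in> cball xs \<rho> \<Longrightarrow> y \<in> cball xs \<rho> \<Longrightarrow> norm (g x - g y - J (x - y)) \<le> \<delta> * norm (x - y)"
    "\<And>d e. norm e \<le> \<delta> * norm d \<Longrightarrow> V d (J d + e) \<le> - a * (norm d)\<^sup>2"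
proof -
  obtain b where b: "b > 0" "\<And>x y. \<bar>V x y\<bar> \<le> b * norm x * norm y" by (metis V_bound)
  define \<delta> where "\<delta> = a / b"
  have \<delta>: "\<delta> > 0" using a_pos b by (simp add: \<delta>_def)
  obtain \<rho> where \<rho>: "\<rho> > 0" "\<forall>x\<in>cball xs \<rho>. \<forall>y\<in>cball xs \<rho>. norm (g x - g y - J (x - y)) \<le> \<delta> * norm (x - y)"
    using strict[OF \<delta>] by blast
  have "V d (J d + e) \<le> - a * (norm d)\<^sup>2" if e: "norm e \<le> \<delta> * norm d" for d e
  proof -
    have "V d e \<le> b * norm d * norm e" using b(2)[of d e] by simp
    also have "\<dots> \<le> b * norm d * (\<delta> * norm d)" using b e by (intro mult_left_mono) auto
    also have "\<dots> = a * (norm d)\<^sup>2" using b by (simp add: \<delta>_def power2_eq_square)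
    finally show ?thesis using J[of d] by (simp add: bilinear_radd[OF bil])
  qed
  then show thesis using that \<rho> \<delta> by blast
qed

text \<open>
  By Baire's theorem the orbits of an open piece of the ball stay close to the equilibrium after a
  common time \<open>N\<close>; there the time-\<open>N\<close> map followed by the projection to \<open>Es\<close> is injective.
\<close>

lemma dim_le_of_ball_in_W_s_loc:
  fixes g :: "'a \<Rightarrow> 'a"
  assumes lipK: "M-lipschitz_on K g" and \<rho>: "\<rho> > 0"
    and mono: "\<And>x y. x \<in> cball xs \<rho> \<Longrightarrow> y \<in> cball xs \<rho> \<Longrightarrow> V (x - y) (g x - g y) \<le> 0"
    and A: "A \<subseteq> W_s_loc K g U xs" and W: "subspace W" and hom: "A homeomorphic (ball 0 1 \<inter> W)"
  shows "dim (W :: 'a set) \<le> dim Es"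
proof -
  obtain h h' where h: "homeomorphism (ball 0 1 \<inter> W) A h h'"
    using hom unfolding homeomorphic_sym[of A] by (auto simp: homeomorphic_def)
  have "\<forall>x. \<exists>y. x \<in> A \<longrightarrow> forward_orbit K g x y \<and> (y \<longlongrightarrow> xs) at_top"
    using A unfolding W_s_loc_def by blast
  then obtain Y where Y: "\<And>x. x \<in> A \<Longrightarrow> forward_orbit K g x (Y x)" "\<And>x. x \<in> A \<Longrightarrow> (Y x \<longlongrightarrow> xs) at_top"
    by metis
  have sol: "solution g (Y x)" and Y0: "Y x 0 = x" and YK: "\<And>t. t \<ge> 0 \<Longrightarrow> Y x t \<in> K" if "x \<in> A" for x
    using Y(1)[OF that] by (auto simp: forward_orbit_def solution_def)
  have Ydist: "norm (Y x t - Y z t) \<le> exp (M * t) * norm (x - z)"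
    "norm (x - z) \<le> exp (M * t) * norm (Y x t - Y z t)" if "x \<in> A" "z \<in> A" "t \<ge> 0" for x z t
    using solution_diff_bounds[OF sol[OF that(1)] sol[OF that(2)] lipK YK[OF that(1)] YK[OF that(2)], of 0 t] that
    by (simp_all add: Y0)
  have Ycont: "continuous_on A (\<lambda>x. Y x t)" if "t \<ge> 0" for t
  proof -
    have "(exp (M * t))-lipschitz_on A (\<lambda>x. Y x t)"
      using Ydist(1)[OF _ _ that] by (intro lipschitz_onI) (auto simp: dist_norm)
    then show ?thesis by (rule lipschitz_on_continuous_on)
  qed
  have hcont: "continuous_on (ball 0 1 \<inter> W) h" and himg: "h ` (ball 0 1 \<inter> W) = A" and hinj: "inj_on h (ball 0 1 \<inter> W)"
    using h by (auto simp: homeomorphism_def intro: inj_on_inverseI)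
  define S where "S = cball 0 (1/2) \<inter> W"
  have SB: "S \<subseteq> ball 0 1 \<inter> W" by (auto simp: S_def)
  have hA: "h p \<in> A" if "p \<in> ball 0 1 \<inter> W" for p using himg that by blast
  have hS: "h ` S \<subseteq> A" using SB himg by blast
  have clS: "closed S" unfolding S_def by (intro closed_Int closed_cball closed_subspace W)
  have S0: "0 \<in> S" using subspace_0[OF W] by (simp add: S_def)
  \<comment> \<open>These sets are closed in \<open>S\<close> by continuous dependence at each fixed
    time, and they cover \<open>S\<close> since every orbit converges. By Baire's theorem one of
    them has interior points relative to \<open>S\<close>.\<close>
  define B where "B N = {p \<in> S. \<forall>t\<ge>real N. Y (h p) t \<in> cball xs \<rho>}" for N
  have "\<exists>N. \<not> S \<subseteq> closure (S - B N)"
  proof (rule ccontr)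
    assume dense: "\<not> (\<exists>N. \<not> S \<subseteq> closure (S - B N))"
    have "S \<subseteq> closure (\<Inter> (range (\<lambda>N. S - B N)))"
    proof (rule Baire[OF clS])
      fix T assume "T \<in> range (\<lambda>N. S - B N)"
      then obtain N where T: "T = S - B N" by blast
      have "closedin (top_of_set S) (\<Inter>t\<in>{real N..}. {p \<in> S. Y (h p) t \<in> cball xs \<rho>})"
      proof (rule closedin_INT)
        fix t assume t: "t \<in> {real N..}"
        have "continuous_on S (\<lambda>p. Y (h p) t)"
          by (rule continuous_on_compose2[OF Ycont continuous_on_subset[OF hcont SB] hS]) (use t in simp)
        then have "closedin (top_of_set S) (S \<inter> (\<lambda>p. Y (h p) t) -` cball xs \<rho>)"
          by (rule continuous_closedin_preimage) simp
        moreover have "S \<inter> (\<lambda>p. Y (h p) t) -` cball xs \<rho> = {p \<in> S. Y (h p) t \<in> cball xs \<rho>}" by auto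
        ultimately show "closedin (top_of_set S) {p \<in> S. Y (h p) t \<in> cball xs \<rho>}" by simp
      qed auto
      moreover have "(\<Inter>t\<in>{real N..}. {p \<in> S. Y (h p) t \<in> cball xs \<rho>}) = B N"
        by (auto simp: B_def)
      ultimately have "openin (top_of_set S) (S - B N)"
        by (simp add: openin_diff)
      then show "openin (top_of_set S) T \<and> S \<subseteq> closure T" using dense T by auto
    qed auto
    moreover have "\<Inter> (range (\<lambda>N. S - B N)) = {}"
    proof -
      have "\<exists>N. p \<in> B N" if p: "p \<in> S" for p
      proof -
        have "(Y (h p) \<longlongrightarrow> xs) at_top" using Y(2)[OF hA] p SB by blast
        then have "\<forall>\<^sub>F t in at_top. dist (Y (h p) t) xs < \<rho>" using \<rho> by (rule tendstoD)
        then obtain T where T: "\<And>t. t \<ge> T \<Longrightarrow> dist (Y (h p) t) xs < \<rho>" by (auto simp: eventually_at_top_linorder)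
        obtain N where "T \<le> real N" using real_arch_simple by blast
        then have "p \<in> B N" using T p by (auto simp: B_def dist_commute intro!: less_imp_le)
        then show ?thesis ..
      qed
      then show ?thesis by blast
    qed
    ultimately have "S \<subseteq> closure {}" by (simp only:)
    then show False using S0 by auto
  qed
  then obtain N p where p: "p \<in> S" "p \<notin> closure (S - B N)" by blast
  then obtain e where e: "e > 0" "\<And>q. q \<in> S - B N \<Longrightarrow> e \<le> dist q p"
    unfolding closure_approachable by (meson not_le)
  define T where "T = W \<inter> (ball 0 (1/2) \<inter> ball p e)"
  have TS: "T \<subseteq> S" and TB: "T \<subseteq> B N"
    using e(2) by (auto simp: T_def S_def dist_commute) (smt (verit) DiffI IntI S_def dist_commute mem_ball mem_cball)
  have oT: "openin (top_of_set W) T" unfolding T_def by (intro openin_open_Int) auto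
  have Tne: "T \<noteq> {}"
  proof -
    \<comment> \<open>\<open>p\<close> may lie on the boundary of the disc \<open>S\<close>; a
      slight contraction towards 0 moves it into the interior while keeping it in the ball of radius
      \<open>e\<close>.\<close>
    define \<eta> where "\<eta> = min 1 e"
    have \<eta>: "0 < \<eta>" "\<eta> \<le> 1" "\<eta> \<le> e" using e by (auto simp: \<eta>_def)
    have np: "norm p \<le> 1/2" and pW: "p \<in> W" using p(1) by (auto simp: S_def)
    have "(1 - \<eta>) * norm p \<le> (1 - \<eta>) * (1/2)" using np \<eta> by (intro mult_left_mono) auto
    then have 1: "norm ((1 - \<eta>) *\<^sub>R p) < 1/2" using \<eta> by simp
    have "p - (1 - \<eta>) *\<^sub>R p = \<eta> *\<^sub>R p" by (simp add: algebra_simps)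
    then have "dist p ((1 - \<eta>) *\<^sub>R p) = \<eta> * norm p" using \<eta> by (simp add: dist_norm)
    also have "\<dots> \<le> \<eta> * (1/2)" using np \<eta> by (intro mult_left_mono) auto
    finally have 2: "dist p ((1 - \<eta>) *\<^sub>R p) < e" using \<eta> by simp
    have "(1 - \<eta>) *\<^sub>R p \<in> T" unfolding T_def using 1 2 pW W by (simp add: subspace_scale)
    then show ?thesis by blast
  qed
  define \<psi> where "\<psi> q = \<pi> (Y (h q) (real N))" for q
  have TB1: "T \<subseteq> ball 0 1 \<inter> W" using TS SB by blast
  show ?thesis
  proof (rule invariance_of_dimension_subspaces[OF oT W subEs _ _ _ Tne])
    have "continuous_on UNIV \<pi>" by (rule linear_continuous_on[OF linear_linear[THEN iffD2, OF lin]])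
    moreover have "continuous_on T (\<lambda>q. Y (h q) (real N))"
      by (rule continuous_on_compose2[OF Ycont continuous_on_subset[OF hcont TB1]]) (use TS hS in auto)
    ultimately show "continuous_on T \<psi>"
      unfolding \<psi>_def by (rule continuous_on_compose2) auto
    show "\<psi> \<in> T \<rightarrow> Es" using pi_Es by (simp add: \<psi>_def)
    show "inj_on \<psi> T"
    proof (rule inj_onI)
      fix q q' assume q: "q \<in> T" "q' \<in> T" "\<psi> q = \<psi> q'"
      have hq: "h q \<in> A" "h q' \<in> A" using q TS hS by auto
      \<comment> \<open>Equal projections put \<open>d 0\<close> into \<open>Eu\<close>, where
        \<open>V\<close> is negative definite, while convergence of both orbits forces
        \<open>V (d 0) (d 0) \<ge> 0\<close>. So the orbits agree at time \<open>N\<close>, and by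
        the backward Gronwall bound already at time 0.\<close>
      define d where "d t = Y (h q) (real N + t) - Y (h q') (real N + t)" for t
      have "V (d 0) (d 0) \<ge> 0"
      proof (rule V_nonneg_of_convergent)
        show "(d has_vector_derivative g (Y (h q) (real N + t)) - g (Y (h q') (real N + t))) (at t within {0..})"
          if "t \<ge> 0" for t
          unfolding d_def by (intro has_vector_derivative_diff solutionD[OF solution_shift] sol hq that) auto
        show "V (d t) (g (Y (h q) (real N + t)) - g (Y (h q') (real N + t))) \<le> 0" if "t \<ge> 0" for t
          unfolding d_def using q TB that by (intro mono) (auto simp: B_def)
        have "((\<lambda>t. Y x (real N + t)) \<longlongrightarrow> xs) at_top" if "x \<in> A" for x
          by (rule filterlim_compose[OF Y(2)[OF that]])
             (rule filterlim_tendsto_add_at_top[OF tendsto_const filterlim_ident])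
        from tendsto_diff[OF this[OF hq(1)] this[OF hq(2)]]
        show "(d \<longlongrightarrow> 0) at_top" by (simp add: d_def[abs_def])
      qed
      moreover have "\<pi> (d 0) = 0" using q(3) by (simp add: d_def \<psi>_def linear_diff[OF lin])
      then have "d 0 \<in> Eu" using pi_Eu[of "d 0"] by simp
      ultimately have "a * (norm (d 0))\<^sup>2 \<le> 0" using neg[of "d 0"] by simp
      then have "d 0 = 0" using a_pos by (simp add: mult_le_0_iff)
      then have "h q = h q'" using Ydist(2)[OF hq, of "real N"] by (simp add: d_def)
      then show "q = q'" using hinj q TB1 by (meson inj_onD subsetD)
    qed
  qed
qed

text \<open>The vector field is extended from \<open>cball xs \<rho>\<close> by composing its nonlinear part with the
  closest point retraction, which is 1-Lipschitz.\<close>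

lemma ball_in_W_s_loc:
  fixes g :: "'a \<Rightarrow> 'a"
  assumes linJ: "linear J" and gxs: "g xs = 0" and \<rho>: "\<rho> > 0" and \<delta>: "\<delta> > 0"
    and approx: "\<And>x y. x \<in> cball xs \<rho> \<Longrightarrow> y \<in> cball xs \<rho> \<Longrightarrow> norm (g x - g y - J (x - y)) \<le> \<delta> * norm (x - y)"
    and Jmono: "\<And>d e. norm e \<le> \<delta> * norm d \<Longrightarrow> V d (J d + e) \<le> - a * (norm d)\<^sup>2"
    and U: "nhd_in K xs U" and D: "open D" "D \<subseteq> K"
    and inv: "\<And>y. solution g y \<Longrightarrow> y 0 \<in> D \<Longrightarrow> (y \<longlongrightarrow> xs) at_top \<Longrightarrow> \<forall>t\<ge>0. y t \<in> D"
    and meets: "W_s_loc K g U xs \<inter> D \<noteq> {}"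
  obtains A where "A \<subseteq> W_s_loc K g U xs" "A homeomorphic (ball 0 1 \<inter> Es)"
proof -
  define cp where "cp = closest_point (cball (0::'a) \<rho>)"
  have cp: "cp x \<in> cball 0 \<rho>" "norm (cp x - cp y) \<le> norm (x - y)" for x y
    using closest_point_in_set[of "cball 0 \<rho>" x] closest_point_lipschitz[of "cball 0 \<rho>" x y] \<rho>
    by (auto simp: cp_def dist_norm)
  have cp_id: "cp x = x" if "norm x \<le> \<rho>" for x
    using that by (simp add: cp_def closest_point_self)
  define N where "N x = g (xs + x) - J x" for x
  define G where "G x = J x + N (cp x)" for x
  have Ndiff: "norm (N (cp x) - N (cp y)) \<le> \<delta> * norm (x - y)" for x y
  proof -
    have "norm (N (cp x) - N (cp y)) = norm (g (xs + cp x) - g (xs + cp y) - J (cp x - cp y))"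
      by (simp add: N_def linear_diff[OF linJ] algebra_simps)
    also have "\<dots> \<le> \<delta> * norm (cp x - cp y)"
      using approx[of "xs + cp x" "xs + cp y"] cp(1)[of x] cp(1)[of y] by (simp add: dist_norm)
    also have "\<dots> \<le> \<delta> * norm (x - y)" using cp(2) \<delta> by (intro mult_left_mono) auto
    finally show ?thesis .
  qed
  have Gdiff: "G x - G y = J (x - y) + (N (cp x) - N (cp y))" for x y
    by (simp add: G_def linear_diff[OF linJ])
  have Geq: "G x = g (xs + x)" if "norm x \<le> \<rho>" for x
    using that by (simp add: G_def N_def cp_id)
  obtain j where j: "j > 0" "\<And>x. norm (J x) \<le> j * norm x"
    using linear_bounded_pos[OF linJ] by auto
  interpret saddle_system V a Es Eu \<pi> G "j + \<delta>"
  proof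
    show "(j + \<delta>)-lipschitz_on UNIV G"
    proof (rule lipschitz_onI)
      fix x y
      have "norm (G x - G y) \<le> norm (J (x - y)) + norm (N (cp x) - N (cp y))"
        unfolding Gdiff by (rule norm_triangle_ineq)
      also have "\<dots> \<le> (j + \<delta>) * norm (x - y)"
        using j(2)[of "x - y"] Ndiff[of x y] by (simp add: algebra_simps)
      finally show "dist (G x) (G y) \<le> (j + \<delta>) * dist x y" by (simp add: dist_norm)
    qed (use j \<delta> in auto)
    show "G 0 = 0" using Geq[of 0] \<rho> gxs by simp
    show "V (x - y) (G x - G y) \<le> - a * (norm (x - y))\<^sup>2" for x y
      unfolding Gdiff by (rule Jmono[OF Ndiff])
  qed (use j \<delta> in auto)
  obtain C c where C: "C > 0" "c > 0"
    "\<And>x t. x \<in> stable_set \<Longrightarrow> t \<ge> 0 \<Longrightarrow> (norm (flow x t))\<^sup>2 \<le> C * exp (- c * t) * (norm x)\<^sup>2"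
    by (metis stable_set_decay)
  \<comment> \<open>By the decay estimate an orbit in the stable set grows by at most the factor
    \<open>sqrt C\<close>. Starting within \<open>\<eta>\<close> it thus stays within
    \<open>\<rho>\<close>, where the extended field \<open>G\<close> agrees with \<open>g\<close>
    shifted by \<open>xs\<close>.\<close>
  define \<eta> where "\<eta> = \<rho> / (sqrt C + 1)"
  have \<eta>: "\<eta> > 0" using \<rho> C by (simp add: \<eta>_def add_nonneg_pos)
  have stays: "norm (flow x t) \<le> \<rho>" if "x \<in> stable_set" "norm x < \<eta>" "t \<ge> 0" for x t
  proof -
    have "(norm (flow x t))\<^sup>2 \<le> C * exp (- c * t) * (norm x)\<^sup>2" using C(3) that by blast
    also have "\<dots> \<le> C * 1 * (norm x)\<^sup>2"
      using C that by (intro mult_right_mono mult_left_mono) auto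
    also have "\<dots> = (sqrt C * norm x)\<^sup>2" using C by (simp add: power_mult_distrib)
    finally have "norm (flow x t) \<le> sqrt C * norm x" by (rule power2_le_imp_le) (use C in auto)
    also have "\<dots> \<le> (sqrt C + 1) * \<eta>" using that(2) C by (intro mult_mono) auto
    also have "\<dots> = \<rho>" using C by (simp add: \<eta>_def add_nonneg_pos less_imp_neq[THEN not_sym])
    finally show ?thesis .
  qed
  obtain O' where O': "open O'" "xs \<in> O'" "K \<inter> O' \<subseteq> U"
    using U by (auto simp: nhd_in_def openin_open)
  obtain r where r: "r > 0" "ball xs r \<subseteq> O'" using O' open_contains_ball by blast
  obtain x0 y where x0: "x0 \<in> D" "forward_orbit K g x0 y" "(y \<longlongrightarrow> xs) at_top"
    using meets by (auto simp: W_s_loc_def)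
  have soly: "solution g y" and y0: "y 0 = x0" using x0(2) by (auto simp: forward_orbit_def solution_def)
  have yD: "\<forall>t\<ge>0. y t \<in> D" by (rule inv[OF soly _ x0(3)]) (simp add: y0 x0)
  have "\<forall>\<^sub>F t in at_top. dist (y t) xs < min (min \<eta> \<rho>) r" using x0(3) by (rule tendstoD) (use \<eta> \<rho> r in auto)
  then obtain T' where T': "\<And>t. t \<ge> T' \<Longrightarrow> dist (y t) xs < min (min \<eta> \<rho>) r" by (auto simp: eventually_at_top_linorder)
  \<comment> \<open>The given orbit is followed until it stays close to \<open>xs\<close>. It is
    still in \<open>D\<close> then, so \<open>z 0\<close> is a point of the stable set of the
    extended field with \<open>xs + z 0\<close> in the open set \<open>D\<close>.\<close>
  define T where "T = max 0 T'"
  define z where "z t = y (T + t) - xs" for t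
  have z: "norm (z t) < \<eta>" "norm (z t) < \<rho>" "norm (z t) < r" if "t \<ge> 0" for t
    using T'[of "T + t"] that by (auto simp: z_def T_def dist_norm)
  have zsol: "solution G z"
    unfolding solution_def
  proof (intro allI impI)
    fix t :: real assume t: "t \<ge> 0"
    have "((\<lambda>t. y (T + t)) has_vector_derivative g (y (T + t))) (at t within {0..})"
      by (rule solutionD[OF solution_shift[OF soly] t]) (simp add: T_def)
    then have "(z has_vector_derivative g (y (T + t)) - 0) (at t within {0..})"
      unfolding z_def by (intro has_vector_derivative_diff has_vector_derivative_const)
    moreover have "G (z t) = g (y (T + t))" using Geq[of "z t"] z(2)[OF t] by (simp add: z_def)
    ultimately show "(z has_vector_derivative G (z t)) (at t within {0..})" by simp
  qed
  have zlim: "(z \<longlongrightarrow> 0) at_top"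
  proof -
    have "((\<lambda>t. y (T + t)) \<longlongrightarrow> xs) at_top"
      by (rule filterlim_compose[OF x0(3)]) (rule filterlim_tendsto_add_at_top[OF tendsto_const filterlim_ident])
    then show ?thesis unfolding z_def by (rule LIM_zero)
  qed
  have zst: "z 0 \<in> stable_set"
    unfolding stable_set_def
  proof (intro CollectI allI impI)
    fix s :: real assume s: "s \<ge> 0"
    have "V (z (s + 0)) (z (s + 0)) \<ge> 0"
    proof (rule V_nonneg_of_convergent[where d = "\<lambda>t. z (s + t)"])
      show "((\<lambda>t. z (s + t)) has_vector_derivative G (z (s + t))) (at t within {0..})" if "t \<ge> 0" for t
        by (rule solutionD[OF solution_shift[OF zsol s] that])
      show "V (z (s + t)) (G (z (s + t))) \<le> 0" for t
        by (rule order_trans[OF mono_0]) (use a_pos in simp)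
      show "((\<lambda>t. z (s + t)) \<longlongrightarrow> 0) at_top"
        by (rule filterlim_compose[OF zlim]) (rule filterlim_tendsto_add_at_top[OF tendsto_const filterlim_ident])
    qed
    then show "V (flow (z 0) s) (flow (z 0) s) \<ge> 0" using flow_unique[OF zsol s] by simp
  qed
  \<comment> \<open>The whole ball around \<open>z 0\<close> satisfies three open conditions: its
    stable points have orbits governed by \<open>g\<close>, they correspond to points of
    \<open>U\<close>, and they start in \<open>D\<close>, hence never leave
    \<open>K\<close>.\<close>
  have "z 0 \<in> ball 0 \<eta> \<inter> ball 0 r \<inter> (\<lambda>x. xs + x) -` D"
    using z[of 0] yD by (simp add: z_def T_def)
  moreover have "open (ball 0 \<eta> \<inter> ball 0 r \<inter> (\<lambda>x. xs + x) -` D)"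
    by (intro open_Int open_ball open_vimage D continuous_intros)
  ultimately obtain e where e: "e > 0" "ball (z 0) e \<subseteq> ball 0 \<eta> \<inter> ball 0 r \<inter> (\<lambda>x. xs + x) -` D"
    using open_contains_ball by meson
  obtain A where A: "A \<subseteq> stable_set \<inter> ball (z 0) e" "A homeomorphic (ball 0 1 \<inter> Es)"
    using stable_set_contains_ball[OF zst e(1)] by blast
  have "(\<lambda>x. xs + x) ` A \<subseteq> W_s_loc K g U xs"
  proof (rule image_subsetI)
    fix x assume "x \<in> A"
    then have x: "x \<in> stable_set" "norm x < \<eta>" "norm x < r" "xs + x \<in> D"
      using A(1) e(2) by auto
    define v where "v t = xs + flow x t" for t
    have vsol: "solution g v"
      unfolding solution_def
    proof (intro allI impI)
      fix t :: real assume t: "t \<ge> 0"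
      have "(v has_vector_derivative 0 + G (flow x t)) (at t within {0..})"
        unfolding v_def by (intro has_vector_derivative_add has_vector_derivative_const solutionD solution_flow t)
      then show "(v has_vector_derivative g (v t)) (at t within {0..})"
        using Geq[OF stays[OF x(1,2) t]] by (simp add: v_def)
    qed
    have vlim: "(v \<longlongrightarrow> xs) at_top"
      using tendsto_add[OF tendsto_const stable_set_tendsto[OF x(1)], of xs] by (simp add: v_def[abs_def])
    have v0: "v 0 = xs + x" by (simp add: v_def)
    have "\<forall>t\<ge>0. v t \<in> D" by (rule inv[OF vsol _ vlim]) (simp add: v0 x)
    then have "forward_orbit K g (xs + x) v"
      using vsol v0 D(2) by (auto simp: forward_orbit_def solution_def)
    moreover have "xs + x \<in> U" using x D(2) r(2) O'(3) by (auto simp: dist_norm subset_iff)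
    ultimately show "xs + x \<in> W_s_loc K g U xs" using vlim unfolding W_s_loc_def by blast
  qed
  moreover have "(\<lambda>x. xs + x) ` A homeomorphic (ball 0 1 \<inter> Es)"
    using homeomorphic_translation[of A xs] A(2) homeomorphic_sym homeomorphic_trans by blast
  ultimately show thesis using that by blast
qed

theorem mdim_W_s_loc:
  fixes g :: "'a \<Rightarrow> 'a"
  assumes linJ: "linear J" and J: "\<And>x. V x (J x) \<le> - (2 * a) * (norm x)\<^sup>2" and gxs: "g xs = 0"
    and strict: "\<And>\<delta>. \<delta> > 0 \<Longrightarrow> \<exists>\<rho>>0. \<forall>x\<in>cball xs \<rho>. \<forall>y\<in>cball xs \<rho>. norm (g x - g y - J (x - y)) \<le> \<delta> * norm (x - y)"
    and lipK: "M-lipschitz_on K g"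
    and U: "nhd_in K xs U" and D: "open D" "D \<subseteq> K"
    and inv: "\<And>y. solution g y \<Longrightarrow> y 0 \<in> D \<Longrightarrow> (y \<longlongrightarrow> xs) at_top \<Longrightarrow> \<forall>t\<ge>0. y t \<in> D"
    and meets: "W_s_loc K g U xs \<inter> D \<noteq> {}"
  shows "mdim (W_s_loc K g U xs) = dim Es"
proof -
  obtain \<rho> \<delta> where \<rho>: "\<rho> > 0" "\<delta> > 0"
    and approx: "\<And>x y. x \<in> cball xs \<rho> \<Longrightarrow> y \<in> cball xs \<rho> \<Longrightarrow> norm (g x - g y - J (x - y)) \<le> \<delta> * norm (x - y)"
    and Jmono: "\<And>d e. norm e \<le> \<delta> * norm d \<Longrightarrow> V d (J d + e) \<le> - a * (norm d)\<^sup>2"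
    using local_monotonicity[OF J strict] by metis
  have mono: "V (x - y) (g x - g y) \<le> 0" if "x \<in> cball xs \<rho>" "y \<in> cball xs \<rho>" for x y
  proof -
    have "V (x - y) (J (x - y) + (g x - g y - J (x - y))) \<le> - a * (norm (x - y))\<^sup>2"
      by (rule Jmono[OF approx[OF that]])
    also have "\<dots> \<le> 0" using a_pos by simp
    finally show ?thesis by simp
  qed
  obtain A where A: "A \<subseteq> W_s_loc K g U xs" "A homeomorphic (ball 0 1 \<inter> Es)"
    by (rule ball_in_W_s_loc[OF linJ gxs \<rho> approx Jmono U D inv meets])
  let ?X = "{dim W | W A. subspace (W :: 'a set) \<and> A \<subseteq> W_s_loc K g U xs \<and> A homeomorphic (ball 0 1 \<inter> W)}"
  show ?thesis
    unfolding mdim_def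
  proof (rule Max_eqI)
    show "finite ?X"
      by (rule finite_subset[of _ "{..DIM('a)}"]) (auto simp: dim_subset_UNIV)
    show "d \<le> dim Es" if "d \<in> ?X" for d
      using that dim_le_of_ball_in_W_s_loc[OF lipK \<rho>(1) mono] by auto
    show "dim Es \<in> ?X" using A subEs by blast
  qed
qed

end

section \<open>Continuously differentiable maps\<close>

text \<open>Continuity of the derivative is tested on each fixed vector; in finite dimension this is
  the same as continuity in the operator norm. The derivatives are two-sided, so \<open>S\<close> is
  open in all uses.\<close>

definition C1_on :: "'a::euclidean_space set \<Rightarrow> ('a \<Rightarrow> 'b::real_normed_vector) \<Rightarrow> bool" where
  "C1_on S f \<longleftrightarrow> (\<exists>D. (\<forall>x\<in>S. (f has_derivative D x) (at x)) \<and> (\<forall>h. continuous_on S (\<lambda>x. D x h)))"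

lemma C1_onI:
  "(\<And>x. x \<in> S \<Longrightarrow> (f has_derivative D x) (at x)) \<Longrightarrow> (\<And>h. continuous_on S (\<lambda>x. D x h)) \<Longrightarrow> C1_on S f"
  unfolding C1_on_def by blast

lemma C1_onE:
  assumes "C1_on S f"
  obtains D where "\<And>x. x \<in> S \<Longrightarrow> (f has_derivative D x) (at x)" "\<And>h. continuous_on S (\<lambda>x. D x h)"
  using assms unfolding C1_on_def by blast

lemma C1_on_frechet:
  assumes "C1_on S f"
  shows "x \<in> S \<Longrightarrow> (f has_derivative frechet_derivative f (at x)) (at x)"
    and "continuous_on S (\<lambda>x. frechet_derivative f (at x) h)"
proof -
  obtain D where D: "\<And>x. x \<in> S \<Longrightarrow> (f has_derivative D x) (at x)" "\<And>h. continuous_on S (\<lambda>x. D x h)"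
    by (metis C1_onE[OF assms])
  have eq: "frechet_derivative f (at x) = D x" if "x \<in> S" for x
    using frechet_derivative_at[OF D(1)[OF that]] by simp
  show "x \<in> S \<Longrightarrow> (f has_derivative frechet_derivative f (at x)) (at x)" by (simp add: eq D(1))
  show "continuous_on S (\<lambda>x. frechet_derivative f (at x) h)"
    using D(2)[of h] by (simp add: eq cong: continuous_on_cong)
qed

lemma C1_on_continuous:
  assumes "C1_on S f"
  shows "continuous_on S f"
proof (rule continuous_at_imp_continuous_on, rule ballI)
  fix x assume "x \<in> S"
  from has_derivative_continuous[OF C1_on_frechet(1)[OF assms this]] show "isCont f x" .
qed

section \<open>Closure properties\<close>

lemma C1_on_const: "C1_on S (\<lambda>x. c)"
  by (rule C1_onI[of _ _ "\<lambda>x h. 0"]) auto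

lemma C1_on_linear: "bounded_linear f \<Longrightarrow> C1_on S f"
  by (rule C1_onI[of _ _ "\<lambda>x. f"]) (auto intro: bounded_linear_imp_has_derivative)

lemma C1_on_add:
  assumes "C1_on S f" "C1_on S g" shows "C1_on S (\<lambda>x. f x + g x)"
proof (rule C1_onI)
  show "((\<lambda>x. f x + g x) has_derivative (\<lambda>h. frechet_derivative f (at x) h + frechet_derivative g (at x) h)) (at x)" if "x \<in> S" for x
    by (rule has_derivative_add[OF C1_on_frechet(1)[OF assms(1) that] C1_on_frechet(1)[OF assms(2) that]])
qed (intro continuous_intros C1_on_frechet(2) assms)

lemma C1_on_diff:
  assumes "C1_on S f" "C1_on S g" shows "C1_on S (\<lambda>x. f x - g x)"
proof (rule C1_onI)
  show "((\<lambda>x. f x - g x) has_derivative (\<lambda>h. frechet_derivative f (at x) h - frechet_derivative g (at x) h)) (at x)" if "x \<in> S" for x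
    by (rule has_derivative_diff[OF C1_on_frechet(1)[OF assms(1) that] C1_on_frechet(1)[OF assms(2) that]])
qed (intro continuous_intros C1_on_frechet(2) assms)

lemma C1_on_mult:
  fixes f g :: "'a::euclidean_space \<Rightarrow> real"
  assumes "C1_on S f" "C1_on S g" shows "C1_on S (\<lambda>x. f x * g x)"
proof (rule C1_onI)
  show "((\<lambda>x. f x * g x) has_derivative (\<lambda>h. f x * frechet_derivative g (at x) h + frechet_derivative f (at x) h * g x)) (at x)" if "x \<in> S" for x
    by (rule has_derivative_mult[OF C1_on_frechet(1)[OF assms(1) that] C1_on_frechet(1)[OF assms(2) that]])
qed (intro continuous_intros C1_on_frechet(2) C1_on_continuous assms)

lemma C1_on_sum:
  assumes "finite I" "\<And>i. i \<in> I \<Longrightarrow> C1_on S (f i)" shows "C1_on S (\<lambda>x. \<Sum>i\<in>I. f i x)"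
  using assms by (induction I) (auto intro!: C1_on_const C1_on_add)

lemma C1_on_power:
  fixes f :: "'a::euclidean_space \<Rightarrow> real"
  assumes "C1_on S f" shows "C1_on S (\<lambda>x. f x ^ n)"
  by (induction n) (auto intro!: C1_on_const C1_on_mult assms)

lemma C1_on_vec_lambda:
  fixes f :: "'n::finite \<Rightarrow> 'a::euclidean_space \<Rightarrow> real"
  assumes "\<And>i. C1_on S (f i)" shows "C1_on S (\<lambda>x. \<chi> i. f i x)"
proof (rule C1_onI)
  show "((\<lambda>x. \<chi> i. f i x) has_derivative (\<lambda>h. \<chi> i. frechet_derivative (f i) (at x) h)) (at x)" if "x \<in> S" for x
    by (rule has_derivative_componentwise_within[THEN iffD2])
       (use C1_on_frechet(1)[OF assms that] in \<open>auto simp: Basis_vec_def inner_axis\<close>)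
qed (intro continuous_on_vec_lambda C1_on_frechet(2) assms)

lemma C1_on_nth: "C1_on S f \<Longrightarrow> C1_on S (\<lambda>x. f x $ i)"
  by (rule C1_onI[OF bounded_linear.has_derivative[OF bounded_linear_vec_nth C1_on_frechet(1)]])
     (auto intro!: continuous_intros C1_on_frechet(2))

lemma C1_on_compose:
  fixes f :: "'a::euclidean_space \<Rightarrow> 'b::euclidean_space"
  assumes g: "C1_on T g" and f: "C1_on S f" and im: "\<And>x. x \<in> S \<Longrightarrow> f x \<in> T"
  shows "C1_on S (\<lambda>x. g (f x))"
proof (rule C1_onI)
  show "((\<lambda>x. g (f x)) has_derivative (\<lambda>h. frechet_derivative g (at (f x)) (frechet_derivative f (at x) h))) (at x)"
    if "x \<in> S" for x
    using diff_chain_at[OF C1_on_frechet(1)[OF f that] C1_on_frechet(1)[OF g im[OF that]]] by (simp add: o_def)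
  fix h
  \<comment> \<open>The vector to which the outer derivative is applied varies with the point, but
    continuity is known only for fixed vectors; hence the expansion in the basis.\<close>
  have expand: "frechet_derivative g (at (f x)) v = (\<Sum>b\<in>Basis. (v \<bullet> b) *\<^sub>R frechet_derivative g (at (f x)) b)"
    if "x \<in> S" for x v
  proof -
    have lin: "linear (frechet_derivative g (at (f x)))"
      by (rule has_derivative_linear[OF C1_on_frechet(1)[OF g im[OF that]]])
    have "frechet_derivative g (at (f x)) v = frechet_derivative g (at (f x)) (\<Sum>b\<in>Basis. (v \<bullet> b) *\<^sub>R b)"
      by (simp add: euclidean_representation)
    then show ?thesis by (simp add: linear_sum[OF lin] linear_scale[OF lin])
  qed
  have "continuous_on S (\<lambda>x. \<Sum>b\<in>Basis. (frechet_derivative f (at x) h \<bullet> b) *\<^sub>R frechet_derivative g (at (f x)) b)"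
    by (intro continuous_intros C1_on_frechet(2)[OF f] continuous_on_compose2[OF C1_on_frechet(2)[OF g] C1_on_continuous[OF f]])
       (use im in auto)
  then show "continuous_on S (\<lambda>x. frechet_derivative g (at (f x)) (frechet_derivative f (at x) h))"
    by (rule continuous_on_cong[THEN iffD1, rotated -1]) (simp_all add: expand)
qed

lemma C1_on_compose_real:
  fixes f :: "'a::euclidean_space \<Rightarrow> real"
  assumes g: "\<And>t. t \<in> T \<Longrightarrow> (g has_real_derivative g' t) (at t)" "continuous_on T g'"
    and f: "C1_on S f" and im: "\<And>x. x \<in> S \<Longrightarrow> f x \<in> T"
  shows "C1_on S (\<lambda>x. g (f x))"
proof (rule C1_on_compose[OF _ f im])
  show "C1_on T g"
    by (rule C1_onI[of _ _ "\<lambda>t h. g' t * h"])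
       (use g in \<open>auto simp: has_field_derivative_def intro!: continuous_intros\<close>)
qed

lemma C1_on_powr:
  fixes f :: "'a::euclidean_space \<Rightarrow> real"
  assumes "C1_on S f" "\<And>x. x \<in> S \<Longrightarrow> f x > 0"
  shows "C1_on S (\<lambda>x. f x powr c)"
  by (rule C1_on_compose_real[of "{0<..}" "\<lambda>t. t powr c" "\<lambda>t. c * t powr (c - 1)", OF _ _ assms(1)])
     (use assms(2) in \<open>auto intro!: derivative_eq_intros continuous_intros\<close>)

lemma C1_on_inverse:
  fixes f :: "'a::euclidean_space \<Rightarrow> real"
  assumes "C1_on S f" "\<And>x. x \<in> S \<Longrightarrow> f x > 0"
  shows "C1_on S (\<lambda>x. inverse (f x))"
  by (rule C1_on_compose_real[of "{0<..}" "inverse" "\<lambda>t. - (inverse t ^ 2)", OF _ _ assms(1)])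
     (use assms(2) in \<open>auto intro!: derivative_eq_intros continuous_intros simp: power2_eq_square\<close>)

section \<open>Mean value estimates\<close>

lemma norm_linear_le_Basis:
  fixes f :: "'a::euclidean_space \<Rightarrow> 'b::real_normed_vector"
  assumes "linear f"
  shows "norm (f h) \<le> (\<Sum>b\<in>Basis. norm (f b)) * norm h"
proof -
  have "f h = f (\<Sum>b\<in>Basis. (h \<bullet> b) *\<^sub>R b)" by (simp add: euclidean_representation)
  also have "\<dots> = (\<Sum>b\<in>Basis. (h \<bullet> b) *\<^sub>R f b)" by (simp add: linear_sum[OF assms] linear_scale[OF assms])
  also have "norm \<dots> \<le> (\<Sum>b\<in>Basis. norm ((h \<bullet> b) *\<^sub>R f b))" by (rule norm_sum)
  also have "\<dots> \<le> (\<Sum>b\<in>Basis. norm (f b) * norm h)"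
  proof (rule sum_mono)
    fix b :: 'a assume "b \<in> Basis"
    from mult_right_mono[OF Basis_le_norm[OF this, of h] norm_ge_zero[of "f b"]]
    show "norm ((h \<bullet> b) *\<^sub>R f b) \<le> norm (f b) * norm h" by (simp add: mult.commute)
  qed
  finally show ?thesis by (simp add: sum_distrib_right)
qed

text \<open>The mean value inequality is applied to \<open>g\<close> minus its linear part at
  \<open>xs\<close>, whose derivative is small on a small ball.\<close>

lemma C1_strict_differentiability:
  fixes g :: "'a::euclidean_space \<Rightarrow> 'b::real_normed_vector"
  assumes g: "C1_on UNIV g" and \<delta>: "\<delta> > 0"
  shows "\<exists>\<rho>>0. \<forall>x\<in>cball xs \<rho>. \<forall>y\<in>cball xs \<rho>.
    norm (g x - g y - frechet_derivative g (at xs) (x - y)) \<le> \<delta> * norm (x - y)"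
proof -
  let ?D = "\<lambda>x. frechet_derivative g (at x)"
  have der: "(g has_derivative ?D x) (at x)" for x by (rule C1_on_frechet(1)[OF g]) simp
  have lin: "linear (?D x)" for x by (rule has_derivative_linear[OF der])
  define s where "s x = (\<Sum>b\<in>Basis. norm (?D x b - ?D xs b))" for x
  have "continuous_on UNIV s" unfolding s_def by (intro continuous_intros C1_on_frechet(2)[OF g])
  then have "(s \<longlongrightarrow> s xs) (nhds xs)" by (simp add: continuous_on_eq_continuous_at isCont_def tendsto_at_iff_tendsto_nhds)
  then have "\<forall>\<^sub>F x in nhds xs. s x < \<delta>" by (rule order_tendstoD(2)) (use \<delta> in \<open>simp add: s_def\<close>)
  then obtain e where e: "e > 0" "\<And>x. dist x xs < e \<Longrightarrow> s x < \<delta>" by (auto simp: eventually_nhds_metric)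
  define \<rho> where "\<rho> = e / 2"
  have "norm (g x - g y - ?D xs (x - y)) \<le> \<delta> * norm (x - y)" if "x \<in> cball xs \<rho>" "y \<in> cball xs \<rho>" for x y
  proof -
    have "norm ((g x - ?D xs x) - (g y - ?D xs y)) \<le> \<delta> * norm (x - y)"
    proof (rule differentiable_bound[OF convex_cball _ _ that])
      fix z assume z: "z \<in> cball xs \<rho>"
      show "((\<lambda>x. g x - ?D xs x) has_derivative (\<lambda>h. ?D z h - ?D xs h)) (at z within cball xs \<rho>)"
        by (intro has_derivative_diff has_derivative_at_withinI[OF der] has_derivative_at_withinI[OF linear_imp_has_derivative] lin)
      have l: "linear (\<lambda>h. ?D z h - ?D xs h)" by (intro linear_compose_sub lin)
      have "s z < \<delta>" using e z by (auto simp: \<rho>_def dist_commute)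
      then have "norm (?D z h - ?D xs h) \<le> \<delta> * norm h" for h
        using norm_linear_le_Basis[OF l, of h] mult_right_mono[of "s z" \<delta> "norm h"] by (simp add: s_def)
      then show "onorm (\<lambda>h. ?D z h - ?D xs h) \<le> \<delta>" by (rule onorm_le)
    qed
    then show ?thesis by (simp add: linear_diff[OF lin] algebra_simps)
  qed
  then show ?thesis using e by (intro exI[of _ \<rho>]) (auto simp: \<rho>_def)
qed

text \<open>\<open>K\<close> is enclosed in a ball because the mean value inequality needs a convex
  set.\<close>

lemma C1_lipschitz_on_bounded:
  fixes g :: "'a::euclidean_space \<Rightarrow> 'b::real_normed_vector"
  assumes g: "C1_on UNIV g" and K: "bounded K"
  obtains M where "M-lipschitz_on K g"
proof -
  let ?D = "\<lambda>x. frechet_derivative g (at x)"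
  have der: "(g has_derivative ?D x) (at x)" for x by (rule C1_on_frechet(1)[OF g]) simp
  have lin: "linear (?D x)" for x by (rule has_derivative_linear[OF der])
  obtain r where "\<forall>x\<in>K. norm x \<le> r" using K unfolding bounded_iff by blast
  then have r: "K \<subseteq> cball 0 r" by auto
  define s where "s x = (\<Sum>b\<in>Basis. norm (?D x b))" for x
  have "continuous_on (cball 0 r) s"
    unfolding s_def by (intro continuous_intros continuous_on_subset[OF C1_on_frechet(2)[OF g]]) auto
  then have "bounded (s ` cball 0 r)" by (intro compact_imp_bounded compact_continuous_image) auto
  then obtain M where M: "M > 0" "\<And>x. x \<in> cball 0 r \<Longrightarrow> norm (s x) \<le> M" by (auto simp: bounded_pos)
  have "M-lipschitz_on (cball 0 r) g"
  proof (rule lipschitz_onI)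
    fix x y :: 'a assume xy: "x \<in> cball 0 r" "y \<in> cball 0 r"
    have "norm (g x - g y) \<le> M * norm (x - y)"
    proof (rule differentiable_bound[OF convex_cball _ _ xy])
      fix z :: 'a assume z: "z \<in> cball 0 r"
      show "(g has_derivative ?D z) (at z within cball 0 r)" by (rule has_derivative_at_withinI[OF der])
      have "norm (?D z h) \<le> M * norm h" for h
      proof -
        have "s z \<le> M" using M(2)[OF z] by simp
        from mult_right_mono[OF this norm_ge_zero[of h]] show ?thesis
          using norm_linear_le_Basis[OF lin, of z h] by (simp add: s_def)
      qed
      then show "onorm (?D z) \<le> M" by (rule onorm_le)
    qed
    then show "dist (g x) (g y) \<le> M * dist x y" by (simp add: dist_norm)
  qed (use M in simp)
  then show thesis using that lipschitz_on_subset[OF _ r] by blast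
qed

lemma C_map_continuous: "C_map r F \<Longrightarrow> continuous_on UNIV F"
  by (cases r) (auto intro: differentiable_imp_continuous_on)

lemma C_map_C1_on:
  fixes F :: "real^'n \<Rightarrow> real^'n"
  assumes "C_map q F" "q \<ge> 1"
  shows "C1_on UNIV F"
proof -
  obtain r where q: "q = Suc r" using assms(2) by (cases q) auto
  let ?D = "\<lambda>x. frechet_derivative F (at x)"
  have der: "(F has_derivative ?D x) (at x)" for x
    using assms(1) by (auto simp: q differentiable_on_def frechet_derivative_works[symmetric])
  have cont: "continuous_on UNIV (\<lambda>x. ?D x (axis l 1))" for l
    using assms(1) by (auto simp: q intro: C_map_continuous)
  have expand: "?D x h = (\<Sum>l\<in>UNIV. h $ l *\<^sub>R ?D x (axis l 1))" for x h
  proof -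
    have lin: "linear (?D x)" by (rule has_derivative_linear[OF der])
    have "?D x h = ?D x (\<Sum>l\<in>UNIV. h $ l *\<^sub>R axis l 1)" using basis_expansion[of h] by (simp add: scalar_mult_eq_scaleR)
    then show ?thesis by (simp add: linear_sum[OF lin] linear_scale[OF lin])
  qed
  have "continuous_on UNIV (\<lambda>x. ?D x h)" for h
  proof -
    have "continuous_on UNIV (\<lambda>x. \<Sum>l\<in>UNIV. h $ l *\<^sub>R ?D x (axis l 1))"
      by (intro continuous_intros cont)
    also have "(\<lambda>x. \<Sum>l\<in>UNIV. h $ l *\<^sub>R ?D x (axis l 1)) = (\<lambda>x. ?D x h)"
      by (rule ext) (rule expand[symmetric])
    finally show ?thesis .
  qed
  with der show ?thesis by (intro C1_onI)
qed

section \<open>Extension by zero across a level set\<close>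

lemma at_le_nhds: "at x \<le> nhds x"
  by (simp add: at_within_def)

text \<open>Near \<open>z\<close> the quantity \<open>1 - P\<close> is bounded by a constant times
  the distance to \<open>z\<close>. Hence the bound with exponent \<open>1 + \<epsilon>\<close>
  makes the difference quotient of \<open>R\<close> at \<open>z\<close> of order
  \<open>(1 - P)\<close> to the power \<open>\<epsilon>\<close>, which tends to 0. So the derivative
  there is 0, and the second bound makes the derivatives from inside converge to it.\<close>

lemma C1_on_extend_by_zero:
  fixes T P :: "'a::euclidean_space \<Rightarrow> real"
  assumes P: "C1_on UNIV P" and T: "C1_on {x. P x < 1} T" and \<epsilon>: "\<epsilon> > 0"
    and O: "\<And>z. P z = 1 \<Longrightarrow> \<forall>\<^sub>F x in nhds z. P x < 1 \<longrightarrow> \<bar>T x\<bar> \<le> c * (1 - P x) powr (1 + \<epsilon>)"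
    and o: "\<And>z h e. P z = 1 \<Longrightarrow> e > 0 \<Longrightarrow> \<forall>\<^sub>F x in nhds z. P x < 1 \<longrightarrow> \<bar>frechet_derivative T (at x) h\<bar> < e"
  defines "R \<equiv> (\<lambda>x. if P x < 1 then T x else 0)"
  shows "C1_on UNIV R" and "P z = 1 \<Longrightarrow> frechet_derivative R (at z) = (\<lambda>h. 0)"
proof -
  define D where "D x = (if P x < 1 then frechet_derivative T (at x) else (\<lambda>h. 0))" for x
  have Pcont: "continuous_on UNIV P" by (rule C1_on_continuous[OF P])
  have op: "open {x. P x < 1}" "open {x. P x > 1}"
    by (intro open_Collect_less Pcont continuous_on_const)+
  have Plim: "(P \<longlongrightarrow> P z) (nhds z)" for z
    using Pcont by (simp add: continuous_on_eq_continuous_at isCont_def tendsto_at_iff_tendsto_nhds)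
  have boundary: "(R has_derivative (\<lambda>h. 0)) (at z)" if z: "P z = 1" for z
    unfolding has_derivative_iff_norm
  proof
    obtain M where M: "M > 0" "\<And>x. norm (frechet_derivative P (at z) x) \<le> norm x * M"
      using has_derivative_bounded_linear[OF C1_on_frechet(1)[OF P UNIV_I]] bounded_linear.pos_bounded by blast
    obtain \<rho> where \<rho>: "\<rho> > 0" "\<forall>x\<in>cball z \<rho>. \<forall>y\<in>cball z \<rho>.
        norm (P x - P y - frechet_derivative P (at z) (x - y)) \<le> 1 * norm (x - y)"
      using C1_strict_differentiability[OF P, of 1 z] by auto
    have Plip: "\<bar>1 - P x\<bar> \<le> (M + 1) * norm (x - z)" if "x \<in> cball z \<rho>" for x
    proof -
      have "\<bar>P x - P z - frechet_derivative P (at z) (x - z)\<bar> \<le> norm (x - z)" using \<rho> that by auto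
      then show ?thesis using M(2)[of "x - z"] by (simp add: z algebra_simps)
    qed
    have "((\<lambda>x. \<bar>c\<bar> * (M + 1) * \<bar>1 - P x\<bar> powr \<epsilon>) \<longlongrightarrow> \<bar>c\<bar> * (M + 1) * 0) (at z)"
    proof (intro tendsto_intros)
      have "((\<lambda>x. \<bar>1 - P x\<bar>) \<longlongrightarrow> \<bar>1 - 1\<bar>) (at z)"
        using tendsto_mono[OF at_le_nhds Plim[of z]] unfolding z by (intro tendsto_intros)
      then show "((\<lambda>x. \<bar>1 - P x\<bar> powr \<epsilon>) \<longlongrightarrow> 0) (at z)"
        using tendsto_powr2[of "\<lambda>x. \<bar>1 - P x\<bar>" 0 "at z" "\<lambda>x. \<epsilon>" \<epsilon>] \<epsilon> by simp
    qed
    then have lim: "((\<lambda>x. \<bar>c\<bar> * (M + 1) * \<bar>1 - P x\<bar> powr \<epsilon>) \<longlongrightarrow> 0) (at z)" by simp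
    have "\<forall>\<^sub>F x in nhds z. x \<in> ball z \<rho>"
      by (rule eventually_nhds_in_open) (use \<rho>(1) in auto)
    then have "\<forall>\<^sub>F x in nhds z. x \<in> cball z \<rho>"
      by (rule eventually_mono) simp
    then have "\<forall>\<^sub>F x in nhds z. norm (norm (R x - R z - 0) / norm (x - z)) \<le> \<bar>c\<bar> * (M + 1) * \<bar>1 - P x\<bar> powr \<epsilon>"
      using O[OF z]
    proof eventually_elim
      case (elim x)
      show ?case
      proof (cases "P x < 1 \<and> x \<noteq> z")
        case True
        have "\<bar>T x\<bar> \<le> c * (1 - P x) powr (1 + \<epsilon>)" using elim True by blast
        then have "\<bar>T x\<bar> \<le> \<bar>c\<bar> * (1 - P x) powr (1 + \<epsilon>)"
          using mult_right_mono[OF abs_ge_self[of c] powr_ge_zero[of "1 - P x" "1 + \<epsilon>"]] by linarith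
        also have "\<dots> = \<bar>c\<bar> * (1 - P x) powr \<epsilon> * (1 - P x)" using True by (simp add: powr_add)
        also have "\<dots> \<le> \<bar>c\<bar> * (1 - P x) powr \<epsilon> * ((M + 1) * norm (x - z))"
          using Plip[of x] elim True by (intro mult_left_mono) auto
        finally have "\<bar>T x\<bar> / norm (x - z) \<le> \<bar>c\<bar> * (M + 1) * (1 - P x) powr \<epsilon>"
          using True by (simp add: field_simps)
        then show ?thesis using True z by (simp add: R_def)
      next
        case False
        then have "R x = 0" using z by (auto simp: R_def)
        then show ?thesis using z M by (simp add: R_def)
      qed
    qed
    then show "((\<lambda>y. norm (R y - R z - 0) / norm (y - z)) \<longlongrightarrow> 0) (at z)"
      by (intro Lim_null_comparison[OF filter_leD[OF at_le_nhds] lim])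
  qed simp
  have der: "(R has_derivative D x) (at x)" for x
  proof -
    consider "P x < 1" | "P x = 1" | "P x > 1" by linarith
    then show ?thesis
    proof cases
      case 1
      have "(R has_derivative frechet_derivative T (at x)) (at x)"
        by (rule has_derivative_transform_within_open[OF C1_on_frechet(1)[OF T] op(1)]) (use 1 in \<open>auto simp: R_def\<close>)
      then show ?thesis using 1 by (simp add: D_def)
    next
      case 2
      then show ?thesis using boundary by (simp add: D_def)
    next
      case 3
      have "(R has_derivative (\<lambda>h. 0)) (at x)"
        by (rule has_derivative_transform_within_open[OF has_derivative_const[of 0] op(2)]) (use 3 in \<open>auto simp: R_def\<close>)
      then show ?thesis using 3 by (simp add: D_def)
    qed
  qed
  have cont: "continuous_on UNIV (\<lambda>x. D x h)" for h
    unfolding continuous_on_eq_continuous_at[OF open_UNIV]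
  proof
    fix z
    consider "P z < 1" | "P z = 1" | "P z > 1" by linarith
    then show "isCont (\<lambda>x. D x h) z"
    proof cases
      case 1
      have "continuous_on {x. P x < 1} (\<lambda>x. D x h)"
        by (rule continuous_on_cong[THEN iffD1, OF refl _ C1_on_frechet(2)[OF T, of h]]) (simp add: D_def)
      then show ?thesis using continuous_on_eq_continuous_at[OF op(1)] 1 by blast
    next
      case 2
      have "((\<lambda>x. D x h) \<longlongrightarrow> 0) (at z)"
      proof (rule tendstoI)
        fix e :: real assume "e > 0"
        from o[OF 2 this, of h] have "\<forall>\<^sub>F x in nhds z. dist (D x h) 0 < e"
          by eventually_elim (use \<open>e > 0\<close> in \<open>auto simp: D_def\<close>)
        then show "\<forall>\<^sub>F x in at z. dist (D x h) 0 < e" by (rule filter_leD[OF at_le_nhds])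
      qed
      then show ?thesis using 2 by (simp add: isCont_def D_def)
    next
      case 3
      have "continuous_on {x. P x > 1} (\<lambda>x. D x h)"
        by (rule continuous_on_cong[THEN iffD1, OF refl _ continuous_on_const[of _ 0]]) (simp add: D_def)
      then show ?thesis using continuous_on_eq_continuous_at[OF op(2)] 3 by blast
    qed
  qed
  show "C1_on UNIV R" by (rule C1_onI[OF der cont])
  show "P z = 1 \<Longrightarrow> frechet_derivative R (at z) = (\<lambda>h. 0)"
    using frechet_derivative_at[OF boundary] by simp
qed

section \<open>The compactification\<close>

locale compactification =
  fixes \<alpha> :: "'n::finite \<Rightarrow> nat"
  assumes \<alpha>_pos: "\<And>i. \<alpha> i > 0"
begin

abbreviation c where "c \<equiv> cc \<alpha>"

lemma cc_pos: "c > 0"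
proof -
  have "c \<noteq> 0"
    unfolding cc_def using \<alpha>_pos by (subst Lcm_0_iff) (auto simp: image_iff)
  then show ?thesis by simp
qed

lemma \<alpha>_mult_\<beta>: "\<alpha> i * \<beta> \<alpha> i = c"
  unfolding \<beta>_def cc_def by (rule dvd_mult_div_cancel) (simp add: dvd_Lcm)

lemma \<beta>_pos: "\<beta> \<alpha> i > 0"
  using \<alpha>_mult_\<beta>[of i] cc_pos by (cases "\<beta> \<alpha> i") auto

lemma real_\<beta>: "real (\<beta> \<alpha> i) = real c / real (\<alpha> i)"
  using arg_cong[OF \<alpha>_mult_\<beta>[of i], of real] \<alpha>_pos[of i] by (simp add: field_simps)

text \<open>This is \<open>p\<close> to the power \<open>2 c\<close>: a polynomial, so that domain,
  horizon and \<open>\<kappa>\<close> are described without the root.\<close>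

definition PP :: "real^'n \<Rightarrow> real" where
  "PP x = (\<Sum>i\<in>UNIV. (x $ i) ^ (2 * \<beta> \<alpha> i))"

definition dPP :: "real^'n \<Rightarrow> real^'n \<Rightarrow> real" where
  "dPP x h = (\<Sum>i\<in>UNIV. 2 * real (\<beta> \<alpha> i) * (x $ i) ^ (2 * \<beta> \<alpha> i - 1) * h $ i)"

lemma PP_nonneg: "PP x \<ge> 0"
  unfolding PP_def by (intro sum_nonneg) (simp add: power_mult)

lemma pp_PP: "pp \<alpha> x = root (2 * c) (PP x)"
  by (simp add: pp_def PP_def)

lemma pp_power: "pp \<alpha> x ^ (2 * c) = PP x"
  unfolding pp_PP using cc_pos PP_nonneg by (intro real_root_pow_pos2) auto

lemma DD_PP: "DD \<alpha> = {x. PP x < 1}"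
  unfolding DD_def pp_PP using cc_pos by simp

lemma horizon_PP: "horizon \<alpha> = {x. PP x = 1}"
  unfolding horizon_def pp_PP using cc_pos by simp

lemma DDbar_PP: "DDbar \<alpha> = {x. PP x \<le> 1}"
  unfolding DDbar_def pp_PP using cc_pos by simp

lemma \<kappa>_PP: "\<kappa> \<alpha> x = inverse (1 - PP x)"
  unfolding \<kappa>_def pp_power ..

lemma PP_has_derivative: "(PP has_derivative dPP x) (at x)"
  unfolding PP_def[abs_def] dPP_def[abs_def]
  by (rule has_derivative_eq_rhs, rule has_derivative_sum, rule has_derivative_power,
      rule bounded_linear.has_derivative[OF bounded_linear_vec_nth has_derivative_ident])
     (simp add: algebra_simps)

lemma C1_component: "C1_on S (\<lambda>x::real^'n. x $ i)"
  by (rule C1_on_linear[OF bounded_linear_vec_nth])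

lemma C1_PP: "C1_on S PP"
  unfolding PP_def[abs_def] by (intro C1_on_sum C1_on_power C1_component) simp

lemma open_DD: "open (DD \<alpha>)"
  unfolding DD_PP by (intro open_Collect_less C1_on_continuous C1_PP continuous_on_const)

lemma bounded_DDbar: "bounded (DDbar \<alpha>)"
proof -
  have "norm x \<le> real CARD('n)" if "x \<in> DDbar \<alpha>" for x
  proof -
    have "\<bar>x $ i\<bar> \<le> 1" for i
    proof (rule ccontr)
      assume "\<not> \<bar>x $ i\<bar> \<le> 1"
      then have "1 < \<bar>x $ i\<bar> ^ (2 * \<beta> \<alpha> i)" using \<beta>_pos[of i] by (intro one_less_power) auto
      also have "\<dots> = (x $ i) ^ (2 * \<beta> \<alpha> i)" by (simp add: power_mult)
      also have "\<dots> \<le> PP x"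
        unfolding PP_def by (rule member_le_sum) (auto simp: power_mult)
      finally show False using that by (simp add: DDbar_PP)
    qed
    then have "(\<Sum>i\<in>UNIV. \<bar>x $ i\<bar>) \<le> (\<Sum>i\<in>(UNIV::'n set). 1)" by (intro sum_mono)
    then show ?thesis using norm_le_l1_cart[of x] by simp
  qed
  then show ?thesis by (auto simp: bounded_iff)
qed

text \<open>Scaling a horizon point by \<open>1 - t\<close> lowers \<open>PP\<close>, because all
  exponents are at least 1. Nontriviality of this filter makes the limit in
  \<open>jacobian_ext\<close> unique.\<close>

lemma horizon_limpt_DD:
  assumes "x \<in> horizon \<alpha>"
  shows "at x within DD \<alpha> \<noteq> bot"
proof -
  have P: "PP x = 1" using assms by (simp add: horizon_PP)
  have x0: "x \<noteq> 0"
  proof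
    assume "x = 0"
    then have z: "(x $ i) ^ (2 * \<beta> \<alpha> i) = 0" for i using \<beta>_pos[of i] by (simp add: zero_power)
    have "PP x = 0" unfolding PP_def z by simp
    then show False using P by simp
  qed
  have mem: "(1 - t) *\<^sub>R x \<in> DD \<alpha>" if t: "0 < t" "t \<le> 1" for t
  proof -
    have "PP ((1 - t) *\<^sub>R x) \<le> (\<Sum>i\<in>UNIV. (1 - t) * (x $ i) ^ (2 * \<beta> \<alpha> i))"
      unfolding PP_def
    proof (rule sum_mono)
      fix i
      have "(1 - t) ^ (2 * \<beta> \<alpha> i) \<le> (1 - t) ^ 1"
        using t \<beta>_pos[of i] by (intro power_decreasing) auto
      then show "((1 - t) *\<^sub>R x) $ i ^ (2 * \<beta> \<alpha> i) \<le> (1 - t) * (x $ i) ^ (2 * \<beta> \<alpha> i)"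
        by (simp add: power_mult_distrib mult_right_mono power_mult)
    qed
    also have "\<dots> = (1 - t) * PP x" by (simp add: PP_def sum_distrib_left)
    finally show ?thesis using t by (simp add: DD_PP P)
  qed
  have "x islimpt DD \<alpha>"
    unfolding islimpt_approachable
  proof (intro allI impI)
    fix e :: real assume e: "e > 0"
    define t where "t = min 1 (e / (2 * norm x))"
    have t: "0 < t" "t \<le> 1" "t \<le> e / (2 * norm x)" using e x0 by (auto simp: t_def)
    have "dist ((1 - t) *\<^sub>R x) x = t * norm x" using t by (simp add: dist_norm algebra_simps)
    also have "\<dots> \<le> e / (2 * norm x) * norm x" using t by (intro mult_right_mono) auto
    also have "\<dots> < e" using e x0 by simp
    finally have "dist ((1 - t) *\<^sub>R x) x < e" .
    moreover have "(1 - t) *\<^sub>R x \<noteq> x"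
    proof
      assume "(1 - t) *\<^sub>R x = x"
      then have "t *\<^sub>R x = 0" by (simp add: algebra_simps)
      then show False using t x0 by simp
    qed
    ultimately show "\<exists>x'\<in>DD \<alpha>. x' \<noteq> x \<and> dist x' x < e" using mem[OF t(1,2)] by blast
  qed
  then show ?thesis by (simp add: trivial_limit_within)
qed

lemma Lam_mult: "Lam \<alpha> *v x = (\<chi> i. real (\<alpha> i) * x $ i)"
  by (simp add: Lam_def matrix_vector_mult_def vec_eq_iff if_distrib[where f = "\<lambda>a. a * _"] cong: if_cong)

text \<open>Euler's identity for \<open>PP\<close>, which is quasi-homogeneous of degree
  \<open>2 c\<close>.\<close>

lemma dPP_Lam: "dPP x (Lam \<alpha> *v x) = 2 * real c * PP x"
proof -
  have eq: "2 * real (\<beta> \<alpha> i) * (x $ i) ^ (2 * \<beta> \<alpha> i - 1) * (real (\<alpha> i) * x $ i) = 2 * real c * (x $ i) ^ (2 * \<beta> \<alpha> i)" for i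
  proof -
    have "(x $ i) ^ (2 * \<beta> \<alpha> i) = (x $ i) ^ (2 * \<beta> \<alpha> i - 1) * x $ i"
      using \<beta>_pos[of i] by (simp flip: power_Suc2)
    moreover have "real (\<beta> \<alpha> i) * real (\<alpha> i) = real c" using \<alpha>_pos[of i] by (simp add: real_\<beta>)
    ultimately show ?thesis by (simp add: algebra_simps)
  qed
  show ?thesis by (simp only: dPP_def Lam_mult PP_def sum_distrib_left vec_lambda_beta eq)
qed

lemma linear_dPP: "linear (dPP x)"
  by (rule has_derivative_linear[OF PP_has_derivative])

lemma C1_qscale_\<kappa>: "C1_on (DD \<alpha>) (\<lambda>x. qscale \<alpha> (\<kappa> \<alpha> x) x)"
  unfolding qscale_def \<kappa>_PP
  by (intro C1_on_vec_lambda C1_on_mult C1_on_power C1_on_inverse C1_on_diff C1_on_const C1_PP C1_component)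
     (simp add: DD_PP)

lemma C1_tilde:
  assumes "C1_on UNIV h"
  shows "C1_on (DD \<alpha>) (\<lambda>x. tilde \<alpha> k h x $ i)"
proof -
  have "C1_on (DD \<alpha>) (\<lambda>x. inverse (1 - PP x) powr (- (k + real (\<alpha> i))) * h (qscale \<alpha> (\<kappa> \<alpha> x) x) $ i)"
    by (intro C1_on_mult C1_on_powr C1_on_inverse C1_on_diff C1_on_const C1_PP C1_on_nth
        C1_on_compose[OF assms C1_qscale_\<kappa>]) (auto simp: DD_PP)
  then show ?thesis by (simp add: tilde_def \<kappa>_PP)
qed

text \<open>The order estimates hold uniformly along the whole horizon. By continuity of
  \<open>pp\<close> they hold near each of its points, which is the local form that the extension by
  zero requires.\<close>

lemma eventually_to_horizon:
  assumes "\<forall>\<^sub>F x in to_horizon \<alpha>. Q x" and z: "PP z = 1"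
  shows "\<forall>\<^sub>F x in nhds z. PP x < 1 \<longrightarrow> Q x"
proof -
  obtain S where S: "\<forall>\<^sub>F s in at_left 1. S s" "\<And>x. S (pp \<alpha> x) \<Longrightarrow> Q x"
    using assms(1) unfolding to_horizon_def eventually_filtercomap by blast
  then obtain b where b: "b < 1" "\<And>s. b < s \<Longrightarrow> s < 1 \<Longrightarrow> S s"
    unfolding eventually_at_left_field by blast
  have "continuous_on UNIV (pp \<alpha>)"
    unfolding pp_PP[abs_def] by (intro continuous_intros C1_on_continuous C1_PP)
  then have "(pp \<alpha> \<longlongrightarrow> pp \<alpha> z) (nhds z)"
    by (simp add: continuous_on_eq_continuous_at isCont_def tendsto_at_iff_tendsto_nhds)
  moreover have "pp \<alpha> z = 1" using z cc_pos by (simp add: pp_PP)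
  ultimately have "\<forall>\<^sub>F x in nhds z. b < pp \<alpha> x" using b by (intro order_tendstoD(1)) auto
  then show ?thesis
  proof eventually_elim
    case (elim x)
    show ?case
    proof
      assume "PP x < 1"
      then have "pp \<alpha> x < 1" using cc_pos by (simp add: pp_PP)
      then show "Q x" using S(2) b(2) elim by blast
    qed
  qed
qed

end

section \<open>The desingularized vector field\<close>

locale desingularization = compactification \<alpha> for \<alpha> :: "'n::finite \<Rightarrow> nat" +
  fixes k \<epsilon> :: real and f F f_res :: "real^'n \<Rightarrow> real^'n"
  assumes C1_f: "C1_on UNIV f" and C1_F: "C1_on UNIV F"
    and f_res: "f_res = (\<lambda>x. f x - F x)"
    and qh: "quasi_homogeneous \<alpha> k F"
    and \<epsilon>_pos: "\<epsilon> > 0"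
    and res_O: "\<And>i. (\<lambda>x. tilde \<alpha> k f_res x $ i) \<in> O[to_horizon \<alpha>](\<lambda>x. \<kappa> \<alpha> x powr (- (1 + \<epsilon>)))"
    and res_deriv_o: "\<And>i l. (\<lambda>x. jacobian (tilde \<alpha> k f_res) (at x) $ i $ l)
                  \<in> o[to_horizon \<alpha>](\<lambda>x. \<kappa> \<alpha> x powr (- (1 + \<epsilon>)))"
begin

definition R :: "'n \<Rightarrow> real^'n \<Rightarrow> real" where
  "R i x = (if PP x < 1 then tilde \<alpha> k f_res x $ i else 0)"

abbreviation G where "G \<equiv> GG \<alpha> k f F"
abbreviation g where "g \<equiv> desing \<alpha> k f F"

lemma C1_f_res: "C1_on UNIV f_res"
  unfolding f_res by (rule C1_on_diff[OF C1_f C1_F])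

lemma \<kappa>_powr: "PP x < 1 \<Longrightarrow> \<kappa> \<alpha> x powr (- s) = (1 - PP x) powr s"
  by (simp add: \<kappa>_PP inverse_powr powr_minus)

lemma frechet_derivative_tilde:
  assumes "PP x < 1"
  shows "frechet_derivative (\<lambda>x. tilde \<alpha> k f_res x $ i) (at x) h
    = (\<Sum>l\<in>UNIV. h $ l * jacobian (tilde \<alpha> k f_res) (at x) $ i $ l)"
proof -
  have "C1_on (DD \<alpha>) (\<lambda>x. \<chi> i. tilde \<alpha> k f_res x $ i)"
    by (intro C1_on_vec_lambda C1_tilde C1_f_res)
  then have "C1_on (DD \<alpha>) (tilde \<alpha> k f_res)" by simp
  then have der: "(tilde \<alpha> k f_res has_derivative frechet_derivative (tilde \<alpha> k f_res) (at x)) (at x)"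
    by (rule C1_on_frechet(1)) (simp add: DD_PP assms)
  have lin: "linear (frechet_derivative (tilde \<alpha> k f_res) (at x))" by (rule has_derivative_linear[OF der])
  have "((\<lambda>x. tilde \<alpha> k f_res x $ i) has_derivative (\<lambda>h. frechet_derivative (tilde \<alpha> k f_res) (at x) h $ i)) (at x)"
    by (rule bounded_linear.has_derivative[OF bounded_linear_vec_nth der])
  from frechet_derivative_at[OF this]
  have "frechet_derivative (\<lambda>x. tilde \<alpha> k f_res x $ i) (at x) h = frechet_derivative (tilde \<alpha> k f_res) (at x) h $ i"
    by metis
  also have "\<dots> = (jacobian (tilde \<alpha> k f_res) (at x) *v h) $ i"
    unfolding jacobian_def using lin by (simp add: matrix_works)
  finally show ?thesis by (simp add: matrix_vector_mult_def mult.commute)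
qed

lemma C1_R: "C1_on UNIV (R i)" and R_derivative: "PP z = 1 \<Longrightarrow> frechet_derivative (R i) (at z) = (\<lambda>h. 0)"
proof -
  obtain b where b: "\<forall>\<^sub>F x in to_horizon \<alpha>. norm (tilde \<alpha> k f_res x $ i) \<le> b * norm (\<kappa> \<alpha> x powr (- (1 + \<epsilon>)))"
    using landau_o.bigE[OF res_O[of i]] by blast
  have T: "C1_on {x. PP x < 1} (\<lambda>x. tilde \<alpha> k f_res x $ i)"
    using C1_tilde[OF C1_f_res] by (simp add: DD_PP)
  have O: "\<forall>\<^sub>F x in nhds z. PP x < 1 \<longrightarrow> \<bar>tilde \<alpha> k f_res x $ i\<bar> \<le> b * (1 - PP x) powr (1 + \<epsilon>)" if "PP z = 1" for z
    using eventually_to_horizon[OF b that]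
  proof eventually_elim
    case (elim x)
    then show ?case using \<kappa>_powr[of x "1 + \<epsilon>"] by auto
  qed
  have o: "\<forall>\<^sub>F x in nhds z. PP x < 1 \<longrightarrow> \<bar>frechet_derivative (\<lambda>x. tilde \<alpha> k f_res x $ i) (at x) h\<bar> < e"
    if z: "PP z = 1" and e: "e > 0" for z h e
  proof -
    \<comment> \<open>The summand 1 keeps \<open>s\<close> positive when \<open>h = 0\<close>, so
      that \<open>d\<close> is a legitimate constant for the small-o bound.\<close>
    define s where "s = (\<Sum>l\<in>UNIV. \<bar>h $ l\<bar>) + 1"
    have s: "s > 0" by (simp add: s_def sum_nonneg add_nonneg_pos)
    define d where "d = e / (2 * s)"
    have d: "d > 0" using e s by (simp add: d_def)
    have "\<forall>\<^sub>F x in nhds z. PP x < 1 \<longrightarrow> norm (jacobian (tilde \<alpha> k f_res) (at x) $ i $ l) \<le> d * norm (\<kappa> \<alpha> x powr (- (1 + \<epsilon>)))" for l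
      by (rule eventually_to_horizon[OF landau_o.smallD[OF res_deriv_o d] z])
    then have "\<forall>\<^sub>F x in nhds z. \<forall>l. PP x < 1 \<longrightarrow> norm (jacobian (tilde \<alpha> k f_res) (at x) $ i $ l) \<le> d * norm (\<kappa> \<alpha> x powr (- (1 + \<epsilon>)))"
      by (rule eventually_all_finite)
    then show ?thesis
    proof (rule eventually_mono, intro impI)
      fix x
      assume all: "\<forall>l. PP x < 1 \<longrightarrow> norm (jacobian (tilde \<alpha> k f_res) (at x) $ i $ l) \<le> d * norm (\<kappa> \<alpha> x powr (- (1 + \<epsilon>)))"
        and x: "PP x < 1"
      have "(1 - PP x) powr (1 + \<epsilon>) \<le> 1"
        using x PP_nonneg[of x] \<epsilon>_pos by (intro powr_le1) auto
      then have jac: "\<bar>jacobian (tilde \<alpha> k f_res) (at x) $ i $ l\<bar> \<le> d" for l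
      proof -
        have "\<bar>jacobian (tilde \<alpha> k f_res) (at x) $ i $ l\<bar> \<le> d * norm (\<kappa> \<alpha> x powr (- (1 + \<epsilon>)))"
          using all x by simp
        also have "\<dots> = d * (1 - PP x) powr (1 + \<epsilon>)" by (simp only: \<kappa>_powr[OF x]) simp
        also have "\<dots> \<le> d * 1" using \<open>(1 - PP x) powr (1 + \<epsilon>) \<le> 1\<close> d by (intro mult_left_mono) auto
        finally show ?thesis by simp
      qed
      have "\<bar>frechet_derivative (\<lambda>x. tilde \<alpha> k f_res x $ i) (at x) h\<bar>
        \<le> (\<Sum>l\<in>UNIV. \<bar>h $ l * jacobian (tilde \<alpha> k f_res) (at x) $ i $ l\<bar>)"
        unfolding frechet_derivative_tilde[OF x] by (rule sum_abs)
      also have "\<dots> \<le> (\<Sum>l\<in>UNIV. \<bar>h $ l\<bar> * d)"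
        by (rule sum_mono) (simp add: abs_mult mult_left_mono jac)
      also have "\<dots> = (s - 1) * d" by (simp add: s_def sum_distrib_right)
      also have "\<dots> \<le> s * d" using d by simp
      also have "\<dots> < e" using e s by (simp add: d_def)
      finally show "\<bar>frechet_derivative (\<lambda>x. tilde \<alpha> k f_res x $ i) (at x) h\<bar> < e" .
    qed
  qed
  note ext = C1_on_extend_by_zero[OF C1_PP T \<epsilon>_pos O o]
  show "C1_on UNIV (R i)" using ext(1) by (simp add: R_def[abs_def])
  show "PP z = 1 \<Longrightarrow> frechet_derivative (R i) (at z) = (\<lambda>h. 0)" using ext(2) by (simp add: R_def[abs_def])
qed

text \<open>By quasi-homogeneity the powers of \<open>\<kappa>\<close> cancel and the tilde
  operation leaves \<open>F\<close> unchanged. Only the residual part has to be extended across the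
  horizon.\<close>

lemma f_tilde_eq: "f_tilde \<alpha> k f F x $ i = F x $ i + R i x"
proof (cases "PP x < 1")
  case True
  then have \<kappa>: "\<kappa> \<alpha> x > 0" by (simp add: \<kappa>_PP)
  have "F (qscale \<alpha> (\<kappa> \<alpha> x) x) $ i = \<kappa> \<alpha> x powr (k + real (\<alpha> i)) * F x $ i"
    using qh \<kappa> by (simp add: quasi_homogeneous_def)
  then have "\<kappa> \<alpha> x powr (- (k + real (\<alpha> i))) * F (qscale \<alpha> (\<kappa> \<alpha> x) x) $ i = F x $ i"
    using \<kappa> by (simp flip: mult.assoc powr_add)
  moreover have "f_res y $ i = f y $ i - F y $ i" for y by (simp add: f_res)
  ultimately show ?thesis
    using True by (simp add: f_tilde_def DD_PP R_def tilde_def right_diff_distrib)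
next
  case False
  then show ?thesis by (simp add: f_tilde_def DD_PP R_def)
qed

lemma G_eq: "G x = (\<Sum>j\<in>UNIV. (x $ j) ^ (2 * \<beta> \<alpha> j - 1) / real (\<alpha> j) * (F x $ j + R j x))"
  by (simp add: GG_def f_tilde_eq)

lemma C1_G: "C1_on UNIV G"
  unfolding G_eq[abs_def] divide_inverse
  by (intro C1_on_sum C1_on_mult C1_on_add C1_on_power C1_on_const C1_component C1_on_nth[OF C1_F] C1_R) simp

definition scal :: "real^'n \<Rightarrow> real" where
  "scal x = 1 - (2 * real c - 1) / (2 * real c) * (1 - PP x)"

lemma g_eq: "g x $ i = scal x * (F x $ i + R i x) - G x * (real (\<alpha> i) * x $ i)"
  by (simp add: desing_def pp_power f_tilde_eq Lam_mult scal_def)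

lemma C1_g: "C1_on UNIV g"
proof -
  have "C1_on UNIV (\<lambda>x. \<chi> i. scal x * (F x $ i + R i x) - G x * (real (\<alpha> i) * x $ i))"
    unfolding scal_def
    by (intro C1_on_vec_lambda C1_on_diff C1_on_mult C1_on_add C1_on_const C1_PP C1_component C1_on_nth[OF C1_F] C1_R C1_G)
  then show ?thesis by (simp add: g_eq[symmetric])
qed

text \<open>As \<open>2 * \<beta>\<close> is \<open>2 c / \<alpha>\<close>, the derivative of
  \<open>PP\<close> along \<open>f_tilde\<close> is \<open>2 c G\<close>, and along
  \<open>Lam \<alpha> *v x\<close> it is \<open>2 c PP\<close>. The constant
  \<open>(2 c - 1) / (2 c)\<close> in the field is such that \<open>2 c scal - 2 c PP\<close> equals
  \<open>1 - PP\<close>.\<close>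

lemma dPP_g: "dPP x (g x) = G x * (1 - PP x)"
proof -
  have "dPP x (g x) = dPP x (scal x *\<^sub>R f_tilde \<alpha> k f F x - G x *\<^sub>R (Lam \<alpha> *v x))"
    by (simp add: desing_def pp_power scal_def)
  also have "\<dots> = scal x * dPP x (f_tilde \<alpha> k f F x) - G x * (2 * real c * PP x)"
    by (simp add: linear_diff[OF linear_dPP] linear_scale[OF linear_dPP] dPP_Lam)
  also have "dPP x (f_tilde \<alpha> k f F x) = 2 * real c * G x"
    by (simp add: dPP_def GG_def real_\<beta> sum_distrib_left algebra_simps)
  also have "scal x * (2 * real c * G x) - G x * (2 * real c * PP x) = G x * (1 - PP x)"
    using cc_pos by (simp add: scal_def field_simps)
  finally show ?thesis .
qed

text \<open>Along an orbit \<open>u = 1 - PP\<close> solves a linear equation with coefficient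
  bounded on compact time intervals, so a positive \<open>u\<close> cannot reach 0 in finite
  time.\<close>

lemma DD_invariant:
  assumes y: "solution g y" and y0: "y 0 \<in> DD \<alpha>"
  shows "\<forall>t\<ge>0. y t \<in> DD \<alpha>"
proof (intro allI impI, rule ccontr)
  fix t :: real assume t: "t \<ge> 0" and out: "y t \<notin> DD \<alpha>"
  define u where "u s = 1 - PP (y s)" for s
  have der: "(u has_vector_derivative - (G (y s) * u s)) (at s within {0..})" if "s \<ge> 0" for s
  proof -
    have "(y has_derivative (\<lambda>h. h *\<^sub>R g (y s))) (at s within {0..})"
      using solutionD[OF y that] by (simp add: has_vector_derivative_def)
    then have "((\<lambda>s. PP (y s)) has_derivative (\<lambda>h. dPP (y s) (h *\<^sub>R g (y s)))) (at s within {0..})"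
      by (rule has_derivative_compose[OF _ PP_has_derivative])
    then have "((\<lambda>s. PP (y s)) has_vector_derivative G (y s) * u s) (at s within {0..})"
      by (simp add: has_vector_derivative_def linear_scale[OF linear_dPP] dPP_g u_def)
    from has_vector_derivative_diff[OF has_vector_derivative_const this, of 1]
    show ?thesis by (simp add: u_def[abs_def])
  qed
  have ycont: "continuous_on {0..t} y" by (rule continuous_on_subset[OF solution_continuous[OF y]]) auto
  have ucont: "continuous_on {0..t} u"
    unfolding u_def by (intro continuous_intros continuous_on_compose2[OF C1_on_continuous[OF C1_PP[of UNIV]] ycont]) auto
  have "u 0 > 0" "u t \<le> 0" using y0 out by (auto simp: u_def DD_PP)
  then obtain \<tau> where \<tau>: "0 \<le> \<tau>" "\<tau> \<le> t" "u \<tau> = 0"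
    using IVT2'[of u t 0 0] t ucont by auto
  have "continuous_on {0..t} (\<lambda>s. G (y s))"
    by (rule continuous_on_compose2[OF C1_on_continuous[OF C1_G] ycont]) auto
  then have "bounded ((\<lambda>s. G (y s)) ` {0..t})"
    by (intro compact_imp_bounded compact_continuous_image) auto
  then obtain M where M: "\<forall>s\<in>{0..t}. \<bar>G (y s)\<bar> \<le> M" by (auto simp: bounded_iff)
  have "norm (u 0) \<le> exp (M * (\<tau> - 0)) * norm (u \<tau>)"
  proof (rule gronwall_two_sided(2)[OF der _ order_refl \<tau>(1)])
    fix s assume "0 < s" "s < \<tau>"
    then show "norm (- (G (y s) * u s)) \<le> M * norm (u s)"
      using bspec[OF M, of s] \<tau> by (simp add: abs_mult mult_right_mono)
  qed
  then show False using \<tau> \<open>u 0 > 0\<close> by simp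
qed

text \<open>The field extended by \<open>F\<close> is \<open>C1\<close> across the horizon, so the
  limit of its Jacobians from inside is the ordinary Jacobian.\<close>

lemma jacobian_g_horizon:
  assumes "x \<in> horizon \<alpha>"
  shows "jacobian_ext (DD \<alpha>) g x = jacobian g (at x)"
proof -
  have "x \<notin> DD \<alpha>" using assms by (simp add: DD_PP horizon_PP)
  moreover have "((\<lambda>y. jacobian g (at y)) \<longlongrightarrow> jacobian g (at x)) (at x within DD \<alpha>)"
  proof (intro vec_tendstoI)
    fix i l
    have "continuous_on UNIV (\<lambda>y. frechet_derivative g (at y) (axis l 1) $ i)"
      by (intro continuous_intros C1_on_frechet(2)[OF C1_g])
    then have "((\<lambda>y. frechet_derivative g (at y) (axis l 1) $ i) \<longlongrightarrow> frechet_derivative g (at x) (axis l 1) $ i) (at x within DD \<alpha>)"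
      using tendsto_within_subset[OF _ subset_UNIV] unfolding continuous_on_def by blast
    then show "((\<lambda>y. jacobian g (at y) $ i $ l) \<longlongrightarrow> jacobian g (at x) $ i $ l) (at x within DD \<alpha>)"
      by (simp add: jacobian_def matrix_def)
  qed
  ultimately show ?thesis
    unfolding jacobian_ext_def using tendsto_Lim[OF horizon_limpt_DD[OF assms]] by simp
qed

lemma jacobian_mult:
  fixes h :: "real^'n \<Rightarrow> real^'n"
  assumes "C1_on UNIV h"
  shows "jacobian h (at x) *v v = frechet_derivative h (at x) v"
  unfolding jacobian_def
  using has_derivative_linear[OF C1_on_frechet(1)[OF assms UNIV_I]] by (simp add: matrix_works)

section \<open>Quasi-homogeneity of the derivative and the spectrum at the equilibrium\<close>

lemma qscale_linear: "bounded_linear (qscale \<alpha> s)"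
proof -
  have "linear (qscale \<alpha> s)"
    by (rule linearI) (simp_all add: qscale_def vec_eq_iff algebra_simps)
  then show ?thesis by (rule linear_conv_bounded_linear[THEN iffD1])
qed

lemma F_has_derivative: "(F has_derivative frechet_derivative F (at x)) (at x)"
  by (rule C1_on_frechet(1)[OF C1_F]) simp

lemma F_component_has_derivative: "((\<lambda>x. F x $ i) has_derivative (\<lambda>h. frechet_derivative F (at x) h $ i)) (at x)"
  by (rule bounded_linear.has_derivative[OF bounded_linear_vec_nth F_has_derivative])

text \<open>Quasi-homogeneity is differentiated in \<open>s\<close> at \<open>s = 1\<close>; the
  curve \<open>qscale \<alpha> s x\<close> has velocity \<open>Lam \<alpha> *v x\<close>
  there.\<close>

lemma euler_identity: "frechet_derivative F (at x) (Lam \<alpha> *v x) $ i = (k + real (\<alpha> i)) * F x $ i"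
proof -
  have q1: "qscale \<alpha> 1 x = x" by (simp add: qscale_def)
  have "((\<lambda>s. qscale \<alpha> s x) has_derivative (\<lambda>h. h *\<^sub>R (Lam \<alpha> *v x))) (at 1)"
  proof (rule has_derivative_componentwise_within[THEN iffD2], rule ballI)
    fix b :: "real^'n" assume "b \<in> Basis"
    then obtain j where b: "b = axis j 1" by (auto simp: Basis_vec_def)
    have "((\<lambda>s. s ^ \<alpha> j * x $ j) has_derivative (\<lambda>h. h * (real (\<alpha> j) * x $ j))) (at 1)"
      by (auto intro!: derivative_eq_intros simp: algebra_simps)
    then show "((\<lambda>s. qscale \<alpha> s x \<bullet> b) has_derivative (\<lambda>h. h *\<^sub>R (Lam \<alpha> *v x) \<bullet> b)) (at 1)"
      by (simp add: b inner_axis qscale_def Lam_mult)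
  qed
  then have "((\<lambda>s. F (qscale \<alpha> s x) $ i) has_derivative
      (\<lambda>h. frechet_derivative F (at x) (h *\<^sub>R (Lam \<alpha> *v x)) $ i)) (at 1)"
    using has_derivative_compose[where g = "\<lambda>x. F x $ i" and f = "\<lambda>s. qscale \<alpha> s x" and x = 1 and s = UNIV]
      F_component_has_derivative[of i x] by (simp add: q1)
  then have "((\<lambda>s. F (qscale \<alpha> s x) $ i) has_real_derivative frechet_derivative F (at x) (Lam \<alpha> *v x) $ i) (at 1)"
    unfolding has_field_derivative_def
    by (simp add: linear_scale[OF has_derivative_linear[OF F_has_derivative]] mult_commute_abs)
  moreover have "((\<lambda>s. F (qscale \<alpha> s x) $ i) has_real_derivative (k + real (\<alpha> i)) * F x $ i) (at 1)"
  proof (rule DERIV_cong_ev[THEN iffD2, OF refl _ refl])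
    have "\<forall>\<^sub>F s in nhds (1::real). s \<in> {0<..}" by (rule eventually_nhds_in_open) auto
    then show "\<forall>\<^sub>F s in nhds 1. F (qscale \<alpha> s x) $ i = s powr (k + real (\<alpha> i)) * F x $ i"
      by eventually_elim (use qh in \<open>simp add: quasi_homogeneous_def\<close>)
    show "((\<lambda>s. s powr (k + real (\<alpha> i)) * F x $ i) has_real_derivative (k + real (\<alpha> i)) * F x $ i) (at 1)"
      by (auto intro!: derivative_eq_intros)
  qed
  ultimately show ?thesis by (rule DERIV_unique)
qed

text \<open>Quasi-homogeneity is differentiated in \<open>x\<close> at fixed \<open>s\<close>. This
  relates the derivatives of \<open>F\<close> at the horizon point and at the root of the balance
  law.\<close>

lemma F_derivative_qscale:
  assumes "s > 0"
  shows "frechet_derivative F (at (qscale \<alpha> s x)) (qscale \<alpha> s h) $ i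
    = s powr (k + real (\<alpha> i)) * frechet_derivative F (at x) h $ i"
proof -
  have "((\<lambda>x. F (qscale \<alpha> s x) $ i) has_derivative (\<lambda>h. frechet_derivative F (at (qscale \<alpha> s x)) (qscale \<alpha> s h) $ i)) (at x)"
    by (rule has_derivative_compose[OF bounded_linear_imp_has_derivative[OF qscale_linear] F_component_has_derivative])
  moreover have "(\<lambda>x. F (qscale \<alpha> s x) $ i) = (\<lambda>x. s powr (k + real (\<alpha> i)) * F x $ i)"
    using qh assms by (simp add: quasi_homogeneous_def)
  moreover have "((\<lambda>x. s powr (k + real (\<alpha> i)) * F x $ i) has_derivative
      (\<lambda>h. s powr (k + real (\<alpha> i)) * frechet_derivative F (at x) h $ i)) (at x)"
    by (rule has_derivative_mult_right[OF F_component_has_derivative])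
  ultimately have "(\<lambda>h. frechet_derivative F (at (qscale \<alpha> s x)) (qscale \<alpha> s h) $ i)
     = (\<lambda>h. s powr (k + real (\<alpha> i)) * frechet_derivative F (at x) h $ i)"
    by (metis has_derivative_unique)
  then show ?thesis by (rule fun_cong)
qed

text \<open>
  With \<open>v = Lam \<alpha> *v x\<close> and \<open>B = DF(x) - C Lam \<alpha>\<close>, the Jacobian of \<open>g\<close> at the equilibrium is \<open>B\<close> plus a
  rank one matrix with range spanned by \<open>v\<close>. By Euler's identity \<open>B v = k C v\<close>, while \<open>v\<close> is an
  eigenvector of the Jacobian for the eigenvalue \<open>- C\<close>, because \<open>dPP x\<close> is a left eigenvector for
  it. Finally \<open>A\<close> is conjugate to a positive multiple of \<open>B\<close>.
\<close>

lemma num_stable_eigenvalues_jacobian_g: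
  assumes x: "x \<in> horizon \<alpha>" and gx: "g x = 0" and k: "k > 0" and C: "C = G x" "C > 0"
    and r: "r = (k * C) powr (- 1 / k)"
    and A: "A = (- (1 / k)) *\<^sub>R Lam \<alpha> + jacobian F (at (qscale \<alpha> r x))"
  shows "num_stable_eigenvalues (jacobian g (at x)) = num_stable_eigenvalues A + 1"
proof -
  have P: "PP x = 1" using x by (simp add: horizon_PP)
  define sc where "sc = (2 * real c - 1) / (2 * real c)"
  let ?DF = "frechet_derivative F (at x)" and ?DG = "frechet_derivative G (at x)"
  define v where "v = Lam \<alpha> *v x"
  \<comment> \<open>The product rule differentiates the two scalar factors \<open>scal\<close> and
    \<open>G\<close>. At the equilibrium \<open>f_tilde\<close> equals \<open>C\<close> times
    \<open>v\<close>, so both contributions point along \<open>v\<close>.\<close>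
  define w where "w h = sc * dPP x h * C - ?DG h" for h
  define J B where "J = jacobian g (at x)" and "B = jacobian F (at x) - C *\<^sub>R Lam \<alpha>"
  have scal: "scal x = 1" and Rx: "R i x = 0" for i by (simp_all add: scal_def P R_def)
  have Fx: "F x $ i = C * v $ i" for i
    using g_eq[of x i] gx by (simp add: scal Rx C v_def Lam_mult)
  have dscal: "(scal has_derivative (\<lambda>h. sc * dPP x h)) (at x)"
    unfolding scal_def[abs_def] sc_def using cc_pos
    by (auto intro!: derivative_eq_intros PP_has_derivative)
  have dG: "(G has_derivative ?DG) (at x)" by (rule C1_on_frechet(1)[OF C1_G]) simp
  have dR: "(R i has_derivative (\<lambda>h. 0)) (at x)" for i
    using C1_on_frechet(1)[OF C1_R, of x i] by (simp add: R_derivative[OF P])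
  have dg: "((\<lambda>x. g x $ i) has_derivative (\<lambda>h. ?DF h $ i - C * (real (\<alpha> i) * h $ i) + w h * v $ i)) (at x)" for i
    unfolding g_eq
    by (rule has_derivative_eq_rhs, rule has_derivative_diff,
        rule has_derivative_mult[OF dscal has_derivative_add[OF F_component_has_derivative dR]],
        rule has_derivative_mult[OF dG has_derivative_mult_right[OF bounded_linear_imp_has_derivative[OF bounded_linear_vec_nth]]])
       (simp add: fun_eq_iff scal Rx Fx w_def v_def Lam_mult C(1) algebra_simps)
  have J: "J *v h = B *v h + w h *\<^sub>R v" for h
  proof -
    have "(J *v h) $ i = ?DF h $ i - C * (real (\<alpha> i) * h $ i) + w h * v $ i" for i
    proof -
      have "((\<lambda>x. g x $ i) has_derivative (\<lambda>h. frechet_derivative g (at x) h $ i)) (at x)"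
        by (rule bounded_linear.has_derivative[OF bounded_linear_vec_nth C1_on_frechet(1)[OF C1_g UNIV_I]])
      from fun_cong[OF has_derivative_unique[OF this dg], of h]
      show ?thesis by (simp add: J_def jacobian_mult[OF C1_g])
    qed
    then show ?thesis
      by (simp add: vec_eq_iff B_def matrix_vector_mult_diff_rdistrib jacobian_mult[OF C1_F]
          scaleR_matrix_vector_assoc[symmetric] Lam_mult)
  qed
  have Bv: "B *v v = (k * C) *\<^sub>R v"
  proof -
    have "(B *v v) $ i = ?DF v $ i - C * (real (\<alpha> i) * v $ i)" for i
      by (simp add: B_def matrix_vector_mult_diff_rdistrib jacobian_mult[OF C1_F]
          scaleR_matrix_vector_assoc[symmetric] Lam_mult)
    moreover have "?DF v $ i = (k + real (\<alpha> i)) * (C * v $ i)" for i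
      unfolding Fx[symmetric] by (simp only: v_def euler_identity)
    ultimately show ?thesis by (simp add: vec_eq_iff algebra_simps)
  qed
  have linw: "linear w"
    unfolding w_def using linear_dPP[of x] has_derivative_linear[OF dG]
    by (intro linearI) (simp_all add: linear_add linear_scale algebra_simps)
  \<comment> \<open>Both sides of \<open>dPP_g\<close> are differentiated at the equilibrium:
    \<open>g x = 0\<close> removes the derivative of \<open>dPP\<close>, and \<open>PP x = 1\<close>
    removes that of \<open>G\<close>.\<close>
  have left: "dPP x (J *v h) = - C * dPP x h" for h
  proof -
    have q: "C1_on UNIV (\<lambda>x::real^'n. 2 * real (\<beta> \<alpha> i) * (x $ i) ^ (2 * \<beta> \<alpha> i - 1))" for i
      by (intro C1_on_mult C1_on_const C1_on_power C1_component)
    have dgJ: "((\<lambda>x. g x $ i) has_derivative (\<lambda>h. (J *v h) $ i)) (at x)" for i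
      unfolding J_def jacobian_mult[OF C1_g]
      by (rule bounded_linear.has_derivative[OF bounded_linear_vec_nth C1_on_frechet(1)[OF C1_g UNIV_I]])
    have "((\<lambda>x. dPP x (g x)) has_derivative (\<lambda>h. dPP x (J *v h))) (at x)"
      unfolding dPP_def
      by (rule has_derivative_eq_rhs, rule has_derivative_sum,
          rule has_derivative_mult[OF C1_on_frechet(1)[OF q UNIV_I] dgJ])
         (simp add: gx)
    moreover have "((\<lambda>x. dPP x (g x)) has_derivative (\<lambda>h. - C * dPP x h)) (at x)"
      unfolding dPP_g
      by (rule has_derivative_eq_rhs,
          rule has_derivative_mult[OF dG has_derivative_diff[OF has_derivative_const PP_has_derivative]])
         (simp add: P C(1))
    ultimately show ?thesis using has_derivative_unique by (metis (no_types, lifting))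
  qed
  have dv: "dPP x v = 2 * real c" by (simp add: v_def dPP_Lam P)
  have v0: "v \<noteq> 0" using dv cc_pos linear_0[OF linear_dPP[of x]] by auto
  \<comment> \<open>That \<open>v\<close> is an eigenvector is clear from \<open>J\<close> and
    \<open>Bv\<close>. Pairing with the left eigenvector \<open>dPP x\<close>, which does not vanish
    on \<open>v\<close>, yields the eigenvalue without computing \<open>w v\<close>.\<close>
  have Jv: "J *v v = (- C) *\<^sub>R v"
  proof -
    have "J *v v = (k * C + w v) *\<^sub>R v" by (simp add: J Bv scaleR_add_left)
    then have "(k * C + w v) * dPP x v = - C * dPP x v"
      using left[of v] by (simp add: linear_scale[OF linear_dPP])
    then have "(k * C + w v + C) * (2 * real c) = 0" by (simp add: dv algebra_simps)
    then have "k * C + w v = - C" using cc_pos by simp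
    then show ?thesis using \<open>J *v v = (k * C + w v) *\<^sub>R v\<close> by simp
  qed
  have "num_stable_eigenvalues J = num_stable_eigenvalues B + 1"
    using k C by (intro num_stable_eigenvalues_rank_one_update[OF Bv linw J Jv v0]) auto
  moreover have "num_stable_eigenvalues A = num_stable_eigenvalues B"
  proof (rule num_stable_eigenvalues_conjugate)
    have kC: "k * C > 0" using k C by simp
    have r0: "r > 0" using k C(2) by (simp add: r)
    \<comment> \<open>This value of \<open>r\<close> turns the scaling factor
      \<open>r powr (k + \<alpha> i)\<close> into \<open>r ^ \<alpha> i / (k C)\<close>, which
      produces the positive factor \<open>1 / (k C)\<close> in the conjugation.\<close>
    have rk: "r powr k = 1 / (k * C)"
    proof -
      have "r powr k = (k * C) powr (- 1 / k * k)" unfolding r by (rule powr_powr)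
      also have "- 1 / k * k = - 1" using k by simp
      also have "(k * C) powr - 1 = 1 / (k * C)" using kC by (simp only: powr_minus_divide powr_one)
      finally show ?thesis .
    qed
    define S T where "S = matrix (qscale \<alpha> r)" and "T = matrix (qscale \<alpha> (1 / r))"
    have S: "S *v h = qscale \<alpha> r h" and T: "T *v h = qscale \<alpha> (1 / r) h" for h
      using bounded_linear.linear[OF qscale_linear] by (simp_all add: S_def T_def matrix_works)
    have "S ** T = mat 1" "T ** S = mat 1"
      using r0 by (simp_all add: matrix_eq matrix_vector_mul_assoc[symmetric] S T qscale_def power_divide vec_eq_iff)
    then show "invertible S" by (auto simp: invertible_def)
    show "A ** S = S ** ((1 / (k * C)) *\<^sub>R B)"
    proof (simp only: matrix_eq matrix_vector_mul_assoc[symmetric] S vec_eq_iff, intro allI)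
      fix h i
      have "(A *v qscale \<alpha> r h) $ i = - (1 / k) * (real (\<alpha> i) * (r ^ \<alpha> i * h $ i)) + r powr (k + real (\<alpha> i)) * ?DF h $ i"
        by (simp add: A matrix_vector_mult_diff_rdistrib scaleR_matrix_vector_assoc[symmetric] Lam_mult
            jacobian_mult[OF C1_F] F_derivative_qscale[OF r0]) (simp add: qscale_def)
      also have "r powr (k + real (\<alpha> i)) = 1 / (k * C) * r ^ \<alpha> i"
        using r0 by (simp add: powr_add rk powr_realpow)
      also have "- (1 / k) * (real (\<alpha> i) * (r ^ \<alpha> i * h $ i)) + 1 / (k * C) * r ^ \<alpha> i * ?DF h $ i
        = r ^ \<alpha> i * (1 / (k * C) * (?DF h $ i - C * (real (\<alpha> i) * h $ i)))"
        using k C(2) by (simp add: field_simps)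
      also have "\<dots> = qscale \<alpha> r (((1 / (k * C)) *\<^sub>R B) *v h) $ i"
        by (simp add: qscale_def B_def scaleR_matrix_vector_assoc[symmetric] matrix_vector_mult_diff_rdistrib
            jacobian_mult[OF C1_F] Lam_mult)
      finally show "(A *v qscale \<alpha> r h) $ i = qscale \<alpha> r (((1 / (k * C)) *\<^sub>R B) *v h) $ i" .
    qed
    show "1 / (k * C) > 0" using kC by simp
  qed
  ultimately show ?thesis by (simp add: J_def)
qed

end

theorem theorem3p22:
  fixes \<alpha> :: "'n::finite \<Rightarrow> nat"
    and k \<epsilon> C r :: real
    and f F f_res g :: "real^'n \<Rightarrow> real^'n"
    and xs Y0 :: "real^'n"
    and U :: "(real^'n) set"
    and A :: "real^'n^'n"
    and q m mA :: nat
  assumes \<alpha>_pos: "\<And>i. \<alpha> i > 0"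
    and k_pos: "k > 0"
    and f_smooth: "q \<ge> 2" "C_map q f"
    and f_asymp: "asymp_quasi_homogeneous \<alpha> k f F"
    and F_C1: "C_map 1 F"
    and f_res: "f_res = (\<lambda>x. f x - F x)"
    and g: "g = desing \<alpha> k f F"
    and \<epsilon>_pos: "\<epsilon> > 0"
    and res_O: "\<And>i. (\<lambda>x. tilde \<alpha> k f_res x $ i)
                  \<in> O[to_horizon \<alpha>](\<lambda>x. \<kappa> \<alpha> x powr (- (1 + \<epsilon>)))"
    and res_deriv_o: "\<And>i l. (\<lambda>x. jacobian (tilde \<alpha> k f_res) (at x) $ i $ l)
                  \<in> o[to_horizon \<alpha>](\<lambda>x. \<kappa> \<alpha> x powr (- (1 + \<epsilon>)))"
    and xs_horizon: "xs \<in> horizon \<alpha>"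
    and xs_equilibrium: "g xs = 0"
    and xs_hyperbolic: "hyperbolic_at (DD \<alpha>) g xs"
    and C: "C = GG \<alpha> k f F xs" "C > 0"
    and U: "nhd_in (DDbar \<alpha>) xs U"
    and W_meets_D: "W_s_loc (DDbar \<alpha>) g U xs \<inter> DD \<alpha> \<noteq> {}"
    and r: "r = (k * C) powr (- 1 / k)"
    and Y0: "Y0 = qscale \<alpha> r xs"
    and A: "A = (- (1 / k)) *\<^sub>R Lam \<alpha> + jacobian F (at Y0)"
    and m: "m = mdim (W_s_loc (DDbar \<alpha>) g U xs)"
    and mA: "mA = num_stable_eigenvalues A"
  shows "m = mA + 1"
proof -
  interpret d: desingularization \<alpha> k \<epsilon> f F f_res
  proof
    show "C1_on UNIV f" by (rule C_map_C1_on[OF f_smooth(2)]) (use f_smooth(1) in simp)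
    show "C1_on UNIV F" by (rule C_map_C1_on[OF F_C1]) simp
    show "quasi_homogeneous \<alpha> k F" using f_asymp by (simp add: asymp_quasi_homogeneous_def)
  qed (use \<alpha>_pos f_res \<epsilon>_pos res_O res_deriv_o in auto)
  define J where "J = jacobian g (at xs)"
  have C1_g: "C1_on UNIV g" unfolding g by (rule d.C1_g)
  have hyp: "Spec J \<inter> {z. Re z = 0} = {}"
    using xs_hyperbolic d.jacobian_g_horizon[OF xs_horizon] by (simp add: hyperbolic_at_def J_def g)
  show ?thesis
  proof (rule hyperbolic_splitting[OF hyp])
    fix V a Es Eu \<pi>
    assume s:
      "bilinear V" "\<And>x y. V x y = V y x" "a > 0" "\<And>x. V x (J *v x) \<le> - a * (x \<bullet> x)"
      "subspace Es" "subspace Eu" "dim Es = num_stable_eigenvalues J"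
      "linear \<pi>" "\<And>x. \<pi> x \<in> Es" "\<And>x. x - \<pi> x \<in> Eu" "\<And>x. x \<in> Es \<Longrightarrow> \<pi> x = x"
      "\<And>x. x \<in> Es \<Longrightarrow> a * (x \<bullet> x) \<le> V x x" "\<And>x. x \<in> Eu \<Longrightarrow> V x x \<le> - a * (x \<bullet> x)"
      "\<And>x y. x \<in> Es \<Longrightarrow> y \<in> Eu \<Longrightarrow> V x y = 0"
    \<comment> \<open>The locale is entered with \<open>a / 2\<close>, since the dimension theorem
      asks for decay of the linear part at twice the constant of the locale.\<close>
    have half: "a / 2 * (norm x)\<^sup>2 \<le> a * (x \<bullet> x)" for x :: "real^'n"
      using s(3) by (simp add: power2_norm_eq_inner mult_right_mono)
    interpret saddle_form V "a / 2" Es Eu \<pi>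
    proof (rule saddle_form.intro)
      show "a / 2 * (norm x)\<^sup>2 \<le> V x x" if "x \<in> Es" for x
        using s(12)[OF that] half[of x] by linarith
      show "V x x \<le> - (a / 2) * (norm x)\<^sup>2" if "x \<in> Eu" for x
        using s(13)[OF that] half[of x] by simp
    qed (use s in auto)
    obtain M where M: "M-lipschitz_on (DDbar \<alpha>) g"
      using C1_lipschitz_on_bounded[OF C1_g d.bounded_DDbar] by metis
    have "mdim (W_s_loc (DDbar \<alpha>) g U xs) = dim Es"
    proof (rule mdim_W_s_loc[where J = "(*v) J", OF _ _ xs_equilibrium _ M U d.open_DD _ _ W_meets_D])
      show "V x (J *v x) \<le> - (2 * (a / 2)) * (norm x)\<^sup>2" for x
        using s(4)[of x] by (simp add: power2_norm_eq_inner)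
      show "\<exists>\<rho>>0. \<forall>x\<in>cball xs \<rho>. \<forall>y\<in>cball xs \<rho>. norm (g x - g y - J *v (x - y)) \<le> \<delta> * norm (x - y)"
        if "\<delta> > 0" for \<delta>
        using C1_strict_differentiability[OF C1_g that, of xs] by (simp add: J_def d.jacobian_mult[OF C1_g])
      show "DD \<alpha> \<subseteq> DDbar \<alpha>" by (auto simp: d.DD_PP d.DDbar_PP)
      show "\<forall>t\<ge>0. y t \<in> DD \<alpha>" if "solution g y" "y 0 \<in> DD \<alpha>" for y
        using d.DD_invariant that by (simp add: g)
    qed simp
    also have "dim Es = mA + 1"
      unfolding s(7) J_def mA g
      by (rule d.num_stable_eigenvalues_jacobian_g[OF xs_horizon xs_equilibrium[unfolded g] k_pos C r A[unfolded Y0]])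
    finally show ?thesis by (simp add: m)
  qed
qed

end
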